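(* There exists a strictly decreasing and concave function $\mathfrak e_{\rm conv}:[0,1]\to[0,1]$, with $\mathfrak e_{\rm conv}(0)=(7+\sqrt{17})/16$, $\mathfrak e_{\rm conv}(1)=0$, and $(\beta,\mathfrak e_{\rm conv}(\beta))\in\mathcal D$ for all $\beta\in(0,1)$, such that for every $(\beta,\mathfrak e)\in\mathcal D$: $\mathfrak e<\mathfrak e_{\rm conv}(\beta)$ if and only if $\mathfrak M$ is strictly convex; $\mathfrak e=\mathfrak e_{\rm conv}(\beta)$ if and only if $\mathfrak M$ is convex but not strictly convex; $\mathfrak e>\mathfrak e_{\rm conv}(\beta)$ if and only if $\mathfrak M$ is not convex.
   Context: For $\varpi,\alpha>0$ consider $H(p_r,p_z,r,z)=\frac{p_r^2+p_z^2}{2}+\frac{\varpi^2}{2r^2}-\frac1r-\frac{4\alpha^{-1}}{(r^2+(1+2\alpha)z^2)^{1/2}}$ on $\mathbb R^2\times\mathbb R^+\times\mathbb R\subset\mathbb R^4$ and $\mathfrak M=H^{-1}(-1)\subset\mathbb R^4$. The parameters are $\beta=(1+4\alpha^{-1})^{-1}$ and $\mathfrak e=(1-2\varpi^2\beta^2)^{1/2}$, in one-to-one correspondence with $(\alpha,\varpi)$, and $\mathcal D=\{(\beta,\mathfrak e):0<\beta^2+\mathfrak e^2<1,\ \beta,\mathfrak e>0\}$; $(\beta,\mathfrak e)\in\mathcal D$ is equivalent to $\frac12<\varpi^2<\frac{(1+4\alpha^{-1})^2}{2}$, in which case $\mathfrak M$ is a regular hypersurface diffeomorphic to $S^3$.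 $\mathfrak M$ is convex if it bounds a convex subset of $\mathbb R^4$ (namely $\{H\le-1\}$), and strictly convex if moreover its second fundamental form is positive definite everywhere, i.e. the Hessian of $H$ is positive definite on $T_x\mathfrak M$ for every $x\in\mathfrak M$. *)

theory Defs
  imports "HOL-Analysis.Analysis"
begin

text \<open>
  Coordinates on \<open>real ^ 4\<close> are \<open>(p_r, p_z, r, z) = (x$1, x$2, x$3, x$4)\<close>. The parameters are
  written \<open>w\<close> (varpi) and \<open>a\<close> (alpha). The formula for the Hamiltonian is only
  meaningful on the open half space \<open>phase_space\<close>; every set below is cut down to it.
\<close>

definition phase_space :: "(real ^ 4) set" where
  "phase_space = {x. 0 < x $ 3}"

definition Ham :: "real \<Rightarrow> real \<Rightarrow> real ^ 4 \<Rightarrow> real" where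
  "Ham w a x =
     ((x $ 1)\<^sup>2 + (x $ 2)\<^sup>2) / 2 + w\<^sup>2 / (2 * (x $ 3)\<^sup>2) - 1 / x $ 3
       - (4 / a) / sqrt ((x $ 3)\<^sup>2 + (1 + 2 * a) * (x $ 4)\<^sup>2)"

definition energy_surface :: "real \<Rightarrow> real \<Rightarrow> (real ^ 4) set" where
  "energy_surface w a = {x \<in> phase_space. Ham w a x = -1}"

definition energy_sublevel :: "real \<Rightarrow> real \<Rightarrow> (real ^ 4) set" where
  "energy_sublevel w a = {x \<in> phase_space. Ham w a x \<le> -1}"

definition beta_par :: "real \<Rightarrow> real" where
  "beta_par a = inverse (1 + 4 / a)"

definition ecc_par :: "real \<Rightarrow> real \<Rightarrow> real" where
  "ecc_par w a = sqrt (1 - 2 * w\<^sup>2 * (beta_par a)\<^sup>2)"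

definition par_domain :: "(real \<times> real) set" where
  "par_domain = {(b, e). 0 < b\<^sup>2 + e\<^sup>2 \<and> b\<^sup>2 + e\<^sup>2 < 1 \<and> 0 < b \<and> 0 < e}"

definition hessian :: "('a::real_normed_vector \<Rightarrow> real) \<Rightarrow> 'a \<Rightarrow> 'a \<Rightarrow> 'a \<Rightarrow> real" where
  "hessian f x u v =
     frechet_derivative (\<lambda>y. frechet_derivative f (at y) u) (at x) v"

text \<open>
  Tangent space at \<open>x\<close> of the level set of \<open>f\<close> through \<open>x\<close>, for a regular point \<open>x\<close> of \<open>f\<close>.
\<close>

definition level_tangent :: "('a::real_normed_vector \<Rightarrow> real) \<Rightarrow> 'a \<Rightarrow> 'a set" where
  "level_tangent f x = {v. frechet_derivative f (at x) v = 0}"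

text \<open>
  The frontier is taken in all of \<open>real ^ 4\<close>, so convexity says that the surface is the full
  boundary of the convex set \<open>energy_sublevel\<close>.
\<close>

definition surface_convex :: "real \<Rightarrow> real \<Rightarrow> bool" where
  "surface_convex w a \<longleftrightarrow>
     frontier (energy_sublevel w a) = energy_surface w a \<and> convex (energy_sublevel w a)"

definition surface_strictly_convex :: "real \<Rightarrow> real \<Rightarrow> bool" where
  "surface_strictly_convex w a \<longleftrightarrow>
     surface_convex w a \<and>
     (\<forall>x \<in> energy_surface w a. \<forall>v \<in> level_tangent (Ham w a) x.
        v \<noteq> 0 \<longrightarrow> 0 < hessian (Ham w a) x v v)"

text \<open>
  Every pair in \<open>par_domain\<close> comes from exactly one pair of positive parameters, so quantifying
  over the pairs \<open>(w, a)\<close> belonging to a given \<open>(b, e)\<close> is neither vacuous nor ambiguous.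
\<close>

lemma par_correspondence:
  assumes "(b, e) \<in> par_domain"
  shows "\<exists>!(w, a). 0 < w \<and> 0 < a \<and> beta_par a = b \<and> ecc_par w a = e"
proof -
  have be: "0 < b" "0 < e" "b\<^sup>2 + e\<^sup>2 < 1"
    using assms by (auto simp: par_domain_def)
  have "b\<^sup>2 < 1" "e\<^sup>2 < 1"
    using be by (smt (verit) zero_le_power2)+
  then have b1: "b < 1" and e1: "e\<^sup>2 < 1"
    using be by (auto simp: abs_square_less_1)
  define a where "a = 4 * b / (1 - b)"
  define w where "w = sqrt ((1 - e\<^sup>2) / (2 * b\<^sup>2))"
  have a: "0 < a" and w: "0 < w"
    using be b1 e1 by (auto simp: a_def w_def)
  have ba: "beta_par a = b"
    using be b1 by (simp add: beta_par_def a_def field_simps)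
  have w2: "w\<^sup>2 = (1 - e\<^sup>2) / (2 * b\<^sup>2)"
    unfolding w_def using be e1 by (subst real_sqrt_pow2) auto
  have "1 - 2 * w\<^sup>2 * b\<^sup>2 = e\<^sup>2"
    using be by (simp add: w2 field_simps)
  then have ew: "ecc_par w a = e"
    using be by (simp add: ecc_par_def ba)
  show ?thesis
  proof (rule ex1I[of _ "(w, a)"])
    show "case (w, a) of (w, a) \<Rightarrow> 0 < w \<and> 0 < a \<and> beta_par a = b \<and> ecc_par w a = e"
      using a w ba ew by simp
  next
    fix p :: "real \<times> real"
    assume p: "case p of (w, a) \<Rightarrow> 0 < w \<and> 0 < a \<and> beta_par a = b \<and> ecc_par w a = e"
    obtain w' a' where pw: "p = (w', a')" by (cases p)
    have h: "0 < w'" "0 < a'" "beta_par a' = b" "ecc_par w' a' = e"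
      using p pw by auto
    have "1 + 4 / a' = 1 + 4 / a"
      using h(3) ba by (metis beta_par_def inverse_eq_iff_eq)
    then have aa: "a' = a"
      using h(2) a by (simp add: field_simps)
    have "1 - 2 * w'\<^sup>2 * b\<^sup>2 = 1 - 2 * w\<^sup>2 * b\<^sup>2"
      using h(3,4) ba ew by (metis ecc_par_def real_sqrt_eq_iff)
    then have "w'\<^sup>2 = w\<^sup>2"
      using be by simp
    then have "w' = w"
      using h(1) w by (simp add: power2_eq_iff_nonneg)
    then show "p = (w, a)"
      using pw aa by simp
  qed
qed

end

theory Submission
  imports Defs
begin

text \<open>
  On the tangent spaces of the energy surface the Hessian of the Hamiltonian is positive definite
  exactly if a determinant is positive over the Hill region. In suitable reduced variables
  \<open>(C, X)\<close> this determinant is a polynomial \<open>dform b C X S\<close>, affine in \<open>S = 1 - e^2\<close>, so for each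
  \<open>b\<close> there is a largest degenerate level \<open>Scrit b\<close>, and the critical eccentricity is
  \<open>sqrt (1 - Scrit b)\<close>.

  The maximum defining \<open>Scrit b\<close> is attained at an interior critical point. The critical equations
  can be solved explicitly in terms of \<open>k = C / sqrt (2 - C^2)\<close>; for \<open>b = 0\<close> they give
  \<open>2 * k^2 + k = 2\<close>, whence the value \<open>(7 + sqrt 17) / 16\<close>. Through each critical point there is a path
  \<open>(C(b), X(b))\<close> along which the degenerate level is convex in \<open>b\<close>, and it bounds \<open>Scrit\<close> from
  below; a maximum principle turns this into convexity of \<open>Scrit\<close>.

  Above the critical level the sublevel set is convex by a local-to-global argument, at the critical
  level by exhaustion, and below it a tangent direction of negative curvature destroys convexity.
\<close>

section \<open>The critical level\<close>

text \<open>The obstacle is the convexity of \<open>Scrit\<close>. Solving \<open>dform = 0\<close>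
  for \<open>S\<close> gives the level \<open>(3 * room - (3 * C^2 - 2) * X^3 / kap) / 4\<close>, in
  which \<open>room\<close> and \<open>kap\<close> are affine in \<open>b\<close> for fixed
  \<open>(C, X)\<close>. Where \<open>kap > 0\<close> this is convex in \<open>b\<close> if
  \<open>3 * C^2 \<le> 2\<close> but concave if \<open>3 * C^2 \<ge> 2\<close>, and maximizers of
  the second kind do occur, for instance at \<open>b = 0\<close>. So \<open>Scrit\<close> cannot
  simply be treated as a supremum of convex functions. For the second kind a path with constant
  \<open>room\<close> is followed instead. Its convexity is checked only on the curve of maximizers,
  which is why the critical equations are solved explicitly and why the sign of the second variation
  rests on numerical polynomial estimates. Each path serves only near its own maximizer, so the
  contradiction is drawn at a single point. All of this is done in the variable \<open>S\<close>, in
  which the determinant is affine; since the square root is increasing and concave, concavity of the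
  eccentricity follows at the end.\<close>

text \<open>
  Reduced variables for a configuration point at distance \<open>rho\<close> from the origin:
  \<open>C = r / rho\<close>, \<open>X = b * w^2 / r\<close> with \<open>b = beta_par a\<close>, and \<open>S = 2 * w^2 * b^2 = 1 - (ecc_par w a)^2\<close>.
  The Hill region is \<open>S \<le> room b C X\<close>, and \<open>dform b C X S\<close> is a positive multiple of the
  determinant that decides whether the Hessian is definite on the tangent space.
\<close>

definition hval :: "real \<Rightarrow> real \<Rightarrow> real" where
  "hval b C = b + (1 - b) * C"

definition room :: "real \<Rightarrow> real \<Rightarrow> real \<Rightarrow> real" where
  "room b C X = X * (2 * hval b C - X)"

text \<open>Up to a positive factor, \<open>- kap\<close> is the determinant of the Hessian of the
  potential, as the computation in \<open>curv_eq_dform\<close> shows. This determinant multiplies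
  the Hill function, whence the slope \<open>4 * kap\<close> of \<open>dform\<close> in
  \<open>S\<close>.\<close>

definition kap :: "real \<Rightarrow> real \<Rightarrow> real \<Rightarrow> real" where
  "kap b C X = (3 * C^2 - 2) * (2 * b - 3 * X) + 2 * (1 - b) * C^3"

definition dform :: "real \<Rightarrow> real \<Rightarrow> real \<Rightarrow> real \<Rightarrow> real" where
  "dform b C X S = kap b C X * (4 * S - 3 * room b C X) + (3 * C^2 - 2) * X^3"

text \<open>The condition \<open>0 \<le> kap\<close> excludes the circular orbit \<open>C = X = S = 1\<close>, where \<open>dform\<close> vanishes
  for a spurious reason; \<open>bad_point_le_Scrit\<close> shows that it loses nothing else.\<close>

definition degen :: "real \<Rightarrow> real \<Rightarrow> real \<Rightarrow> real \<Rightarrow> bool" where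
  "degen b C X S \<longleftrightarrow> 0 \<le> C \<and> C \<le> 1 \<and> 0 \<le> X \<and> 0 \<le> S \<and> S \<le> room b C X
     \<and> 0 \<le> kap b C X \<and> dform b C X S \<le> 0"

definition Scrit :: "real \<Rightarrow> real" where
  "Scrit b = Sup {S. \<exists>C X. degen b C X S}"

lemma hval_le_1 [extraction_expand]: "0 \<le> b \<Longrightarrow> b \<le> 1 \<Longrightarrow> 0 \<le> C \<Longrightarrow> C \<le> 1 \<Longrightarrow> hval b C \<le> 1"
  unfolding hval_def using mult_left_mono[of C 1 "1 - b"] by simp

lemma hval_ge [extraction_expand]: "b \<le> 1 \<Longrightarrow> 0 \<le> C \<Longrightarrow> b \<le> hval b C"
  unfolding hval_def by simp

lemma room_le_sq [extraction_expand]: "room b C X \<le> (hval b C)^2"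
proof -
  have "0 \<le> (X - hval b C)^2" by simp
  then show ?thesis unfolding room_def by (simp add: power2_eq_square algebra_simps)
qed

lemma room_reflect [extraction_expand]: "room b C (2 * hval b C - X) = room b C X"
  unfolding room_def by (simp add: algebra_simps)

lemma degen_bounds [extraction_expand]:
  assumes "0 \<le> b" "b \<le> 1" "degen b C X S"
  shows "X \<le> 2" "S \<le> 1"
proof -
  have h: "hval b C \<le> 1" "0 \<le> hval b C"
    using assms hval_le_1 hval_ge[of b C] by (auto simp: degen_def)
  have "S \<le> (hval b C)^2"
    using assms room_le_sq[of b C X] by (simp add: degen_def)
  also have "\<dots> \<le> 1" using h by (simp add: power_le_one)
  finally show "S \<le> 1" .
  show "X \<le> 2"
  proof (rule ccontr)
    assume "\<not> X \<le> 2"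
    then have "X * (2 * hval b C - X) < 0" using h by (intro mult_pos_neg) auto
    then show False using assms by (simp add: degen_def room_def)
  qed
qed

definition degen_set :: "(real \<times> real \<times> real \<times> real) set" where
  "degen_set = {p. 0 \<le> fst p \<and> fst p \<le> 1
     \<and> degen (fst p) (fst (snd p)) (fst (snd (snd p))) (snd (snd (snd p)))}"

text \<open>Compactness holds with \<open>b\<close> as one of the variables. This gives attainment
  of \<open>Scrit b\<close> for each \<open>b\<close>, and also lets the maximum principle in
  \<open>Scrit_convex\<close> run over an interval of \<open>b\<close>.\<close>

lemma compact_degen_set [extraction_expand]: "compact degen_set"
proof -
  let ?B = "{0..1} \<times> {0..1} \<times> {0..2} \<times> {0..1::real} :: (real \<times> real \<times> real \<times> real) set"
  have "closed degen_set"
    unfolding degen_set_def degen_def dform_def kap_def room_def hval_def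
    by (intro closed_Collect_conj closed_Collect_le continuous_intros)
  moreover have "compact ?B"
    by (intro compact_Times compact_Icc)
  moreover have "degen_set \<subseteq> ?B"
  proof
    fix p assume "p \<in> degen_set"
    then show "p \<in> ?B"
      using degen_bounds[of "fst p" "fst (snd p)" "fst (snd (snd p))" "snd (snd (snd p))"]
      by (simp add: degen_set_def degen_def mem_Times_iff)
  qed
  ultimately show ?thesis using compact_Int_closed[of ?B degen_set] by (simp add: Int_absorb1)
qed

lemma degen_zero [extraction_expand]: "0 \<le> b \<Longrightarrow> b \<le> 1 \<Longrightarrow> degen b 1 0 0"
  by (simp add: degen_def room_def kap_def dform_def hval_def)

lemma Scrit_upper [extraction_expand]:
  assumes "0 \<le> b" "b \<le> 1" "degen b C X S"
  shows "S \<le> Scrit b"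
  unfolding Scrit_def
proof (rule cSup_upper)
  show "bdd_above {S. \<exists>C X. degen b C X S}"
    using degen_bounds(2)[OF assms(1,2)] by (intro bdd_aboveI[of _ 1]) auto
qed (use assms in auto)

lemma Scrit_attained [extraction_expand]:
  assumes b: "0 \<le> b" "b \<le> 1"
  obtains C X where "degen b C X (Scrit b)"
proof -
  let ?K = "degen_set \<inter> {p. fst p = b}"
  have "compact ?K"
    by (intro compact_Int_closed compact_degen_set closed_Collect_eq continuous_intros)
  moreover have "(b, 1, 0, 0) \<in> ?K" using b degen_zero by (simp add: degen_set_def)
  moreover have "continuous_on ?K (\<lambda>p. snd (snd (snd p)))" by (intro continuous_intros)
  ultimately obtain p where p: "p \<in> ?K" "\<And>q. q \<in> ?K \<Longrightarrow> snd (snd (snd q)) \<le> snd (snd (snd p))"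
    using continuous_attains_sup[of ?K "\<lambda>p. snd (snd (snd p))"] by blast
  obtain C X S where pp: "p = (b, C, X, S)" using p(1) by (cases p) auto
  have d: "degen b C X S" using p(1) pp by (simp add: degen_set_def)
  have "Scrit b \<le> S"
    unfolding Scrit_def
  proof (rule cSup_least)
    show "{S. \<exists>C X. degen b C X S} \<noteq> {}" using d by auto
    fix S' assume "S' \<in> {S. \<exists>C X. degen b C X S}"
    then obtain C' X' where "degen b C' X' S'" by auto
    then show "S' \<le> S" using p(2)[of "(b, C', X', S')"] b pp by (simp add: degen_set_def)
  qed
  then have "S = Scrit b" using Scrit_upper[OF b d] by simp
  then show ?thesis using that d by simp
qed

lemma Scrit_le_1 [extraction_expand]: "0 \<le> b \<Longrightarrow> b \<le> 1 \<Longrightarrow> Scrit b \<le> 1"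
  using Scrit_attained degen_bounds(2) by metis

lemma Scrit_1 [extraction_expand]: "Scrit 1 = 1"
proof -
  have "degen 1 0 1 1" by (simp add: degen_def room_def kap_def dform_def hval_def)
  then show ?thesis using Scrit_upper[of 1] Scrit_le_1[of 1] by fastforce
qed

lemma dform_shift [extraction_expand]: "dform b C X S' = dform b C X S + 4 * kap b C X * (S' - S)"
  unfolding dform_def by (simp add: algebra_simps)

text \<open>The determinant condition is affine in \<open>S\<close> with slope \<open>kap\<close>, so a strict failure
  survives an increase of \<open>S\<close>.\<close>

lemma Scrit_greater [extraction_expand]:
  assumes "0 \<le> b" "b \<le> 1" "0 \<le> C" "C \<le> 1" "0 \<le> X" "0 \<le> S" "S < room b C X"
    and k: "0 < kap b C X" and "dform b C X S < 0"
  shows "S < Scrit b"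
proof -
  define S' where "S' = min (room b C X) (S - dform b C X S / (4 * kap b C X))"
  have "0 < - dform b C X S / (4 * kap b C X)" using assms by (intro divide_pos_pos) auto
  then have S': "S < S'" "S' \<le> room b C X" "S' \<le> S - dform b C X S / (4 * kap b C X)"
    using assms by (auto simp: S'_def)
  have "4 * kap b C X * (S' - S) \<le> 4 * kap b C X * (- dform b C X S / (4 * kap b C X))"
    using S'(3) k by (intro mult_left_mono) auto
  also have "\<dots> = - dform b C X S" using k by simp
  finally have "dform b C X S' \<le> 0" using dform_shift[of b C X S' S] by simp
  then have "degen b C X S'" using assms S' by (simp add: degen_def)
  then show ?thesis using Scrit_upper[OF assms(1,2)] S'(1) by force
qed

text \<open>The boundary curvature \<open>lamb\<close> of the Hill region: it governs \<open>dform\<close> where \<open>S = room\<close>.\<close>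

definition lamb :: "real \<Rightarrow> real \<Rightarrow> real \<Rightarrow> real" where
  "lamb b C s = (3 * C^2 - 2) * s^2 - (1 - b) * C * (1 - C^2) * s + (1 - b) * C * (1 - C^2) * hval b C"

lemma dform_eq_lamb [extraction_expand]:
  "dform b C X S = 4 * (kap b C X * (S - room b C X) + X * lamb b C (X - hval b C))"
  unfolding dform_def lamb_def kap_def room_def hval_def by algebra

lemma room_eq_sq [extraction_expand]: "room b C X = (hval b C)^2 - (X - hval b C)^2"
  unfolding room_def by (simp add: power2_eq_square algebra_simps)

lemma kap_alt [extraction_expand]: "kap b C X = (2 - 3 * C^2) * (3 * X - 2 * b) + 2 * (1 - b) * C^3"
  unfolding kap_def by (simp add: algebra_simps)

lemma lamb_reflect [extraction_expand]: "lamb b C (- s) = lamb b C s + 2 * ((1 - b) * C * (1 - C^2) * s)"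
  unfolding lamb_def by (simp add: algebra_simps)

text \<open>Where \<open>kap < 0\<close> the form decreases in \<open>S\<close>, so failure persists
  up to \<open>S = room\<close>, where it means \<open>lamb \<le> 0\<close>. If
  \<open>3 * C^2 \<ge> 2\<close>, \<open>lamb\<close> is a sum of nonnegative terms and only the
  circular orbit remains. Otherwise \<open>s < 0\<close>, and the reflection
  \<open>X \<mapsto> 2 * hval - X\<close> keeps \<open>room\<close>, does not increase
  \<open>lamb\<close> and makes \<open>kap\<close> nonnegative, so \<open>room\<close> itself is a
  degenerate level.\<close>

lemma bad_point_le_Scrit [extraction_expand]:
  assumes b: "0 < b" "b < 1" and C: "0 < C" "C \<le> 1" and X: "0 < X"
    and S: "0 \<le> S" "S < 1" "S \<le> room b C X" and E: "dform b C X S \<le> 0"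
  shows "S \<le> Scrit b"
proof (cases "0 \<le> kap b C X")
  case True
  then show ?thesis using assms Scrit_upper[of b C X S] by (simp add: degen_def)
next
  case False
  define s where "s = X - hval b C"
  have H0: "0 < hval b C" using b C unfolding hval_def by (simp add: add_pos_pos)
  have H1: "hval b C \<le> 1" using hval_le_1 b C by simp
  have "0 \<le> X * (2 * hval b C - X)" using S unfolding room_def by simp
  then have sH: "s \<le> hval b C" using X unfolding s_def by (simp add: zero_le_mult_iff)
  have C2: "C^2 \<le> 1" using C by (simp add: power_le_one)
  have d0: "0 \<le> (1 - b) * C * (1 - C^2)" using b C C2 by simp
  have "0 \<le> kap b C X * (S - room b C X)" using False S by (intro mult_nonpos_nonpos) auto
  moreover have "kap b C X * (S - room b C X) + X * lamb b C s \<le> 0"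
    using E unfolding dform_eq_lamb s_def by simp
  ultimately have L: "X * lamb b C s \<le> 0" "kap b C X * (S - room b C X) \<le> - (X * lamb b C s)" by linarith+
  then have L0: "lamb b C s \<le> 0" using X by (simp add: mult_le_0_iff)
  have lam: "lamb b C s = (3 * C^2 - 2) * s^2 + (1 - b) * C * (1 - C^2) * (hval b C - s)"
    unfolding lamb_def by (simp add: algebra_simps)
  show ?thesis
  proof (cases "2 \<le> 3 * C^2")
    case True
    have p: "0 \<le> (3 * C^2 - 2) * s^2" "0 \<le> (1 - b) * C * (1 - C^2) * (hval b C - s)"
      using True d0 sH by (simp_all)
    then have z: "(3 * C^2 - 2) * s^2 = 0" "(1 - b) * C * (1 - C^2) * (hval b C - s) = 0"
      using L0 lam by linarith+
    have "s = 0 \<and> C = 1"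
    proof (cases "C = 1")
      case True then show ?thesis using z by simp
    next
      case False
      then have "C^2 < 1" using C by (simp add: power_less_one_iff)
      then have "hval b C = s" using z(2) b C by simp
      then have "3 * C^2 = 2" using z(1) H0 by simp
      then have "kap b C X > 0" unfolding kap_def using b C by simp
      then show ?thesis using \<open>\<not> 0 \<le> kap b C X\<close> by simp
    qed
    \<comment> \<open>This is the circular orbit; here \<open>L(2)\<close> would force
      \<open>S \<ge> 1\<close>, against \<open>S < 1\<close>.\<close>
    then have eq: "C = 1" "X = 1" using s_def by (auto simp: hval_def)
    then have "kap b C X = -1" "room b C X = 1" "lamb b C s = 0"
      using \<open>s = 0 \<and> C = 1\<close> by (simp_all add: kap_def room_def hval_def lamb_def)
    then show ?thesis using L(2) S by simp
  next
    case n: False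
    have s0: "s < 0"
    proof (rule ccontr)
      assume "\<not> s < 0"
      then have "b \<le> X" using hval_ge[of b C] b C unfolding s_def by simp
      then have "0 \<le> (2 - 3 * C^2) * (3 * X - 2 * b)" using n b by (intro mult_nonneg_nonneg) auto
      moreover have "0 \<le> 2 * (1 - b) * C^3" using b C by simp
      ultimately have "0 \<le> kap b C X" unfolding kap_alt by linarith
      then show False using False by simp
    qed
    define X' where "X' = 2 * hval b C - X"
    have X': "X' - hval b C = - s" "hval b C \<le> X'" using s0 by (auto simp: X'_def s_def)
    have "lamb b C (- s) \<le> lamb b C s"
      unfolding lamb_reflect using d0 s0 by (simp add: mult_nonneg_nonpos)
    then have L': "lamb b C (- s) \<le> 0" using L0 by simp
    have "b \<le> X'" using hval_ge[of b C] b C X' by simp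
    then have "0 \<le> (2 - 3 * C^2) * (3 * X' - 2 * b)" using n b by (intro mult_nonneg_nonneg) auto
    moreover have "0 \<le> 2 * (1 - b) * C^3" using b C by simp
    ultimately have k': "0 \<le> kap b C X'" unfolding kap_alt by linarith
    have r': "room b C X' = room b C X" unfolding X'_def by (rule room_reflect)
    have "dform b C X' (room b C X) = 4 * (X' * lamb b C (- s))"
      unfolding dform_eq_lamb X'(1) r' by simp
    also have "\<dots> \<le> 0" using L' \<open>b \<le> X'\<close> b by (simp add: mult_nonneg_nonpos)
    finally have "degen b C X' (room b C X)"
      using C b \<open>b \<le> X'\<close> S k' r' by (simp add: degen_def)
    then show ?thesis using Scrit_upper[of b C X' "room b C X"] b S by simp
  qed
qed

section \<open>A priori lower bounds for the critical level\<close>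

text \<open>At \<open>3 * C^2 = 2\<close> the last term of \<open>dform\<close> vanishes, so the
  degenerate level is \<open>3/4 * room\<close>, which is largest at
  \<open>X = hval\<close>.\<close>

lemma Scrit_lower_three_quarters [extraction_expand]:
  assumes "0 \<le> b" "b < 1"
  shows "3 / 4 * (hval b (sqrt (2/3)))^2 \<le> Scrit b"
proof -
  define C where "C = sqrt (2/3 :: real)"
  have C2: "C^2 = 2/3" by (simp add: C_def)
  then have C: "3 * C^2 - 2 = 0" "0 < C" "C \<le> 1" unfolding C2 by (simp_all add: C_def)
  have k: "kap b C (hval b C) = 2 * (1 - b) * C^3" unfolding kap_def C(1) by simp
  have "dform b C (hval b C) (3/4 * (hval b C)^2) = 0"
    unfolding dform_def C(1) room_def by (simp add: power2_eq_square)
  moreover have "room b C (hval b C) = (hval b C)^2" unfolding room_def by (simp add: power2_eq_square)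
  moreover have "b \<le> hval b C" using hval_ge assms C by simp
  ultimately have "degen b C (hval b C) (3/4 * (hval b C)^2)"
    using C(2,3) assms k by (simp add: degen_def)
  then show ?thesis using Scrit_upper[of b] assms unfolding C_def by force
qed

text \<open>On \<open>C = 1\<close>, that is \<open>z = 0\<close>, no level above \<open>1/2\<close>
  is degenerate, so this bound keeps the maximizers away from that face.\<close>

lemma Scrit_gt_half [extraction_expand]:
  assumes b: "0 \<le> b" "b < 1"
  shows "1 / 2 < Scrit b"
proof (cases "b = 0")
  case True
  \<comment> \<open>At \<open>b = 0\<close> the bound \<open>3/4 * hval^2\<close> is exactly
    \<open>1/2\<close>. The strict inequality comes from a rational point close to the
    maximizer.\<close>
  have "degen 0 (7/8) (3/4) (103/200)"
    by (simp add: degen_def kap_def dform_def room_def hval_def power2_eq_square power3_eq_cube)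
  then show ?thesis using Scrit_upper[of 0 "7/8" "3/4" "103/200"] True by simp
next
  case False
  define C where "C = sqrt (2/3 :: real)"
  have C: "C^2 = 2/3" "0 < C" "C < 1" by (simp_all add: C_def)
  have "hval b C = C + b * (1 - C)" unfolding hval_def by (simp add: algebra_simps)
  moreover have "0 < b * (1 - C)" using b False C by simp
  ultimately have "C < hval b C" by simp
  then have "C^2 < (hval b C)^2" using C by (intro power_strict_mono) auto
  then show ?thesis using Scrit_lower_three_quarters[OF b] C unfolding C_def by simp
qed

text \<open>With \<open>S = 1 - e^2\<close> this is the domain condition
  \<open>b^2 + e^2 < 1\<close> for the critical eccentricity. It also excludes maximizers with
  \<open>C = 0\<close>, where \<open>room \<le> b^2\<close>.\<close>

lemma Scrit_gt_square [extraction_expand]: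
  assumes b: "0 \<le> b" "b < 1"
  shows "b^2 < Scrit b"
proof -
  \<comment> \<open>For this \<open>C\<close> and \<open>X = hval\<close>, the form at
    \<open>S = b^2\<close> is minus a polynomial in \<open>b\<close> and \<open>d\<close> with
    positive coefficients.\<close>
  define C where "C = sqrt (1/2 :: real)"
  have C: "C^2 = 1/2" "0 < C" "C \<le> 1" by (simp_all add: C_def real_sqrt_le_1_iff)
  define d where "d = (1 - b) * C"
  have d: "0 < d" using b C by (simp add: d_def)
  have H: "hval b C = b + d" by (simp add: hval_def d_def)
  have C3: "C^3 = C / 2" using C by (simp add: power3_eq_cube power2_eq_square)
  have k: "kap b C (b + d) = (b + 5 * d) / 2"
    unfolding kap_def by (simp add: C C3 d_def algebra_simps)
  have r: "room b C (b + d) = (b + d)^2" unfolding room_def H by (simp add: power2_eq_square)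
  have "dform b C (b + d) (b^2) = - (2 * b^2 * d + 18 * b * d^2 + 8 * d^3)"
    unfolding dform_def k r C by (simp add: field_simps power2_eq_square power3_eq_cube)
  moreover have "0 < 2 * b^2 * d + 18 * b * d^2 + 8 * d^3"
    using b d by (intro add_nonneg_pos add_nonneg_nonneg) auto
  ultimately have E: "dform b C (b + d) (b^2) < 0" by simp
  have "b^2 < (b + d)^2" using b d by (intro power_strict_mono) auto
  then show ?thesis using Scrit_greater[of b C "b + d" "b^2"] E b d C k r by simp
qed

section \<open>Maximizers\<close>

text \<open>Otherwise a path from the boundary into the Hill region would reach a higher degenerate
  level: \<open>dform\<close> starts at \<open>4 * X * lamb\<close>, and if \<open>lamb = 0\<close>
  its derivative along the path is negative.\<close>

lemma boundary_below_Scrit [extraction_expand]: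
  assumes b: "0 \<le> b" "b < 1" and C: "0 < C" "C < 1" and s: "0 < s"
    and S: "S = room b C (hval b C + s)" "0 \<le> S" and L: "lamb b C s \<le> 0"
  shows "S < Scrit b"
proof (rule ccontr)
  assume not: "\<not> S < Scrit b"
  define X where "X = hval b C + s"
  define N where "N = 2 - 3 * C^2"
  define D where "D = (1 - b) * C * (1 - C^2)"
  have C2: "C^2 < 1" using C by (simp add: power_less_one_iff)
  have D: "0 < D" using b C C2 by (simp add: D_def)
  have H: "0 < hval b C" "b \<le> hval b C"
    using b C hval_ge[of b C] unfolding hval_def by (simp_all add: add_nonneg_pos)
  have X: "s < X" "0 < X" "b < X" using s H by (auto simp: X_def)
  have SX: "S = (hval b C + s) * (hval b C - s)"
    using S unfolding room_def by (simp add: algebra_simps)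
  then have sH: "s \<le> hval b C" using S(2) H s by (simp add: zero_le_mult_iff)
  have lam: "lamb b C t = D * (hval b C - t) - N * t^2" for t
    unfolding lamb_def D_def N_def by (simp add: algebra_simps)
  have "0 \<le> D * (hval b C - s)" using D sH by simp
  then have N0: "0 < N"
  proof -
    have "D * (hval b C - s) \<le> N * s^2" using L lam by simp
    then have "0 \<le> N" using \<open>0 \<le> D * (hval b C - s)\<close> s
      by (metis (no_types) order_trans mult_less_0_iff not_le zero_less_power)
    moreover have "N \<noteq> 0"
    proof
      assume "N = 0"
      then have "hval b C = s" using \<open>D * (hval b C - s) \<le> N * s^2\<close> D sH
        by (simp add: mult_le_0_iff)
      then have "S = 0" using SX by simp
      then show False using not Scrit_gt_half[OF b] by simp
    qed
    ultimately show ?thesis by simp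
  qed
  have k0: "0 < kap b C Y" if "b \<le> Y" for Y
  proof -
    have "0 \<le> N * (3 * Y - 2 * b)" using N0 that b by (intro mult_nonneg_nonneg) auto
    moreover have "0 < 2 * (1 - b) * C^3" using b C by simp
    ultimately show ?thesis unfolding kap_alt N_def by linarith
  qed
  \<comment> \<open>The rate at which the level is raised while \<open>X\<close> moves inward. It is
    below \<open>s\<close>, hence below the rate \<open>2 * s\<close> at which \<open>room\<close>
    opens, and \<open>sl * X = s^2\<close> closes the derivative computation.\<close>
  define sl where "sl = s^2 / X"
  have sl: "0 < sl" "sl < s"
    using s X by (auto simp: sl_def power2_eq_square pos_divide_less_eq)
  define F where "F t = dform b C (X - t) (S + sl * t)" for t
  have room_gap: "S + sl * t - room b C (X - t) = t^2 - (2 * s - sl) * t" for t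
    unfolding SX X_def room_def by (simp add: algebra_simps power2_eq_square)
  have F0: "0 \<le> F t" if t: "0 < t" "t < s" for t
  proof (rule ccontr)
    assume "\<not> 0 \<le> F t"
    then have "dform b C (X - t) (S + sl * t) < 0" by (simp add: F_def)
    moreover have "S + sl * t < room b C (X - t)"
    proof -
      have "t * (t - (2 * s - sl)) < 0" using t sl by (intro mult_pos_neg) auto
      then show ?thesis using room_gap[of t] by (simp add: algebra_simps power2_eq_square)
    qed
    moreover have "b \<le> X - t" using t H X_def by simp
    moreover have "0 \<le> S + sl * t" using S(2) sl t by simp
    ultimately have "S + sl * t < Scrit b"
      using Scrit_greater[of b C "X - t" "S + sl * t"] b C k0 by simp
    then show False using not mult_pos_pos[OF sl(1) t(1)] by linarith
  qed
  have F: "F t = 4 * ((t^2 - (2 * s - sl) * t) * (kap b C X - 3 * N * t)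
      + (X - t) * (D * (hval b C - s + t) - N * (s - t)^2))" for t
  proof -
    have "X - t - hval b C = s - t" by (simp add: X_def)
    then have "lamb b C (X - t - hval b C) = D * (hval b C - s + t) - N * (s - t)^2"
      unfolding lam by (simp add: algebra_simps)
    moreover have "kap b C (X - t) = kap b C X - 3 * N * t"
      unfolding kap_alt N_def by (simp add: algebra_simps)
    ultimately show ?thesis unfolding F_def dform_eq_lamb by (simp only: room_gap mult.commute)
  qed
  have deriv: "(F has_real_derivative 4 * (- (2 * s - sl) * kap b C X - lamb b C s + X * (D + 2 * N * s))) (at 0)"
    unfolding F lam by (auto intro!: derivative_eq_intros simp: algebra_simps)
  have lim: "0 \<le> F 0"
  proof (rule tendsto_lowerbound)
    show "(F \<longlongrightarrow> F 0) (at_right 0)"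
      using DERIV_isCont[OF deriv] by (simp add: isCont_def filterlim_at_split)
    show "\<forall>\<^sub>F t in at_right 0. 0 \<le> F t"
      using s F0 by (auto simp: eventually_at_right_field)
  qed simp
  moreover have "F 0 = 4 * (X * lamb b C s)" unfolding F lam by simp
  ultimately have L0: "lamb b C s = 0" using L X by (simp add: zero_le_mult_iff)
  then have "F 0 = 0" using \<open>F 0 = 4 * (X * lamb b C s)\<close> by simp
  have kX: "kap b C X * (hval b C - s) = N * X^2"
  proof -
    have "dform b C X S = 0" using \<open>F 0 = 0\<close> by (simp add: F_def)
    moreover have eq: "S = X * (hval b C - s)" "room b C X = X * (hval b C - s)"
      unfolding SX room_def X_def by (simp_all add: algebra_simps)
    have "dform b C X S = X * (kap b C X * (hval b C - s) - N * X^2)"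
      unfolding dform_def N_def eq by (simp add: algebra_simps power2_eq_square power3_eq_cube)
    ultimately show ?thesis using X by simp
  qed
  have gap: "0 < hval b C - s"
  proof -
    have "D * (hval b C - s) = N * s^2" using L0 lam[of s] by simp
    then have "0 < D * (hval b C - s)" using N0 s by simp
    then show ?thesis using D by (simp add: zero_less_mult_iff)
  qed
  \<comment> \<open>The second factor is the derivative of \<open>F\<close> at \<open>0\<close>
    divided by \<open>-4\<close>. Multiplying by \<open>hval b C - s\<close> allows
    \<open>kX\<close> and \<open>lamb = 0\<close> to remove \<open>kap\<close> and \<open>D\<close>,
    and a single positive term is left.\<close>
  have "(hval b C - s) * ((2 * s - sl) * kap b C X - X * (D + 2 * N * s))
      = (2 * s - sl) * (kap b C X * (hval b C - s)) - X * (D * (hval b C - s) + 2 * N * s * (hval b C - s))"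
    by (simp add: algebra_simps)
  also have "\<dots> = (2 * s - sl) * (N * X^2) - X * (N * s^2 + 2 * N * s * (hval b C - s))"
    using kX L0 lam[of s] by simp
  also have "\<dots> = 2 * N * s * X^2 - N * X * (sl * X) - X * (N * s^2 + 2 * N * s * (hval b C - s))"
    by (simp add: algebra_simps power2_eq_square)
  also have "sl * X = s^2" using X by (simp add: sl_def)
  also have "2 * N * s * X^2 - N * X * s^2 - X * (N * s^2 + 2 * N * s * (hval b C - s)) = 2 * N * s^2 * X"
    unfolding X_def by (simp add: algebra_simps power2_eq_square)
  finally have "0 < (hval b C - s) * ((2 * s - sl) * kap b C X - X * (D + 2 * N * s))"
    using N0 s X by simp
  then have "0 < (2 * s - sl) * kap b C X - X * (D + 2 * N * s)"
    using gap by (simp add: zero_less_mult_iff)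
  then have "- 4 * ((2 * s - sl) * kap b C X - X * (D + 2 * N * s)) < 0" by simp
  moreover have "4 * (- (2 * s - sl) * kap b C X - lamb b C s + X * (D + 2 * N * s))
      = - 4 * ((2 * s - sl) * kap b C X - X * (D + 2 * N * s))"
    using L0 by (simp add: algebra_simps)
  ultimately have "4 * (- (2 * s - sl) * kap b C X - lamb b C s + X * (D + 2 * N * s)) < 0"
    by presburger
  then obtain d where d: "0 < d" "\<And>h. 0 < h \<Longrightarrow> h < d \<Longrightarrow> F (0 + h) < F 0"
    using DERIV_neg_dec_right[OF deriv] by auto
  define h where "h = min d s / 2"
  have "0 < h" "h < d" "h < s" using d s by (auto simp: h_def)
  then show False using d(2)[of h] F0[of h] \<open>F 0 = 0\<close> by simp
qed

text \<open>The faces \<open>C = 0\<close> and \<open>C = 1\<close> are excluded by the bounds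
  \<open>b^2\<close> and \<open>1/2\<close>; the Hill boundary and \<open>kap = 0\<close> both lead
  to \<open>lamb \<le> 0\<close>, which \<open>boundary_below_Scrit\<close> refutes. In the interior
  the first-order conditions become available.\<close>

lemma Scrit_point_interior [extraction_expand]:
  assumes b: "0 \<le> b" "b < 1" and dg: "degen b C X (Scrit b)"
  shows "0 < C" "C < 1" "0 < X" "Scrit b < room b C X" "0 < kap b C X" "dform b C X (Scrit b) = 0"
proof -
  define S where "S = Scrit b"
  have S: "1/2 < S" "b^2 < S" using Scrit_gt_half Scrit_gt_square b by (auto simp: S_def)
  note dg' = dg[folded S_def, unfolded degen_def]
  have C01: "0 \<le> C" "C \<le> 1" using dg' by auto
  show C0: "0 < C"
  proof (rule ccontr)
    assume "\<not> 0 < C"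
    then have "hval b C = b" using C01 by (simp add: hval_def)
    then show False using room_le_sq[of b C X] dg' S by simp
  qed
  show X0: "0 < X" using dg' S by (cases "X = 0") (auto simp: room_def)
  show C1: "C < 1"
  proof (rule ccontr)
    assume "\<not> C < 1"
    then have "C = 1" using C01 by simp
    then have f: "room b C X = X * (2 - X)" "kap b C X = 2 - 3 * X" "3 * C^2 - 2 = 1"
      by (simp_all add: room_def kap_def hval_def)
    have "0 \<le> 2 - 3 * X" using dg' f by simp
    have "2 * (2 * X - 1)^2 * (2 - X) + 4 * (2 - 3 * X) * (S - 1/2) = dform b C X S"
      unfolding dform_def f by (simp add: algebra_simps power2_eq_square power3_eq_cube)
    moreover have "0 \<le> 2 * (2 * X - 1)^2 * (2 - X)" using \<open>0 \<le> 2 - 3 * X\<close> by simp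
    moreover have "0 \<le> 4 * (2 - 3 * X) * (S - 1/2)" using \<open>0 \<le> 2 - 3 * X\<close> S by simp
    ultimately have z: "(2 * X - 1)^2 * (2 - X) = 0" "(2 - 3 * X) * (S - 1/2) = 0"
      using dg' by linarith+
    then show False using \<open>0 \<le> 2 - 3 * X\<close> S by auto
  qed
  define s where "s = X - hval b C"
  have H: "0 < hval b C" "b \<le> hval b C"
    using b C0 hval_ge[of b C] unfolding hval_def by (simp_all add: add_nonneg_pos)
  have C2: "C^2 < 1" using C0 C1 by (simp add: power_less_one_iff)
  have D: "0 < (1 - b) * C * (1 - C^2)" using b C0 C2 by simp
  have "0 \<le> X * (2 * hval b C - X)" using dg' unfolding room_def by simp
  then have sH: "s \<le> hval b C" using X0 unfolding s_def by (simp add: zero_le_mult_iff)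
  have E: "kap b C X * (S - room b C X) + X * lamb b C s \<le> 0"
    using dg' unfolding dform_eq_lamb s_def by simp
  \<comment> \<open>Passing to \<open>\<bar>s\<bar>\<close> keeps \<open>room\<close> and does not
    increase \<open>lamb\<close>; then \<open>boundary_below_Scrit\<close> yields
    \<open>room < Scrit b\<close>, against admissibility of the maximizer.\<close>
  have refl: False if L: "lamb b C s \<le> 0" and r: "S = room b C X \<or> s < 0"
  proof -
    have "s \<noteq> 0"
    proof
      assume "s = 0"
      then have "lamb b C s = (1 - b) * C * (1 - C^2) * hval b C" by (simp add: lamb_def)
      then show False using L mult_pos_pos[OF D H(1)] by simp
    qed
    have L': "lamb b C \<bar>s\<bar> \<le> 0"
    proof (cases "s < 0")
      case True
      then have "(1 - b) * C * (1 - C^2) * s < 0" using D by (simp add: mult_pos_neg)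
      then show ?thesis using L lamb_reflect[of b C s] True by simp
    qed (use L in simp)
    have r': "room b C (hval b C + \<bar>s\<bar>) = room b C X"
      unfolding room_eq_sq s_def by simp
    have "room b C X < Scrit b"
      by (rule boundary_below_Scrit[where s = "\<bar>s\<bar>" and C = C])
        (use b C0 C1 \<open>s \<noteq> 0\<close> L' r' dg' S in auto)
    then show False using dg' by (simp add: S_def)
  qed
  show k0: "0 < kap b C X"
  proof (rule ccontr)
    assume "\<not> 0 < kap b C X"
    then have k: "kap b C X = 0" using dg' by simp
    then have L: "lamb b C s \<le> 0" using E X0 by (simp add: mult_le_0_iff)
    have n: "3 * C^2 - 2 \<le> 0" using k dg' X0 by (simp add: dform_def mult_le_0_iff)
    have "0 < 2 * (1 - b) * C^3" using b C0 by simp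
    then have "(2 - 3 * C^2) * (3 * X - 2 * b) < 0" using k unfolding kap_alt by linarith
    then have "3 * X < 2 * b" using n by (simp add: mult_less_0_iff)
    then have "s < 0" using H b unfolding s_def by simp
    then show False using refl L by simp
  qed
  show W: "Scrit b < room b C X"
  proof (rule ccontr)
    assume "\<not> Scrit b < room b C X"
    then have "S = room b C X" using dg' by (simp add: S_def)
    moreover then have "lamb b C s \<le> 0" using E X0 by (simp add: mult_le_0_iff)
    ultimately show False using refl by simp
  qed
  show "dform b C X (Scrit b) = 0"
  proof (rule ccontr)
    assume "dform b C X (Scrit b) \<noteq> 0"
    then have "dform b C X (Scrit b) < 0" using dg' by (simp add: S_def)
    then show False using Scrit_greater[of b C X "Scrit b"] b C0 C1 X0 k0 W S S_def by simp
  qed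
qed

text \<open>At a maximizer the determinant condition cannot become negative nearby, so its partial
  derivatives vanish.\<close>

lemma Scrit_point_stationary [extraction_expand]:
  assumes b: "0 \<le> b" "b < 1" and dg: "degen b C X (Scrit b)"
  defines "n \<equiv> 3 * C^2 - 2" and "\<kappa> \<equiv> kap b C X"
  shows "n^2 * X + n * \<kappa> = 2 * \<kappa>^2 * (hval b C - X) / X^2"
    and "\<kappa>^2 = X^2 * C^2 * (2 - C^2)"
proof -
  define S where "S = Scrit b"
  note pt = Scrit_point_interior[OF b dg, folded S_def]
  have S0: "0 \<le> S" using dg by (simp add: S_def degen_def)
  define A where "A = 4 * S - 3 * room b C X"
  \<comment> \<open>This eliminates \<open>S\<close>: both derivatives are multiplied by
    \<open>\<kappa>\<close>, after which \<open>S\<close> occurs only inside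
    \<open>\<kappa> * A\<close>.\<close>
  have A: "\<kappa> * A = - n * X^3"
    using pt(6) unfolding dform_def A_def n_def \<kappa>_def by (simp add: algebra_simps)
  have nonneg: "0 \<le> dform b C' X' S"
    if "0 < C'" "C' < 1" "0 < X'" "S < room b C' X'" "0 < kap b C' X'" for C' X'
    using Scrit_greater[of b C' X' S] that b S0 by (force simp: S_def)
  have "3 * n^2 * X^3 + 3 * n * \<kappa> * X^2 - 6 * \<kappa>^2 * (hval b C - X) = 0"
  proof -
    have "open {x. 0 < x \<and> S < room b C x \<and> 0 < kap b C x}"
      unfolding room_def kap_def
      by (intro open_Collect_conj open_Collect_less continuous_intros)
    then obtain d where d: "0 < d" "ball X d \<subseteq> {x. 0 < x \<and> S < room b C x \<and> 0 < kap b C x}"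
      using pt by (metis (mono_tags, lifting) mem_Collect_eq openE)
    have "((\<lambda>x. dform b C x S) has_real_derivative
        (- 3 * n * A - \<kappa> * (3 * (2 * hval b C - 2 * X)) + 3 * n * X^2)) (at X)"
      unfolding dform_def kap_def room_def A_def \<kappa>_def n_def
      by (auto intro!: derivative_eq_intros simp: algebra_simps)
    then have z: "- 3 * n * A - \<kappa> * (3 * (2 * hval b C - 2 * X)) + 3 * n * X^2 = 0"
    proof (rule DERIV_local_min[OF _ d(1)])
      have "y \<in> {x. 0 < x \<and> S < room b C x \<and> 0 < kap b C x}" if "\<bar>X - y\<bar> < d" for y
        using subsetD[OF d(2), of y] that by (simp add: dist_real_def)
      then show "\<forall>y. \<bar>X - y\<bar> < d \<longrightarrow> dform b C X S \<le> dform b C y S"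
        using nonneg[OF pt(1,2)] unfolding pt(6) by blast
    qed
    have "3 * n^2 * X^3 + 3 * n * \<kappa> * X^2 - 6 * \<kappa>^2 * (hval b C - X)
        = - 3 * n * (\<kappa> * A) - \<kappa> * (\<kappa> * (3 * (2 * hval b C - 2 * X))) + \<kappa> * (3 * n * X^2)"
      unfolding A by (simp add: algebra_simps power2_eq_square)
    also have "\<dots> = \<kappa> * (- 3 * n * A - \<kappa> * (3 * (2 * hval b C - 2 * X)) + 3 * n * X^2)"
      by (simp add: algebra_simps)
    finally show ?thesis unfolding z by simp
  qed
  then have "(n^2 * X + n * \<kappa>) * X^2 = 2 * \<kappa>^2 * (hval b C - X)"
    by (simp add: algebra_simps power2_eq_square power3_eq_cube)
  then show "n^2 * X + n * \<kappa> = 2 * \<kappa>^2 * (hval b C - X) / X^2"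
    using pt by (simp add: field_simps)
  define kC where "kC = 6 * C * (2 * b - 3 * X) + 6 * (1 - b) * C^2"
  have "6 * X * (1 - b) * (X^2 * C^2 * (2 - C^2) - \<kappa>^2) = 0"
  proof -
    have "open {c. 0 < c \<and> c < 1 \<and> S < room b c X \<and> 0 < kap b c X}"
      unfolding room_def kap_def hval_def
      by (intro open_Collect_conj open_Collect_less continuous_intros)
    then obtain d where d: "0 < d"
      "ball C d \<subseteq> {c. 0 < c \<and> c < 1 \<and> S < room b c X \<and> 0 < kap b c X}"
      using pt by (metis (mono_tags, lifting) mem_Collect_eq openE)
    have "((\<lambda>c. dform b c X S) has_real_derivative
        (kC * A - 6 * \<kappa> * X * (1 - b) + 6 * C * X^3)) (at C)"
      unfolding dform_def kap_def room_def hval_def A_def \<kappa>_def kC_def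
      by (auto intro!: derivative_eq_intros simp: algebra_simps)
    then have z: "kC * A - 6 * \<kappa> * X * (1 - b) + 6 * C * X^3 = 0"
    proof (rule DERIV_local_min[OF _ d(1)])
      have "y \<in> {c. 0 < c \<and> c < 1 \<and> S < room b c X \<and> 0 < kap b c X}" if "\<bar>C - y\<bar> < d" for y
        using subsetD[OF d(2), of y] that by (simp add: dist_real_def)
      then show "\<forall>y. \<bar>C - y\<bar> < d \<longrightarrow> dform b C X S \<le> dform b y X S"
        using nonneg[OF _ _ pt(3)] unfolding pt(6) by blast
    qed
    \<comment> \<open>After elimination the derivative \<open>kC\<close> of \<open>kap\<close>
      occurs only as \<open>n * kC\<close>; the first term on the right cancels
      \<open>6 * C * \<kappa> * X^3\<close>.\<close>
    have nk: "n * kC = 6 * C * \<kappa> + 6 * (1 - b) * C^2 * (C^2 - 2)"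
      unfolding n_def kC_def \<kappa>_def kap_def by algebra
    have "6 * X * (1 - b) * (X^2 * C^2 * (2 - C^2) - \<kappa>^2)
        = - (n * kC) * X^3 - 6 * \<kappa>^2 * X * (1 - b) + 6 * C * \<kappa> * X^3"
      unfolding nk by algebra
    also have "\<dots> = kC * (\<kappa> * A) - 6 * \<kappa>^2 * X * (1 - b) + 6 * C * \<kappa> * X^3"
      unfolding A by (simp add: algebra_simps)
    also have "\<dots> = \<kappa> * (kC * A - 6 * \<kappa> * X * (1 - b) + 6 * C * X^3)"
      by (simp add: algebra_simps power2_eq_square)
    finally show ?thesis unfolding z by simp
  qed
  then show "\<kappa>^2 = X^2 * C^2 * (2 - C^2)" using pt b by simp
qed

text \<open>Both critical equations become rational in \<open>k = C / sqrt (2 - C^2)\<close>, and the curve of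
  critical points is parametrized by \<open>k\<close> up to the scale \<open>X\<close>.\<close>

lemma Scrit_point_param [extraction_expand]:
  assumes b: "0 \<le> b" "b < 1" and dg: "degen b C X (Scrit b)"
  obtains k T where "0 < k" "0 < T" "C = k * T" "T^2 * (1 + k^2) = 2"
    "b = X * (2 - k - 2 * k^2)"
    "2 * k^2 * ((1 - b) * C) = X * (8 * k^4 + 4 * k^3 - 6 * k^2 - k + 1)"
    "4 * k^2 * Scrit b = X^2 * (12 * k^4 + 4 * k^3 - 9 * k^2 - 2 * k + 3)"
proof -
  note pt = Scrit_point_interior[OF b dg] and st = Scrit_point_stationary[OF b dg]
  define S where "S = Scrit b"
  have C2: "C^2 < 1" using pt by (simp add: power_less_one_iff)
  define T where "T = sqrt (2 - C^2)"
  have T: "0 < T" "T^2 = 2 - C^2" using C2 by (auto simp: T_def)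
  define k where "k = C / T"
  have k: "0 < k" "C = k * T" using T pt by (auto simp: k_def)
  have kT: "T^2 * (1 + k^2) = 2" using T k by (simp add: algebra_simps power_mult_distrib)
  have k1: "k^2 \<noteq> 1"
  proof
    assume "k^2 = 1"
    then have "T^2 = 1" using kT by simp
    then show False using T C2 by simp
  qed
  define n where "n = 3 * C^2 - 2"
  have n: "n = T^2 * (2 * k^2 - 1)"
    using kT unfolding n_def k(2) by (simp add: algebra_simps power_mult_distrib)
  define d where "d = (1 - b) * C"
  have H: "hval b C = b + d" by (simp add: hval_def d_def)
  have "(kap b C X)^2 = (X * C * T)^2"
    using st(2) T by (simp add: power_mult_distrib)
  then have "kap b C X = X * C * T"
    using pt(1,3,5) T(1) by (simp add: power2_eq_iff_nonneg)
  then have kap: "kap b C X = X * k * T^2" by (simp add: k(2) power2_eq_square)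
  have "(n^2 * X + n * kap b C X) * X^2 = 2 * (kap b C X)^2 * (b + d - X)"
    using st(1) pt(3) unfolding H n_def by (simp add: field_simps)
  then have "X^2 * T^4 * (X * ((2 * k^2 - 1)^2 + k * (2 * k^2 - 1)))
      = X^2 * T^4 * (2 * k^2 * (b + d - X))"
    unfolding n kap by (simp add: algebra_simps power_mult_distrib power2_eq_square power4_eq_xxxx)
  then have e1: "X * ((2 * k^2 - 1)^2 + k * (2 * k^2 - 1)) = 2 * k^2 * (b + d - X)"
    using pt T by simp
  have "kap b C X = T^2 * (2 * k^2 - 1) * (2 * b - 3 * X) + 2 * d * (k * T)^2"
    unfolding kap_def n_def[symmetric] n d_def k(2)[symmetric]
    by (simp add: algebra_simps power2_eq_square power3_eq_cube)
  then have "T^2 * ((2 * k^2 - 1) * (2 * b - 3 * X) + 2 * d * k^2) = T^2 * (X * k)"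
    unfolding kap by (simp add: algebra_simps power_mult_distrib)
  then have e2: "(2 * k^2 - 1) * (2 * b - 3 * X) + 2 * d * k^2 = X * k"
    using T(1) by simp
  \<comment> \<open>Both critical equations are linear in \<open>b\<close> and \<open>d\<close>.
    Eliminating \<open>d\<close> leaves the factor \<open>1 - k^2\<close>, nonzero because
    \<open>C < 1\<close>.\<close>
  have "(1 - k^2) * b = (1 - k^2) * (X * (2 - k - 2 * k^2))"
    using e1 e2 by algebra
  then have bX: "b = X * (2 - k - 2 * k^2)" using k1 by simp
  have dX: "2 * k^2 * d = X * (8 * k^4 + 4 * k^3 - 6 * k^2 - k + 1)"
    using e2 bX by algebra
  have "X * k * T^2 * (4 * S - 3 * room b C X) + T^2 * (2 * k^2 - 1) * X^3 = 0"
    using pt(6) unfolding dform_def S_def kap n_def[symmetric] n by simp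
  then have "X * T^2 * (k * (4 * S - 3 * room b C X) + (2 * k^2 - 1) * X^2) = 0"
    by (simp add: algebra_simps power2_eq_square power3_eq_cube)
  then have e3: "k * (4 * S - 3 * (X * (2 * (b + d) - X))) + (2 * k^2 - 1) * X^2 = 0"
    using pt(3) T(1) unfolding room_def H by simp
  have "4 * k^2 * S = X^2 * (12 * k^4 + 4 * k^3 - 9 * k^2 - 2 * k + 3)"
    using e3 e1 by algebra
  then show ?thesis using that[OF k(1) T(1) k(2) kT bX] dX by (simp add: d_def S_def)
qed

text \<open>The scale \<open>X\<close>, free in the parametrization, is fixed because
  \<open>(1 - b) * C\<close> is just \<open>C\<close>. Eliminating it gives the eccentricity
  \<open>(2 + k) / 4\<close> with \<open>4 * k + 1 = sqrt 17\<close>.\<close>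

lemma Scrit_0 [extraction_expand]: "Scrit 0 = 1 - ((7 + sqrt 17) / 16)^2"
proof -
  obtain C X where dg: "degen 0 C X (Scrit 0)" using Scrit_attained[of 0] by auto
  have X: "0 < X" using Scrit_point_interior(3)[OF _ _ dg] by simp
  from Scrit_point_param[OF _ _ dg] obtain k T where kT: "0 < k" "C = k * T" "T^2 * (1 + k^2) = 2"
    "0 = X * (2 - k - 2 * k^2)"
    "2 * k^2 * C = X * (8 * k^4 + 4 * k^3 - 6 * k^2 - k + 1)"
    "4 * k^2 * Scrit 0 = X^2 * (12 * k^4 + 4 * k^3 - 9 * k^2 - 2 * k + 3)"
    by (metis diff_zero mult_1 order_refl zero_less_one)
  define S where "S = Scrit 0"
  have k: "2 * k^2 + k = 2" using kT(4) X by simp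
  have "(4 * k + 1)^2 = 17" using k by (simp add: algebra_simps power2_eq_square)
  then have k17: "sqrt 17 = 4 * k + 1" using kT(1) by (intro real_sqrt_unique) auto
  have "k < 1"
  proof (rule ccontr)
    assume "\<not> k < 1"
    then have "1 \<le> k^2" by (simp add: one_le_power)
    then show False using k \<open>\<not> k < 1\<close> by linarith
  qed
  have eX: "(2 - k) * C = X * (3 - 2 * k)" using kT(5) k by algebra
  have eC: "C^2 * (4 - k) = 2 * (2 - k)" using kT(2,3) k by algebra
  have eS: "2 * (2 - k) * S = X^2 * (7 - 6 * k)" using kT(6) k unfolding S_def by algebra
  have "(2 - k) * ((4 - k) * (3 - 2 * k)^2 * S) = (2 - k) * ((2 - k)^2 * (7 - 6 * k))"
    using eX eC eS by algebra
  then have "(4 - k) * (3 - 2 * k)^2 * S = (2 - k)^2 * (7 - 6 * k)" using \<open>k < 1\<close> by simp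
  moreover have "(4 - k) * (3 - 2 * k)^2 * (1 - ((2 + k) / 4)^2) = (2 - k)^2 * (7 - 6 * k)"
  proof -
    have "(4 - k) * (3 - 2 * k)^2 * (16 - (2 + k)^2) = 16 * ((2 - k)^2 * (7 - 6 * k))"
    proof -
      \<comment> \<open>Division with remainder by the vanishing polynomial \<open>q\<close> reduces
        both sides to the same linear polynomial in \<open>k\<close>.\<close>
      define q where "q = 2 * k^2 + k - 2"
      have e: "(4 - k) * (3 - 2 * k)^2 = 66 - 76 * k + q * (15 - 2 * k)"
        "16 - (2 + k)^2 = 11 - 7/2 * k - q / 2"
        "(2 - k)^2 * (7 - 6 * k) = 62 - 75 * k + q * (17 - 3 * k)"
        "(66 - 76 * k) * (11 - 7/2 * k) = 992 - 1200 * k + q * 133"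
        by (simp_all add: q_def field_simps power2_eq_square)
      have "q = 0" using k by (simp add: q_def)
      then show ?thesis using e(4) unfolding e(1-3) by simp
    qed
    then show ?thesis by (simp add: power_divide diff_divide_distrib right_diff_distrib)
  qed
  moreover have "(4 - k) * (3 - 2 * k)^2 \<noteq> 0" using \<open>k < 1\<close> by simp
  ultimately have "S = 1 - ((2 + k) / 4)^2" by (metis mult_cancel_left)
  then show ?thesis unfolding S_def k17 by (simp add: add_divide_distrib)
qed

section \<open>Convexity of the critical level\<close>

text \<open>The fraction is the root in \<open>S\<close> of \<open>dform\<close>; \<open>lo\<close>
  and \<open>hi\<close> place it between \<open>0\<close> and \<open>room\<close>. Any path of
  points \<open>(C, X)\<close> thus yields a lower bound for \<open>Scrit\<close>.\<close>

lemma Scrit_lower [extraction_expand]: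
  assumes b: "0 \<le> b" "b \<le> 1" and C: "0 \<le> C" "C \<le> 1" and X: "0 \<le> X" and k: "0 < kap b C X"
    and lo: "(3 * C^2 - 2) * X^3 \<le> 3 * room b C X * kap b C X"
    and hi: "- (3 * C^2 - 2) * X^3 \<le> room b C X * kap b C X"
  shows "(3 * room b C X - (3 * C^2 - 2) * X^3 / kap b C X) / 4 \<le> Scrit b"
proof -
  define q where "q = (3 * C^2 - 2) * X^3 / kap b C X"
  have "q \<le> 3 * room b C X" using lo k by (simp add: q_def pos_divide_le_eq)
  moreover have "- ((3 * C^2 - 2) * X^3) / kap b C X \<le> room b C X"
    using hi k by (simp only: pos_divide_le_eq mult_minus_left)
  then have "- q \<le> room b C X" by (simp add: q_def)
  moreover have "dform b C X ((3 * room b C X - q) / 4) = 0"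
    using k by (simp add: dform_def q_def field_simps)
  ultimately have "degen b C X ((3 * room b C X - q) / 4)" using C X k by (simp add: degen_def)
  then have "(3 * room b C X - q) / 4 \<le> Scrit b" by (rule Scrit_upper[OF b])
  then show ?thesis by (simp add: q_def)
qed

section \<open>The second variation on the parameter interval\<close>

text \<open>The hypotheses on \<open>k^2\<close> express \<open>3 * C^2 \<ge> 2\<close> and
  \<open>b \<ge> 0\<close> on the critical curve. The bounds round \<open>sqrt (1/2)\<close> down
  and \<open>(sqrt 17 - 1) / 4\<close> up.\<close>

lemma param_range [extraction_expand]:
  fixes k :: real
  assumes k: "1 / 2 \<le> k^2" "2 * k^2 + k \<le> 2" "0 < k"
  shows "7 / 10 \<le> k" "k \<le> 782 / 1000"
proof -
  show "7 / 10 \<le> k"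
  proof (rule ccontr)
    assume "\<not> 7 / 10 \<le> k"
    then have "k^2 < (7 / 10)^2" using k by (intro power_strict_mono) auto
    then show False using k by (simp add: power_divide)
  qed
  show "k \<le> 782 / 1000"
  proof (rule ccontr)
    assume n: "\<not> k \<le> 782 / 1000"
    then have "(782 / 1000)^2 < k^2" by (intro power_strict_mono) auto
    then show False using k n by (simp add: power_divide)
  qed
qed

text \<open>The inequalities needed in \<open>second_variation_sign\<close>. The lines
  \<open>781/100 - 41/10 * k\<close> and \<open>7788/1000 - 41/10 * k\<close> enclose
  \<open>4 * s\<close>, whose slope in \<open>k\<close> is about \<open>-4.1\<close> on this
  interval; \<open>29/20\<close> and \<open>11/5\<close> enclose the quantity called
  \<open>\<beta>\<close> there.\<close>

lemma param_estimates [extraction_expand]: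
  fixes k :: real
  assumes k: "7 / 10 \<le> k" "k \<le> 782 / 1000"
  shows "16 * (1 + k^2) \<le> (781 / 100 - 41 / 10 * k)^2 * (2 * k^2)"
    and "(7788 / 1000 - 41 / 10 * k)^2 * (2 * k^2) \<le> 16 * (1 + k^2)"
    and "2 * (29 / 20) * k^4 \<le> 2 * (8 * k^4 + 4 * k^3 - 6 * k^2 - k + 1) * (k^2 + 1)
      - 2 * k^4 * (4 * k^2 + 2 * k - 1) * (41 / 10 * k - 1788 / 1000)"
    and "2 * (8 * k^4 + 4 * k^3 - 6 * k^2 - k + 1) * (k^2 + 1)
      - 2 * k^4 * (4 * k^2 + 2 * k - 1) * (41 / 10 * k - 181 / 100) \<le> 2 * (11 / 5) * k^4"
    and "2 * k^2 * (4 * k^2 + 2 * k - 1)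
      \<le> (8 * k^4 + 4 * k^3 - 6 * k^2 - k + 1) * (6 - 2 * (41 / 10 * k - 1788 / 1000))"
    and "1 + (2 * k^2 - 1) * (29 / 20)^2 < k * (41 / 10 * k - 181 / 100) * (29 / 20)"
    and "1 + (2 * k^2 - 1) * (11 / 5)^2 < k * (41 / 10 * k - 181 / 100) * (11 / 5)"
    and "0 < 8 * k^4 + 4 * k^3 - 6 * k^2 - k + 1"
proof -
  \<comment> \<open>Measured from the left endpoint, \<open>u\<close> is small, and
    \<open>pq\<close> bounds each power by the preceding one. The polynomial inequalities become
    linear in the monomials.\<close>
  define u where "u = k - 7 / 10"
  have u: "0 \<le> u" "u \<le> 82 / 1000" "k = 7 / 10 + u" using k by (auto simp: u_def)
  have p: "0 \<le> u" "0 \<le> u^2" "0 \<le> u^3" "0 \<le> u^4" "0 \<le> u^5" "0 \<le> u^6" "0 \<le> u^7"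
    using u(1) by simp_all
  have q: "u * u^i \<le> 82 / 1000 * u^i" for i
    using u(1) by (intro mult_right_mono u(2)) simp
  have pq: "u \<le> 82 / 1000" "u^2 \<le> 82 / 1000 * u" "u^3 \<le> 82 / 1000 * u^2" "u^4 \<le> 82 / 1000 * u^3"
    "u^5 \<le> 82 / 1000 * u^4" "u^6 \<le> 82 / 1000 * u^5" "u^7 \<le> 82 / 1000 * u^6"
    using u(2) q[of 1] q[of 2] q[of 3] q[of 4] q[of 5] q[of 6]
    by (simp_all add: eval_nat_numeral)
  show "16 * (1 + k^2) \<le> (781 / 100 - 41 / 10 * k)^2 * (2 * k^2)"
  proof -
    have e: "(781 / 100 - 41 / 10 * k)^2 * (2 * k^2) - (16 * (1 + k^2)) = 9441 / 125000 + 77903 / 12500 * u - 320707 / 5000 * u^2 - 8487 / 250 * u^3 + 1681 / 50 * u^4"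
      unfolding u(3) by algebra
    have "0 \<le> 9441 / 125000 + 77903 / 12500 * u - 320707 / 5000 * u^2 - 8487 / 250 * u^3 + 1681 / 50 * u^4" using p pq by linarith
    then show ?thesis unfolding e[symmetric] by (simp only: diff_ge_0_iff_ge)
  qed
  show "(7788 / 1000 - 41 / 10 * k)^2 * (2 * k^2) \<le> 16 * (1 + k^2)"
  proof -
    have e: "16 * (1 + k^2) - ((7788 / 1000 - 41 / 10 * k)^2 * (2 * k^2)) = 1712631 / 12500000 - 453264 / 78125 * u + 4004377 / 62500 * u^2 + 20992 / 625 * u^3 - 1681 / 50 * u^4"
      unfolding u(3) by algebra
    \<comment> \<open>The polynomial comes close to zero near \<open>u = 0.0453\<close>, so a lower
      bound on \<open>u^2\<close> is needed; the square gives the tangent line there.\<close>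
    have "0 \<le> (u - 453 / 10000)^2" by simp
    then have sq: "0 \<le> u^2 - 906 / 10000 * u + 205209 / 100000000"
      by (simp add: power2_eq_square field_simps)
    have "0 \<le> 1712631 / 12500000 - 453264 / 78125 * u + 4004377 / 62500 * u^2 + 20992 / 625 * u^3 - 1681 / 50 * u^4" using p pq sq by linarith
    then show ?thesis unfolding e[symmetric] by (simp only: diff_ge_0_iff_ge)
  qed
  show "2 * (29 / 20) * k^4 \<le> 2 * (8 * k^4 + 4 * k^3 - 6 * k^2 - k + 1) * (k^2 + 1)
      - 2 * k^4 * (4 * k^2 + 2 * k - 1) * (41 / 10 * k - 1788 / 1000)"
  proof -
    have e: "2 * (8 * k^4 + 4 * k^3 - 6 * k^2 - k + 1) * (k^2 + 1)
      - 2 * k^4 * (4 * k^2 + 2 * k - 1) * (41 / 10 * k - 1788 / 1000) - (2 * (29 / 20) * k^4) = 357089 / 15625000 + 13955829 / 3125000 * u + 60791 / 6250 * u^2 - 834517 / 12500 * u^3 - 132696 / 625 * u^4 - 159852 / 625 * u^5 - 18352 / 125 * u^6 - 164 / 5 * u^7"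
      unfolding u(3) by algebra
    have "0 \<le> 357089 / 15625000 + 13955829 / 3125000 * u + 60791 / 6250 * u^2 - 834517 / 12500 * u^3 - 132696 / 625 * u^4 - 159852 / 625 * u^5 - 18352 / 125 * u^6 - 164 / 5 * u^7" using p pq by linarith
    then show ?thesis unfolding e[symmetric] by (simp only: diff_ge_0_iff_ge)
  qed
  show "2 * (8 * k^4 + 4 * k^3 - 6 * k^2 - k + 1) * (k^2 + 1)
      - 2 * k^4 * (4 * k^2 + 2 * k - 1) * (41 / 10 * k - 181 / 100) \<le> 2 * (11 / 5) * k^4"
  proof -
    have e: "2 * (11 / 5) * k^4 - (2 * (8 * k^4 + 4 * k^3 - 6 * k^2 - k + 1) * (k^2 + 1)
      - 2 * k^4 * (4 * k^2 + 2 * k - 1) * (41 / 10 * k - 181 / 100)) = 1952277 / 6250000 - 3288279 / 1250000 * u - 765363 / 125000 * u^2 + 34723 / 500 * u^3 + 26532 / 125 * u^4 + 31867 / 125 * u^5 + 3666 / 25 * u^6 + 164 / 5 * u^7"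
      unfolding u(3) by algebra
    have "0 \<le> 1952277 / 6250000 - 3288279 / 1250000 * u - 765363 / 125000 * u^2 + 34723 / 500 * u^3 + 26532 / 125 * u^4 + 31867 / 125 * u^5 + 3666 / 25 * u^6 + 164 / 5 * u^7" using p pq by linarith
    then show ?thesis unfolding e[symmetric] by (simp only: diff_ge_0_iff_ge)
  qed
  show "2 * k^2 * (4 * k^2 + 2 * k - 1) \<le> (8 * k^4 + 4 * k^3 - 6 * k^2 - k + 1) * (6 - 2 * (41 / 10 * k - 1788 / 1000))"
  proof -
    have e: "(8 * k^4 + 4 * k^3 - 6 * k^2 - k + 1) * (6 - 2 * (41 / 10 * k - 1788 / 1000)) - (2 * k^2 * (4 * k^2 + 2 * k - 1)) = 29897 / 156250 + 143629 / 15625 * u + 26156 / 3125 * u^2 - 86046 / 625 * u^3 - 24224 / 125 * u^4 - 328 / 5 * u^5"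
      unfolding u(3) by algebra
    have "0 \<le> 29897 / 156250 + 143629 / 15625 * u + 26156 / 3125 * u^2 - 86046 / 625 * u^3 - 24224 / 125 * u^4 - 328 / 5 * u^5" using p pq by linarith
    then show ?thesis unfolding e[symmetric] by (simp only: diff_ge_0_iff_ge)
  qed
  show "1 + (2 * k^2 - 1) * (29 / 20)^2 < k * (41 / 10 * k - 181 / 100) * (29 / 20)"
  proof -
    have e: "k * (41 / 10 * k - 181 / 100) * (29 / 20) - (1 + (2 * k^2 - 1) * (29 / 20)^2) = 2359 / 20000 - 377 / 2000 * u + 87 / 50 * u^2"
      unfolding u(3) by algebra
    have "0 < 2359 / 20000 - 377 / 2000 * u + 87 / 50 * u^2" using p pq by linarith
    then show ?thesis unfolding e[symmetric] by (simp only: diff_gt_0_iff_gt)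
  qed
  show "1 + (2 * k^2 - 1) * (11 / 5)^2 < k * (41 / 10 * k - 181 / 100) * (11 / 5)"
  proof -
    have e: "k * (41 / 10 * k - 181 / 100) * (11 / 5) - (1 + (2 * k^2 - 1) * (11 / 5)^2) = 1823 / 2500 - 2453 / 500 * u - 33 / 50 * u^2"
      unfolding u(3) by algebra
    have "0 < 1823 / 2500 - 2453 / 500 * u - 33 / 50 * u^2" using p pq by linarith
    then show ?thesis unfolding e[symmetric] by (simp only: diff_gt_0_iff_gt)
  qed
  show "0 < 8 * k^4 + 4 * k^3 - 6 * k^2 - k + 1"
  proof -
    have e: "8 * k^4 + 4 * k^3 - 6 * k^2 - k + 1 = 408 / 625 + 932 / 125 * u + 648 / 25 * u^2 + 132 / 5 * u^3 + 8 * u^4"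
      unfolding u(3) by algebra
    show ?thesis unfolding e using p pq by linarith
  qed
qed

text \<open>Since \<open>v \<ge> 0\<close> and \<open>\<alpha> + 2 * d * w - 6 * d \<le> 0\<close>,
  it suffices that \<open>1 + k * v * \<beta>^2 - k * w * \<beta>\<close> is negative. This is
  convex in \<open>\<beta>\<close>, so two endpoints enclosing \<open>\<beta>\<close> decide
  it.\<close>

lemma second_variation_sign [extraction_expand]:
  fixes k s d v :: real
  assumes k: "1 / 2 \<le> k^2" "2 * k^2 + k \<le> 2" "0 < k" and s: "0 < s" "2 * k^2 * s^2 = 1 + k^2"
    and d: "2 * k^2 * d = 8 * k^4 + 4 * k^3 - 6 * k^2 - k + 1" and v: "k * v = 2 * k^2 - 1"
  defines "w \<equiv> 6 - 4 * s" and "\<alpha> \<equiv> 4 * k^2 + 2 * k - 1"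
  defines "\<beta> \<equiv> 6 * d - 2 * d * v / k - \<alpha> * w"
  shows "0 < d" "(1 + v * (\<alpha> + 2 * d * w - 6 * d)) / k - w * \<beta> + v * \<beta>^2 < 0"
proof -
  note kr = param_range[OF k]
  note est = param_estimates[OF kr]
  have sq: "(4 * s)^2 * (2 * k^2) = 16 * (1 + k^2)" using s(2) by algebra
  have w_lo: "41 / 10 * k - 181 / 100 \<le> w"
  proof (rule ccontr)
    assume "\<not> 41 / 10 * k - 181 / 100 \<le> w"
    then have "781 / 100 - 41 / 10 * k < 4 * s" by (simp add: w_def)
    then have "(781 / 100 - 41 / 10 * k)^2 < (4 * s)^2" using kr by (intro power_strict_mono) auto
    then have "(781 / 100 - 41 / 10 * k)^2 * (2 * k^2) < (4 * s)^2 * (2 * k^2)" using k by simp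
    then show False using sq est(1) by linarith
  qed
  have w_hi: "w \<le> 41 / 10 * k - 1788 / 1000"
  proof (rule ccontr)
    assume "\<not> w \<le> 41 / 10 * k - 1788 / 1000"
    then have "4 * s < 7788 / 1000 - 41 / 10 * k" by (simp add: w_def)
    then have "(4 * s)^2 < (7788 / 1000 - 41 / 10 * k)^2" using s by (intro power_strict_mono) auto
    then have "(4 * s)^2 * (2 * k^2) < (7788 / 1000 - 41 / 10 * k)^2 * (2 * k^2)" using k by simp
    then show False using sq est(2) by linarith
  qed
  have "0 < 2 * k^2 * d" using est(8) d by simp
  then show d0: "0 < d" using k by (simp add: zero_less_mult_iff)
  have \<alpha>: "0 < \<alpha>" using kr k unfolding \<alpha>_def by linarith
  have v0: "0 \<le> v"
  proof -
    have "0 \<le> k * v" using v k by simp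
    then show ?thesis using k by (simp add: zero_le_mult_iff)
  qed
  have first: "\<alpha> + 2 * d * w - 6 * d \<le> 0"
  proof -
    have "2 * k^2 * (\<alpha> + 2 * d * w - 6 * d) = 2 * k^2 * \<alpha> - (2 * k^2 * d) * (6 - 2 * w)"
      by (simp add: algebra_simps)
    also have "\<dots> \<le> 2 * k^2 * \<alpha> - (2 * k^2 * d) * (6 - 2 * (41 / 10 * k - 1788 / 1000))"
      using w_hi \<open>0 < 2 * k^2 * d\<close> by (intro diff_left_mono mult_left_mono) auto
    also have "\<dots> \<le> 0" using est(5) unfolding d \<alpha>_def by simp
    finally show ?thesis using k by (simp add: mult_le_0_iff)
  qed
  have "k^2 * \<beta> = 6 * d * k^2 - 2 * d * (k * v) - k^2 * \<alpha> * w"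
    using k unfolding \<beta>_def by (simp add: field_simps power2_eq_square)
  then have "2 * k^2 * (k^2 * \<beta>) = 2 * k^2 * (6 * d * k^2 - 2 * d * (2 * k^2 - 1) - k^2 * \<alpha> * w)"
    unfolding v by simp
  also have "\<dots> = 2 * (2 * k^2 * d) * (k^2 + 1) - 2 * k^2 * k^2 * \<alpha> * w"
    by (simp add: algebra_simps)
  finally have \<beta>: "2 * k^4 * \<beta> = 2 * (8 * k^4 + 4 * k^3 - 6 * k^2 - k + 1) * (k^2 + 1) - 2 * k^4 * \<alpha> * w"
    using d by algebra
  have k4: "0 < 2 * k^4" "0 \<le> 2 * k^4 * \<alpha>" using k \<alpha> by simp_all
  have "2 * k^4 * (29 / 20) \<le> 2 * k^4 * \<beta>"
    using mult_left_mono[OF w_hi k4(2)] est(3) unfolding \<beta> \<alpha>_def by linarith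
  then have \<beta>_lo: "29 / 20 \<le> \<beta>" using k4 by simp
  have "2 * k^4 * \<beta> \<le> 2 * k^4 * (11 / 5)"
    using mult_left_mono[OF w_lo k4(2)] est(4) unfolding \<beta> \<alpha>_def by linarith
  then have \<beta>_hi: "\<beta> \<le> 11 / 5" using k4 by simp
  have ends: "1 + k * v * t^2 < k * w * t" if "t = 29 / 20 \<or> t = 11 / 5" for t
  proof -
    have "k * (41 / 10 * k - 181 / 100) * t \<le> k * w * t"
      using w_lo k that by (intro mult_right_mono mult_left_mono) auto
    moreover have "1 + (2 * k^2 - 1) * t^2 < k * (41 / 10 * k - 181 / 100) * t"
      using that by (rule disjE) (use est(6,7) in \<open>simp_all only:\<close>)
    ultimately show ?thesis unfolding v by linarith
  qed
  have conc: "0 \<le> (11 / 5 - 29 / 20) * ((k * v) * ((\<beta> - 29 / 20) * (11 / 5 - \<beta>)))"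
    using v0 k \<beta>_lo \<beta>_hi by (intro mult_nonneg_nonneg) auto
  \<comment> \<open>The convex quadratic as its chord over the two endpoints minus a nonnegative
    defect.\<close>
  have interp: "(11 / 5 - 29 / 20) * (1 + k * v * \<beta>^2 - k * w * \<beta>)
      = (11 / 5 - \<beta>) * (1 + k * v * (29 / 20)^2 - k * w * (29 / 20))
        + (\<beta> - 29 / 20) * (1 + k * v * (11 / 5)^2 - k * w * (11 / 5))
        - (11 / 5 - 29 / 20) * ((k * v) * ((\<beta> - 29 / 20) * (11 / 5 - \<beta>)))"
    by (simp add: field_simps power2_eq_square)
  have chord: "(11 / 5 - \<beta>) * (1 + k * v * (29 / 20)^2 - k * w * (29 / 20))
        + (\<beta> - 29 / 20) * (1 + k * v * (11 / 5)^2 - k * w * (11 / 5)) < 0"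
  proof -
    have "(11 / 5 - \<beta>) * (1 + k * v * (29 / 20)^2 - k * w * (29 / 20)) \<le> 0"
      "(\<beta> - 29 / 20) * (1 + k * v * (11 / 5)^2 - k * w * (11 / 5)) \<le> 0"
      using ends[of "29 / 20"] ends[of "11 / 5"] \<beta>_lo \<beta>_hi by (intro mult_nonneg_nonpos; simp)+
    moreover have "(11 / 5 - \<beta>) * (1 + k * v * (29 / 20)^2 - k * w * (29 / 20)) < 0
      \<or> (\<beta> - 29 / 20) * (1 + k * v * (11 / 5)^2 - k * w * (11 / 5)) < 0"
      using ends[of "29 / 20"] ends[of "11 / 5"] \<beta>_lo \<beta>_hi
      by (cases "\<beta> < 11 / 5") (auto simp: mult_less_0_iff)
    ultimately show ?thesis by linarith
  qed
  have "L < 0" if "L = M - q" "M < 0" "0 \<le> q" for L M q :: real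
    using that by simp
  from this[OF interp chord conc]
  have "(11 / 5 - 29 / 20) * (1 + k * v * \<beta>^2 - k * w * \<beta>) < 0" .
  then have main: "1 + k * v * \<beta>^2 - k * w * \<beta> < 0" by (simp add: mult_less_0_iff)
  have "v * (\<alpha> + 2 * d * w - 6 * d) \<le> 0" using v0 first by (rule mult_nonneg_nonpos)
  then have "1 + v * (\<alpha> + 2 * d * w - 6 * d) + k * (v * \<beta>^2 - w * \<beta>) < 0"
    using main by (simp add: algebra_simps)
  moreover have "(1 + v * (\<alpha> + 2 * d * w - 6 * d)) / k - w * \<beta> + v * \<beta>^2
      = (1 + v * (\<alpha> + 2 * d * w - 6 * d) + k * (v * \<beta>^2 - w * \<beta>)) / k"
    using k by (simp add: field_simps)
  ultimately show "(1 + v * (\<alpha> + 2 * d * w - 6 * d)) / k - w * \<beta> + v * \<beta>^2 < 0"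
    using k by (simp add: divide_less_0_iff)
qed

text \<open>The second variation of the critical level, at the critical point with parameter \<open>k\<close>, along the
  path used below where \<open>2 \<le> 3 * C^2\<close>; here \<open>D = (1 - b) * C\<close> and \<open>f = 1 - b\<close>.\<close>

lemma second_variation_negative [extraction_expand]:
  fixes b D f X k s :: real
  assumes k: "1 / 2 \<le> k^2" "2 * k^2 + k \<le> 2" "0 < k" and s: "0 < s" "2 * k^2 * s^2 = 1 + k^2"
    and X: "0 < X" and b: "b = X * (2 - k - 2 * k^2)" and f: "f = D * s"
    and D: "2 * k^2 * D = X * (8 * k^4 + 4 * k^3 - 6 * k^2 - k + 1)"
  defines "A \<equiv> 2 * b - 3 * X"
  defines "N0 \<equiv> 3 * D^2 - 2 * f^2" and "N1 \<equiv> 4 * f - 6 * D"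
  defines "Q0 \<equiv> A * N0 + 2 * D^3" and "Q1 \<equiv> 2 * N0 + A * N1 - 6 * D^2" and "Q2 \<equiv> A + 2 * N1 + 6 * D"
  shows "Q0^2 - N0 * Q0 * Q2 - N1 * Q1 * Q0 + N0 * Q1^2 < 0"
proof -
  define d where "d = D / X"
  define v where "v = (2 * k^2 - 1) / k"
  define w where "w = 6 - 4 * s"
  define \<alpha> where "\<alpha> = 4 * k^2 + 2 * k - 1"
  define \<beta> where "\<beta> = 6 * d - 2 * d * v / k - \<alpha> * w"
  have D': "D = X * d" using X by (simp add: d_def)
  have d: "2 * k^2 * d = 8 * k^4 + 4 * k^3 - 6 * k^2 - k + 1"
  proof -
    have "X * (2 * k^2 * d) = X * (8 * k^4 + 4 * k^3 - 6 * k^2 - k + 1)"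
      using D unfolding D' by (simp add: algebra_simps)
    then show ?thesis using X by simp
  qed
  have v: "k * v = 2 * k^2 - 1" using k by (simp add: v_def)
  note sg = second_variation_sign[OF k s d v, folded w_def \<alpha>_def, folded \<beta>_def]
  have "k * (k * (3 - 2 * s^2)) = k * v" using s(2) v by algebra
  then have "k * (3 - 2 * s^2) = v" using k by simp
  then have v': "3 - 2 * s^2 = v / k" using k by (simp add: field_simps)
  have A: "A = - (X * \<alpha>)" unfolding A_def b \<alpha>_def by (simp add: algebra_simps)
  have N0: "N0 = X^2 * d^2 * (v / k)"
    unfolding N0_def f D' v'[symmetric] by (simp add: algebra_simps power_mult_distrib)
  have N1: "N1 = - (X * d * w)" unfolding N1_def f D' w_def by (simp add: algebra_simps)
  \<comment> \<open>On the critical curve this combination is constant, which collapses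
    \<open>Q0\<close> to a monomial and makes the second variation tractable.\<close>
  have "k * (2 * d * k - \<alpha> * v) = k * 1"
  proof -
    have "k * (2 * d * k - \<alpha> * v) = 2 * k^2 * d - \<alpha> * (k * v)"
      by (simp add: algebra_simps power2_eq_square)
    also have "\<dots> = k" unfolding d v \<alpha>_def by (simp add: algebra_simps eval_nat_numeral)
    finally show ?thesis by simp
  qed
  then have one: "2 * d * k - \<alpha> * v = 1" using k by simp
  have "Q0 = X^3 * d^2 / k * (2 * d * k - \<alpha> * v)"
    unfolding Q0_def A N0 D' using k by (simp add: field_simps power2_eq_square power3_eq_cube)
  then have Q0: "Q0 = X^3 * d^2 / k" using one by simp
  have Q1: "Q1 = - (X^2 * d * \<beta>)"
    unfolding Q1_def N0 N1 A D' \<beta>_def by (simp add: algebra_simps power2_eq_square)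
  have Q2: "Q2 = - (X * (\<alpha> + 2 * d * w - 6 * d))"
    unfolding Q2_def A N1 D' by (simp add: algebra_simps)
  have "Q0^2 - N0 * Q0 * Q2 - N1 * Q1 * Q0 + N0 * Q1^2
      = X^6 * d^4 / k * ((1 + v * (\<alpha> + 2 * d * w - 6 * d)) / k - w * \<beta> + v * \<beta>^2)"
    unfolding Q0 Q1 Q2 N0 N1 using k by (simp add: field_simps eval_nat_numeral)
  also have "\<dots> < 0" using sg X k by (intro mult_pos_neg divide_pos_pos) auto
  finally show ?thesis .
qed

section \<open>Local midpoint inequalities for the critical level\<close>

text \<open>After clearing denominators the midpoint defect is exactly \<open>2 * h^2\<close> times
  the left side of \<open>P\<close>. The part of \<open>P\<close> without \<open>h\<close> is
  \<open>Q0^3 / 2\<close> times the second derivative of the quotient at \<open>0\<close>.\<close>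

lemma quotient_midpoint [extraction_expand]:
  fixes N0 N1 Q0 Q1 Q2 h :: real
  assumes P: "Q0^2 - N0 * Q0 * Q2 - N1 * Q1 * Q0 + N0 * Q1^2 + h^2 * (Q0 * Q2 - N0 * Q2^2) < 0"
    and pos: "0 < Q0" "0 < Q0 + Q1 * h + Q2 * h^2" "0 < Q0 - Q1 * h + Q2 * h^2"
  shows "(N0 + N1 * h + h^2) / (Q0 + Q1 * h + Q2 * h^2) + (N0 - N1 * h + h^2) / (Q0 - Q1 * h + Q2 * h^2)
    \<le> 2 * (N0 / Q0)"
proof -
  let ?Np = "N0 + N1 * h + h^2" and ?Nm = "N0 - N1 * h + h^2"
  let ?Qp = "Q0 + Q1 * h + Q2 * h^2" and ?Qm = "Q0 - Q1 * h + Q2 * h^2"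
  have "(?Np * ?Qm + ?Nm * ?Qp) * Q0 - 2 * N0 * (?Qp * ?Qm)
      = 2 * h^2 * (Q0^2 - N0 * Q0 * Q2 - N1 * Q1 * Q0 + N0 * Q1^2 + h^2 * (Q0 * Q2 - N0 * Q2^2))"
    by algebra
  also have "\<dots> \<le> 0" using P by (intro mult_nonneg_nonpos) auto
  finally have "(?Np * ?Qm + ?Nm * ?Qp) * Q0 \<le> 2 * N0 * (?Qp * ?Qm)" by simp
  then have "(?Np * ?Qm + ?Nm * ?Qp) / (?Qp * ?Qm) \<le> 2 * N0 / Q0"
    using pos by (simp add: divide_le_eq pos_le_divide_eq mult_pos_pos)
  moreover have "?Np / ?Qp + ?Nm / ?Qm = (?Np * ?Qm + ?Nm * ?Qp) / (?Qp * ?Qm)"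
    using pos by (simp add: add_frac_eq)
  ultimately show ?thesis by simp
qed

lemma reciprocal_midpoint [extraction_expand]:
  fixes m a x :: real
  assumes "0 \<le> m" "0 < a + x" "0 < a - x"
  shows "2 * (m / a) \<le> m / (a + x) + m / (a - x)"
proof -
  have "0 < a" using assms by simp
  then have "m / (a + x) + m / (a - x) - 2 * (m / a) = 2 * m * x^2 / (a * ((a + x) * (a - x)))"
    using assms by (simp add: divide_simps) (simp add: algebra_simps power2_eq_square)
  also have "0 \<le> \<dots>" using assms \<open>0 < a\<close> by simp
  finally show ?thesis by simp
qed

text \<open>At a critical point with \<open>3 * C^2 \<le> 2\<close> the critical level is convex in \<open>b\<close> for fixed
  \<open>(C, X)\<close>; otherwise \<open>(hval, X)\<close> is held fixed, that is, \<open>(1 - b) * C\<close> decreases at unit rate.\<close>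

lemma Scrit_midpoint_low [extraction_expand]:
  assumes b: "0 < b" "b < 1" and dg: "degen b C X (Scrit b)" and n: "3 * C^2 \<le> 2"
  obtains e where "0 < e"
    "\<And>h. 0 < h \<Longrightarrow> h < e \<Longrightarrow> 2 * Scrit b \<le> Scrit (b + h) + Scrit (b - h)"
proof -
  note pt = Scrit_point_interior[OF less_imp_le[OF b(1)] b(2) dg]
  define m where "m = - (3 * C^2 - 2) * X^3"
  have m: "0 \<le> m" using n pt unfolding m_def by (intro mult_nonneg_nonneg) auto
  \<comment> \<open>Strict forms of the hypotheses of \<open>Scrit_lower\<close>. They hold at
    \<open>b\<close> because the maximizer is interior, and hence nearby.\<close>
  let ?U = "{t. 0 < t \<and> t < 1 \<and> 0 < kap t C X \<and> 0 < room t C X \<and> m < room t C X * kap t C X}"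
  have "open ?U"
    unfolding room_def kap_def hval_def
    by (intro open_Collect_conj open_Collect_less continuous_intros)
  moreover have S: "Scrit b = (3 * room b C X + m / kap b C X) / 4"
    using pt(5,6) unfolding dform_def m_def by (simp add: field_simps)
  moreover have "b \<in> ?U"
  proof -
    have "m / kap b C X < room b C X" using S pt(4) by simp
    then have "m < room b C X * kap b C X" using pt(5) by (simp add: pos_divide_less_eq)
    moreover have "0 < room b C X" using pt(4) Scrit_gt_half[of b] b by simp
    ultimately show ?thesis using b pt by simp
  qed
  ultimately obtain e where e: "0 < e" "ball b e \<subseteq> ?U" by (meson openE)
  have lower: "(3 * room t C X + m / kap t C X) / 4 \<le> Scrit t" if "\<bar>t - b\<bar> < e" for t
  proof -
    have "t \<in> ball b e" using that by (simp add: dist_real_def abs_minus_commute)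
    then have t: "t \<in> ?U" using e(2) by (meson subsetD)
    then have "0 < room t C X * kap t C X" by simp
    then have "- m \<le> 3 * room t C X * kap t C X" using m by linarith
    then have "(3 * room t C X - (3 * C^2 - 2) * X^3 / kap t C X) / 4 \<le> Scrit t"
      using t pt unfolding m_def by (intro Scrit_lower) (auto simp: algebra_simps)
    moreover have "m / kap t C X = - ((3 * C^2 - 2) * X^3 / kap t C X)"
      unfolding m_def by (simp only: mult_minus_left minus_divide_left)
    ultimately show ?thesis by simp
  qed
  have "2 * Scrit b \<le> Scrit (b + h) + Scrit (b - h)" if h: "0 < h" "h < e" for h
  proof -
    define k1 where "k1 = 2 * (3 * C^2 - 2) - 2 * C^3"
    have kp: "kap (b + h) C X = kap b C X + k1 * h" "kap (b - h) C X = kap b C X - k1 * h"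
      unfolding kap_def k1_def by (simp_all add: algebra_simps)
    have r: "room (b + h) C X + room (b - h) C X = 2 * room b C X"
      unfolding room_def hval_def by (simp add: algebra_simps)
    have pos: "0 < kap b C X + k1 * h" "0 < kap b C X - k1 * h"
    proof -
      have "b + h \<in> ball b e" "b - h \<in> ball b e" using h by (simp_all add: dist_real_def)
      then have "b + h \<in> ?U" "b - h \<in> ?U" using e(2) by (meson subsetD)+
      then show "0 < kap b C X + k1 * h" "0 < kap b C X - k1 * h" using kp by auto
    qed
    have "2 * (m / kap b C X) \<le> m / (kap b C X + k1 * h) + m / (kap b C X - k1 * h)"
      using reciprocal_midpoint[OF m pos] .
    moreover have "(3 * room (b + h) C X + m / (kap b C X + k1 * h)) / 4 \<le> Scrit (b + h)"
      "(3 * room (b - h) C X + m / (kap b C X - k1 * h)) / 4 \<le> Scrit (b - h)"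
      using lower[of "b + h"] lower[of "b - h"] h unfolding kp by auto
    moreover have "2 * s \<le> s1 + s2"
      if "2 * p \<le> p1 + p2" "(3 * r1 + p1) / 4 \<le> s1" "(3 * r2 + p2) / 4 \<le> s2"
        "s = (3 * r0 + p) / 4" "r1 + r2 = 2 * r0" for s s1 s2 p p1 p2 r0 r1 r2 :: real
      using that by simp
    ultimately show ?thesis using S r by blast
  qed
  then show ?thesis using that e(1) by blast
qed

text \<open>The path is \<open>b + t\<close>, \<open>C = (D - t) / (f - t)\<close> with
  \<open>X\<close> fixed. Along it \<open>room\<close> is constant, and multiplication by
  \<open>(f - t)^2\<close> turns \<open>3 * C^2 - 2\<close> and \<open>kap\<close> into quadratics
  \<open>N t\<close> and \<open>Q t\<close>, so only the quotient \<open>N t / Q t\<close> has to be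
  concave at \<open>0\<close> to second order.\<close>

lemma Scrit_midpoint_high [extraction_expand]:
  assumes b: "0 < b" "b < 1" and dg: "degen b C X (Scrit b)" and n: "2 \<le> 3 * C^2"
  obtains e where "0 < e"
    "\<And>h. 0 < h \<Longrightarrow> h < e \<Longrightarrow> 2 * Scrit b \<le> Scrit (b + h) + Scrit (b - h)"
proof -
  have b': "0 \<le> b" using b by simp
  note pt = Scrit_point_interior[OF b' b(2) dg]
  obtain k T where kT: "0 < k" "0 < T" "C = k * T" "T^2 * (1 + k^2) = 2"
    "b = X * (2 - k - 2 * k^2)"
    "2 * k^2 * ((1 - b) * C) = X * (8 * k^4 + 4 * k^3 - 6 * k^2 - k + 1)"
    using Scrit_point_param[OF b' b(2) dg] by metis
  define D where "D = (1 - b) * C"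
  define f where "f = 1 - b"
  define s where "s = 1 / C"
  have f: "0 < f" "f = D * s" "D = f * C" using b pt by (auto simp: f_def D_def s_def)
  have D: "0 < D" "D < f" unfolding f(3) using f(1) pt(1,2) by simp_all
  have s: "0 < s" "2 * k^2 * s^2 = 1 + k^2"
  proof -
    show "0 < s" using pt by (simp add: s_def)
    have "2 * k^2 = C^2 * (1 + k^2)" using kT(3,4) by algebra
    then show "2 * k^2 * s^2 = 1 + k^2" using pt(1) by (simp add: s_def power_divide)
  qed
  have "0 < 2 - k - 2 * k^2" using kT(5) b pt by (simp add: zero_less_mult_iff)
  then have k2: "2 * k^2 + k \<le> 2" by simp
  have k1: "1 / 2 \<le> k^2"
  proof -
    have "T^2 * (1 + k^2) \<le> T^2 * (3 * k^2)"
      using n kT(3,4) by (simp add: power_mult_distrib algebra_simps)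
    then have "1 + k^2 \<le> 3 * k^2" by (rule mult_left_le_imp_le) (use kT(2) in simp)
    then show ?thesis by simp
  qed
  define A where "A = 2 * b - 3 * X"
  define N0 where "N0 = 3 * D^2 - 2 * f^2"
  define N1 where "N1 = 4 * f - 6 * D"
  define Q0 where "Q0 = A * N0 + 2 * D^3"
  define Q1 where "Q1 = 2 * N0 + A * N1 - 6 * D^2"
  define Q2 where "Q2 = A + 2 * N1 + 6 * D"
  define P where "P = Q0^2 - N0 * Q0 * Q2 - N1 * Q1 * Q0 + N0 * Q1^2"
  have P: "P < 0"
    unfolding P_def Q0_def Q1_def Q2_def N1_def N0_def A_def
    using second_variation_negative[OF k1 k2 kT(1) s pt(3) kT(5) f(2)] kT(6) D_def by simp
  define N where "N t = N0 + N1 * t + t^2" for t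
  define Q where "Q t = Q0 + Q1 * t + Q2 * t^2" for t
  define R where "R = room b C X"
  have nf: "(3 * ((D - t) / (f - t))^2 - 2) * (f - t)^2 = N t" if "t < f" for t
  proof -
    have "((D - t) / (f - t))^2 * (f - t)^2 = (D - t)^2" using that by (simp add: power_divide)
    then have "(3 * ((D - t) / (f - t))^2 - 2) * (f - t)^2 = 3 * (D - t)^2 - 2 * (f - t)^2"
      by (simp add: left_diff_distrib)
    then show ?thesis unfolding N_def N0_def N1_def by (simp add: algebra_simps power2_eq_square)
  qed
  \<comment> \<open>A priori this is a cubic in \<open>t\<close>; its cubic terms
    \<open>2 * t^3\<close> and \<open>- 2 * t^3\<close> cancel.\<close>
  have kf: "kap (b + t) ((D - t) / (f - t)) X * (f - t)^2 = Q t" if "t < f" for t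
  proof -
    have "kap (b + t) c X * (f - t)^2
        = (3 * c^2 - 2) * (f - t)^2 * (A + 2 * t) + 2 * (f - t)^3 * c^3" for c
      unfolding kap_def A_def f_def by (simp add: algebra_simps power2_eq_square power3_eq_cube)
    then have "kap (b + t) ((D - t) / (f - t)) X * (f - t)^2
        = (3 * ((D - t) / (f - t))^2 - 2) * (f - t)^2 * (A + 2 * t)
          + 2 * (f - t)^3 * ((D - t) / (f - t))^3" .
    also have "(f - t)^3 * ((D - t) / (f - t))^3 = (D - t)^3" using that by (simp add: power_divide)
    then have "2 * (f - t)^3 * ((D - t) / (f - t))^3 = 2 * (D - t)^3" by simp
    finally show ?thesis unfolding nf[OF that]
      unfolding N_def Q_def Q0_def Q1_def Q2_def N0_def N1_def by (simp add: algebra_simps eval_nat_numeral)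
  qed
  have rf: "room (b + t) ((D - t) / (f - t)) X = R" if "t < f" for t
  proof -
    have "hval (b + t) ((D - t) / (f - t)) = hval b C"
    proof -
      have "1 - (b + t) = f - t" by (simp add: f_def)
      then have "hval (b + t) ((D - t) / (f - t)) = b + t + (D - t)"
        using that unfolding hval_def by (simp only:) simp
      then show ?thesis by (simp add: hval_def D_def)
    qed
    then show ?thesis by (simp add: R_def room_def)
  qed
  have C0: "(D - 0) / f = C" "b + 0 = b" "f - 0 = f" using f(1) unfolding f(3) by simp_all
  have Q00: "Q 0 = Q0" "N 0 = N0" by (auto simp: Q_def N_def)
  have Q0pos: "0 < Q0" using kf[of 0] pt(5) f(1) unfolding C0 Q00
    by (metis mult_pos_pos zero_less_power)
  have ratio: "N t * X^3 / Q t = (3 * ((D - t) / (f - t))^2 - 2) * X^3 / kap (b + t) ((D - t) / (f - t)) X"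
    if "t < f" for t
    using that unfolding nf[OF that, symmetric] kf[OF that, symmetric] by simp
  have S: "Scrit b = (3 * R - N0 * X^3 / Q0) / 4"
  proof -
    have "Scrit b = (3 * R - (3 * C^2 - 2) * X^3 / kap b C X) / 4"
      using pt(5,6) unfolding dform_def R_def by (simp add: field_simps)
    then show ?thesis using ratio[of 0] f(1) unfolding C0 Q00 by simp
  qed
  let ?U = "{t. t < f \<and> t < D \<and> - b < t \<and> 0 < Q t \<and> N t * X^3 < 3 * R * Q t \<and> - (N t * X^3) < R * Q t
      \<and> P + t^2 * (Q0 * Q2 - N0 * Q2^2) < 0}"
  have "open ?U"
    unfolding Q_def N_def by (intro open_Collect_conj open_Collect_less continuous_intros)
  moreover have "0 \<in> ?U"
  proof -
    have "N0 * X^3 / Q0 < 3 * R" using S Scrit_gt_half[OF b' b(2)] by simp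
    then have "N0 * X^3 < 3 * R * Q0" using Q0pos by (simp add: pos_divide_less_eq)
    moreover have "- (N0 * X^3) / Q0 < R" using S pt(4) by (simp add: R_def)
    then have "- (N0 * X^3) < R * Q0" using Q0pos by (simp only: pos_divide_less_eq)
    ultimately show ?thesis using f(1) D(1) b P Q0pos by (simp add: Q00)
  qed
  ultimately obtain e where e: "0 < e" "ball 0 e \<subseteq> ?U" by (meson openE)
  have lower: "(3 * R - N t * X^3 / Q t) / 4 \<le> Scrit (b + t)" if "\<bar>t\<bar> < e" for t
  proof -
    have "t \<in> ball 0 e" using that by (simp add: dist_real_def)
    then have t: "t \<in> ?U" using e(2) by (meson subsetD)
    then have tf: "t < f" by simp
    let ?C = "(D - t) / (f - t)"
    have sq: "0 < (f - t)^2" using tf by simp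
    have "0 < kap (b + t) ?C X * (f - t)^2" using t kf[OF tf] by simp
    then have kp: "0 < kap (b + t) ?C X" using sq by (simp add: zero_less_mult_iff)
    have "(3 * ?C^2 - 2) * X^3 * (f - t)^2 < 3 * R * kap (b + t) ?C X * (f - t)^2"
      using t kf[OF tf] nf[OF tf] by (simp add: mult.assoc mult.commute mult.left_commute)
    then have lo: "(3 * ?C^2 - 2) * X^3 \<le> 3 * R * kap (b + t) ?C X" using sq by simp
    have "- ((3 * ?C^2 - 2) * (f - t)^2 * X^3) < R * (kap (b + t) ?C X * (f - t)^2)"
      using t unfolding kf[OF tf] nf[OF tf] by simp
    then have "- (3 * ?C^2 - 2) * X^3 * (f - t)^2 < R * kap (b + t) ?C X * (f - t)^2"
      by (simp add: algebra_simps)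
    then have hi: "- (3 * ?C^2 - 2) * X^3 \<le> R * kap (b + t) ?C X" using sq
      by (simp only: mult_less_cancel_right_pos less_imp_le)
    have "0 \<le> ?C" "?C \<le> 1" using t D by (auto simp: divide_le_eq)
    moreover have "0 \<le> b + t" "b + t \<le> 1" using t tf by (auto simp: f_def)
    ultimately show ?thesis
      using Scrit_lower[of "b + t" ?C X] kp lo hi pt(3) unfolding rf[OF tf] ratio[OF tf] by simp
  qed
  have "2 * Scrit b \<le> Scrit (b + h) + Scrit (b - h)" if h: "0 < h" "h < e" for h
  proof -
    have "h \<in> ball 0 e" "- h \<in> ball 0 e" using h by (simp_all add: dist_real_def)
    then have U: "h \<in> ?U" "- h \<in> ?U" using e(2) by (meson subsetD)+
    have "N h / Q h + N (- h) / Q (- h) \<le> 2 * (N0 / Q0)"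
      using quotient_midpoint[of Q0 N0 Q2 N1 Q1 h] U Q0pos unfolding P_def N_def Q_def by simp
    then have "X^3 * (N h / Q h + N (- h) / Q (- h)) \<le> X^3 * (2 * (N0 / Q0))"
      using pt(3) by (intro mult_left_mono) auto
    then have "N h * X^3 / Q h + N (- h) * X^3 / Q (- h) \<le> 2 * (N0 * X^3 / Q0)"
      by (simp add: distrib_left mult.commute mult.left_commute)
    moreover have "(3 * R - N h * X^3 / Q h) / 4 \<le> Scrit (b + h)"
      "(3 * R - N (- h) * X^3 / Q (- h)) / 4 \<le> Scrit (b - h)"
      using lower[of h] lower[of "- h"] h by simp_all
    moreover have "2 * s \<le> s1 + s2"
      if "p1 + p2 \<le> 2 * p" "(3 * R - p1) / 4 \<le> s1" "(3 * R - p2) / 4 \<le> s2"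
        "s = (3 * R - p) / 4" for s s1 s2 p p1 p2 :: real
      using that by simp
    ultimately show ?thesis using S by blast
  qed
  then show ?thesis using that e(1) by blast
qed

text \<open>The midpoint inequality is available only within a radius depending on the point. If the
  graph rose above a chord, a slightly perturbed excess would have a positive interior maximum, and
  there its second differences would be both nonpositive and positive.\<close>

lemma Scrit_convex [extraction_expand]: "convex_on {0..1} Scrit"
proof (rule convex_on_linorderI)
  fix t x y :: real
  assume t: "0 < t" "t < 1" and xy: "x \<in> {0..1}" "y \<in> {0..1}" "x < y"
  define z where "z = (1 - t) * x + t * y"
  define sl where "sl = (Scrit y - Scrit x) / (y - x)"
  define l where "l u = Scrit x + (u - x) * sl" for u
  have lz: "l z = (1 - t) * Scrit x + t * Scrit y"
  proof -
    have "z - x = t * (y - x)" by (simp add: z_def algebra_simps)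
    then have "l z = Scrit x + t * (Scrit y - Scrit x)" using xy by (simp add: l_def sl_def)
    then show ?thesis by (simp add: algebra_simps)
  qed
  have z: "x < z" "z < y"
  proof -
    have "z - x = t * (y - x)" "y - z = (1 - t) * (y - x)" by (simp_all add: z_def algebra_simps)
    then show "x < z" "z < y" using t xy by (metis diff_gt_0_iff_gt mult_pos_pos)+
  qed
  have "Scrit z \<le> l z"
  proof (rule ccontr)
    assume "\<not> Scrit z \<le> l z"
    \<comment> \<open>Half the excess: since \<open>(z - x) * (y - z) \<le> 1\<close>, the penalty
      leaves the value at \<open>z\<close> positive. It vanishes at \<open>x\<close> and
      \<open>y\<close>, and subtracting it adds \<open>2 * g * h^2\<close> to second
      differences.\<close>
    define g where "g = (Scrit z - l z) / 2"
    have "2 * g = Scrit z - l z" by (simp add: g_def)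
    have g: "0 < g" using \<open>\<not> Scrit z \<le> l z\<close> by (simp add: g_def)
    define \<phi> where "\<phi> u S = S - l u - g * ((u - x) * (y - u))" for u S
    let ?K = "degen_set \<inter> {p. x \<le> fst p} \<inter> {p. fst p \<le> y}"
    have "compact ?K"
      by (intro compact_Int_closed compact_degen_set closed_Collect_le continuous_intros)
    moreover obtain Cz Xz where dz: "degen z Cz Xz (Scrit z)" using Scrit_attained[of z] z xy by auto
    then have zK: "(z, Cz, Xz, Scrit z) \<in> ?K" using z xy by (simp add: degen_set_def)
    moreover have "continuous_on ?K (\<lambda>p. \<phi> (fst p) (snd (snd (snd p))))"
      unfolding \<phi>_def l_def by (intro continuous_intros)
    ultimately obtain p where p: "p \<in> ?K"
      "\<And>q. q \<in> ?K \<Longrightarrow> \<phi> (fst q) (snd (snd (snd q))) \<le> \<phi> (fst p) (snd (snd (snd p)))"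
      using continuous_attains_sup[of ?K "\<lambda>p. \<phi> (fst p) (snd (snd (snd p)))"] by blast
    obtain b C X S where pp: "p = (b, C, X, S)" by (cases p) auto
    have b: "x \<le> b" "b \<le> y" "0 \<le> b" "b \<le> 1" and dS: "degen b C X S"
      using p(1) pp by (auto simp: degen_set_def)
    have max: "\<phi> u (Scrit u) \<le> \<phi> b S" if u: "x \<le> u" "u \<le> y" for u
    proof -
      have u01: "0 \<le> u" "u \<le> 1" using u xy by auto
      then obtain C' X' where "degen u C' X' (Scrit u)" using Scrit_attained by blast
      then show ?thesis using p(2)[of "(u, C', X', Scrit u)"] u u01 pp by (simp add: degen_set_def)
    qed
    have "S = Scrit b" using max[of b] b Scrit_upper[OF b(3,4) dS] by (simp add: \<phi>_def)
    have "0 < \<phi> z (Scrit z)"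
    proof -
      have "(z - x) * (y - z) \<le> 1 * 1" using z xy by (intro mult_mono) auto
      then have "g * ((z - x) * (y - z)) \<le> g * 1" using g by (intro mult_left_mono) auto
      then have "g * ((z - x) * (y - z)) < Scrit z - l z" using g \<open>2 * g = Scrit z - l z\<close> by linarith
      then show ?thesis unfolding \<phi>_def by simp
    qed
    then have pos: "0 < \<phi> b (Scrit b)" using max[of z] z \<open>S = Scrit b\<close> by simp
    have "b \<noteq> x" using pos by (auto simp: \<phi>_def l_def)
    moreover have "b \<noteq> y" using pos xy by (auto simp: \<phi>_def l_def sl_def)
    ultimately have bi: "x < b" "b < y" using b by auto
    then have b01: "0 < b" "b < 1" using xy by auto
    obtain e where e: "0 < e"
      "\<And>h. 0 < h \<Longrightarrow> h < e \<Longrightarrow> 2 * Scrit b \<le> Scrit (b + h) + Scrit (b - h)"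
    proof (cases "3 * C^2 \<le> 2")
      case True
      then show ?thesis using Scrit_midpoint_low[OF b01] dS \<open>S = Scrit b\<close> that by metis
    next
      case False
      then show ?thesis using Scrit_midpoint_high[OF b01] dS \<open>S = Scrit b\<close> that by (metis linear)
    qed
    define h where "h = Min {e, b - x, y - b} / 2"
    have "0 < Min {e, b - x, y - b}" using e bi by simp
    then have h: "0 < h" "h < e" "h < b - x" "h < y - b" by (auto simp: h_def)
    have "\<phi> (b + h) (Scrit (b + h)) \<le> \<phi> b (Scrit b)" "\<phi> (b - h) (Scrit (b - h)) \<le> \<phi> b (Scrit b)"
      using max[of "b + h"] max[of "b - h"] h \<open>S = Scrit b\<close> by auto
    then have "\<phi> (b + h) (Scrit (b + h)) + \<phi> (b - h) (Scrit (b - h)) - 2 * \<phi> b (Scrit b) \<le> 0" by simp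
    moreover have "\<phi> (b + h) (Scrit (b + h)) + \<phi> (b - h) (Scrit (b - h)) - 2 * \<phi> b (Scrit b)
        = Scrit (b + h) + Scrit (b - h) - 2 * Scrit b + 2 * g * h^2"
      unfolding \<phi>_def l_def by (simp add: algebra_simps power2_eq_square)
    moreover have "0 < 2 * g * h^2" using g h by simp
    ultimately show False using e(2)[OF h(1,2)] by simp
  qed
  then show "Scrit ((1 - t) *\<^sub>R x + t *\<^sub>R y) \<le> (1 - t) * Scrit x + t * Scrit y"
    using lz by (simp add: z_def)
qed (simp add: convex_real_interval)

section \<open>Monotonicity of the critical level\<close>

text \<open>By convexity it is enough that \<open>Scrit\<close> rises immediately after
  \<open>0\<close>. With the maximizer \<open>(C, X)\<close> for \<open>b = 0\<close> held fixed,
  the level increases in \<open>b\<close> if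
  \<open>n * X^2 * (C^3 - n) < 3 * (1 - C) * \<kappa>^2\<close>. Stationarity replaces
  \<open>\<kappa>^2\<close> by \<open>X^2 * C^2 * (2 - C^2)\<close>, which leaves the inequality
  \<open>main\<close> in \<open>C\<close> alone.\<close>

lemma Scrit_0_less [extraction_expand]:
  assumes b: "0 < b" "b \<le> 1"
  shows "Scrit 0 < Scrit b"
proof -
  obtain C X where dg: "degen 0 C X (Scrit 0)" using Scrit_attained[of 0] by auto
  have z: "(0::real) \<le> 0" "(0::real) < 1" by simp_all
  note pt = Scrit_point_interior[OF z dg] and st = Scrit_point_stationary(2)[OF z dg]
  obtain k T where kT: "0 < k" "C = k * T" "T^2 * (1 + k^2) = 2" "0 = X * (2 - k - 2 * k^2)"
    using Scrit_point_param[OF z dg] by metis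
  have k: "2 * k^2 + k = 2" using kT(4) pt by simp
  have kr: "7 / 10 \<le> k" "k \<le> 782 / 1000"
  proof -
    have "k \<le> 1"
    proof (rule ccontr)
      assume "\<not> k \<le> 1"
      then have "1 < k" "1 \<le> k^2" by (simp_all add: one_le_power)
      then show False using k by linarith
    qed
    then have "1 / 2 \<le> k^2" using k by simp
    then show "7 / 10 \<le> k" "k \<le> 782 / 1000" using param_range[of k] k kT(1) by simp_all
  qed
  have eC: "C^2 * (4 - k) = 2 * (2 - k)" using kT(2,3) k by algebra
  have C2: "75 / 100 \<le> C^2" "C^2 \<le> 79 / 100"
  proof -
    have p: "0 < 4 - k" using kr by simp
    have lo: "75 / 100 * (4 - k) \<le> C^2 * (4 - k)" and hi: "C^2 * (4 - k) \<le> 79 / 100 * (4 - k)"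
      unfolding eC using kr by simp_all
    show "75 / 100 \<le> C^2" by (rule mult_right_le_imp_le[OF lo p])
    show "C^2 \<le> 79 / 100" by (rule mult_right_le_imp_le[OF hi p])
  qed
  have C1: "C \<le> 89 / 100"
  proof (rule ccontr)
    assume "\<not> C \<le> 89 / 100"
    then have "(89 / 100)^2 < C^2" by (intro power_strict_mono) auto
    then show False using C2 by (simp add: power_divide)
  qed
  define n where "n = 3 * C^2 - 2"
  have n: "25 / 100 \<le> n" "n \<le> 37 / 100" using C2 by (auto simp: n_def)
  have C3: "C^3 \<le> 71 / 100"
  proof -
    have "C * C^2 \<le> 89 / 100 * (79 / 100)" using C1 C2 pt by (intro mult_mono) auto
    then show ?thesis by (simp add: power3_eq_cube power2_eq_square)
  qed
  have "n * (C^3 - n) \<le> 37 / 100 * (46 / 100)"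
  proof (cases "0 \<le> C^3 - n")
    case True
    then show ?thesis using n C3 by (intro mult_mono) auto
  next
    case False
    then have "n * (C^3 - n) \<le> 0" using n by (intro mult_nonneg_nonpos) auto
    then show ?thesis by simp
  qed
  moreover have "11 / 100 * (75 / 100) * (121 / 100) \<le> (1 - C) * C^2 * (2 - C^2)"
    using C1 C2 by (intro mult_mono mult_nonneg_nonneg) auto
  ultimately have main: "n * (C^3 - n) < 3 * ((1 - C) * C^2 * (2 - C^2))" by simp
  define \<kappa> where "\<kappa> = kap 0 C X"
  define R where "R = room 0 C X"
  have \<kappa>0: "0 < \<kappa>" and SR: "Scrit 0 < R" using pt by (auto simp: \<kappa>_def R_def)
  have S: "Scrit 0 = (3 * R - n * X^3 / \<kappa>) / 4"
    using pt(5,6) unfolding dform_def n_def \<kappa>_def R_def by (simp add: field_simps)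
  have kh: "kap h C X = \<kappa> - 2 * (C^3 - n) * h" for h
    unfolding \<kappa>_def kap_def n_def by (simp add: algebra_simps)
  have rh: "room h C X = R + 2 * X * (1 - C) * h" for h
    unfolding R_def room_def hval_def by (simp add: algebra_simps)
  let ?U = "{h. h < 1 \<and> 0 < kap h C X \<and> n * X^3 < 3 * room h C X * kap h C X
    \<and> - n * X^3 < room h C X * kap h C X \<and> n * X^2 * (C^3 - n) < 3 * (1 - C) * \<kappa> * kap h C X}"
  have "open ?U"
    unfolding room_def kap_def hval_def
    by (intro open_Collect_conj open_Collect_less continuous_intros)
  moreover have "0 \<in> ?U"
  proof -
    have "n * X^3 / \<kappa> < 3 * R" using S Scrit_gt_half[of 0] by simp
    then have "n * X^3 < 3 * R * \<kappa>" using \<kappa>0 by (simp add: pos_divide_less_eq)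
    moreover have "- n * X^3 < R * \<kappa>"
    proof -
      have "0 < n * X^3" "0 < R * \<kappa>" using n pt \<kappa>0 SR Scrit_gt_half[of 0] by simp_all
      then show ?thesis by simp
    qed
    moreover have "X^2 * (n * (C^3 - n)) < X^2 * (3 * ((1 - C) * C^2 * (2 - C^2)))"
      using main pt by simp
    then have "n * X^2 * (C^3 - n) < 3 * (1 - C) * \<kappa>^2"
      unfolding \<kappa>_def st by (simp add: algebra_simps)
    ultimately show ?thesis using \<kappa>0 by (simp add: kh rh power2_eq_square mult.assoc)
  qed
  ultimately obtain d where d: "0 < d" "ball 0 d \<subseteq> ?U" by (meson openE)
  define h where "h = min d b / 2"
  have h: "0 < h" "h < d" "h < b" using d b by (auto simp: h_def)
  then have "h \<in> ball 0 d" by (simp add: dist_real_def)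
  then have hU: "h \<in> ?U" using d(2) by (meson subsetD)
  have "(3 * room h C X - n * X^3 / kap h C X) / 4 \<le> Scrit h"
    using hU h pt unfolding n_def by (intro Scrit_lower) auto
  moreover have "Scrit 0 < (3 * room h C X - n * X^3 / kap h C X) / 4"
  proof -
    have pos: "0 < \<kappa> * kap h C X" using \<kappa>0 hU by simp
    have "3 * room h C X - n * X^3 / kap h C X - 4 * Scrit 0
        = 2 * h * X * (3 * (1 - C) - n * X^2 * (C^3 - n) / (\<kappa> * kap h C X))"
    proof -
      have "n * X^3 / kap h C X - n * X^3 / \<kappa> = n * X^3 * (\<kappa> - kap h C X) / (\<kappa> * kap h C X)"
        using \<kappa>0 hU by (simp add: diff_frac_eq algebra_simps)
      also have "\<kappa> - kap h C X = 2 * (C^3 - n) * h" by (simp add: kh)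
      finally have "n * X^3 / kap h C X - n * X^3 / \<kappa>
          = 2 * h * X * (n * X^2 * (C^3 - n) / (\<kappa> * kap h C X))"
        by (simp add: power3_eq_cube power2_eq_square mult.commute mult.left_commute)
      moreover have "3 * (R + 2 * X * (1 - C) * h) - A - (3 * R - B) = 2 * h * X * (3 * (1 - C) - Z)"
        if "A - B = 2 * h * X * Z" for A B Z
        using that by (simp add: algebra_simps)
      moreover have "4 * Scrit 0 = 3 * R - n * X^3 / \<kappa>" using S by simp
      ultimately show ?thesis unfolding rh by simp
    qed
    moreover have "n * X^2 * (C^3 - n) / (\<kappa> * kap h C X) < 3 * (1 - C)"
      using hU pos by (simp add: pos_divide_less_eq mult.assoc)
    then have "0 < 2 * h * X * (3 * (1 - C) - n * X^2 * (C^3 - n) / (\<kappa> * kap h C X))"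
      using h pt by simp
    ultimately have "0 < 3 * room h C X - n * X^3 / kap h C X - 4 * Scrit 0" by (simp only:)
    then show ?thesis by simp
  qed
  ultimately have up: "Scrit 0 < Scrit h" by simp
  show ?thesis
  proof (rule ccontr)
    assume "\<not> Scrit 0 < Scrit b"
    have "Scrit ((1 - h / b) *\<^sub>R 0 + (h / b) *\<^sub>R b) \<le> (1 - h / b) * Scrit 0 + h / b * Scrit b"
      using h b by (intro convex_onD[OF Scrit_convex]) auto
    also have "\<dots> \<le> (1 - h / b) * Scrit 0 + h / b * Scrit 0"
      using \<open>\<not> Scrit 0 < Scrit b\<close> h b by (intro add_left_mono mult_left_mono) auto
    finally show False using up b by (simp add: algebra_simps)
  qed
qed

lemma Scrit_strict_mono [extraction_expand]:
  assumes "0 \<le> x" "x < y" "y \<le> 1"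
  shows "Scrit x < Scrit y"
proof (cases "x = 0")
  case True
  then show ?thesis using Scrit_0_less assms by simp
next
  case False
  have "Scrit ((1 - x / y) *\<^sub>R 0 + (x / y) *\<^sub>R y) \<le> (1 - x / y) * Scrit 0 + x / y * Scrit y"
    using assms by (intro convex_onD[OF Scrit_convex]) auto
  also have "\<dots> < (1 - x / y) * Scrit y + x / y * Scrit y"
    using Scrit_0_less[of y] assms by (intro add_strict_right_mono mult_strict_left_mono) auto
  finally show ?thesis using assms by (simp add: algebra_simps)
qed

lemma Scrit_less_1 [extraction_expand]: "0 \<le> b \<Longrightarrow> b < 1 \<Longrightarrow> Scrit b < 1"
  using Scrit_strict_mono[of b 1] Scrit_1 by simp

section \<open>The critical eccentricity\<close>

definition e_crit :: "real \<Rightarrow> real" where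
  "e_crit b = sqrt (1 - Scrit b)"

lemma e_crit_range [extraction_expand]: "e_crit \<in> {0..1} \<rightarrow> {0..1}"
proof
  fix b :: real assume b: "b \<in> {0..1}"
  have "0 \<le> Scrit b" "Scrit b \<le> 1"
    using b Scrit_upper[OF _ _ degen_zero, of b] Scrit_le_1[of b] by auto
  then show "e_crit b \<in> {0..1}" by (simp add: e_crit_def)
qed

lemma e_crit_strict_antimono [extraction_expand]: "strict_antimono_on {0..1} e_crit"
  by (rule monotone_onI) (simp add: e_crit_def Scrit_strict_mono)

text \<open>Squares are convex, so the square of a mean of eccentricities is at most the mean of
  \<open>1 - Scrit\<close>, and convexity of \<open>Scrit\<close> bounds that by its value at the
  mean point.\<close>

lemma e_crit_concave [extraction_expand]: "concave_on {0..1} e_crit"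
  unfolding concave_on_iff
proof (intro conjI ballI allI impI)
  fix x y u v :: real
  assume xy: "x \<in> {0..1}" "y \<in> {0..1}" and uv: "0 \<le> u" "0 \<le> v" "u + v = 1"
  define p q where "p = e_crit x" and "q = e_crit y"
  have pq: "0 \<le> p" "0 \<le> q" "p^2 = 1 - Scrit x" "q^2 = 1 - Scrit y"
    using xy Scrit_le_1 by (auto simp: p_def q_def e_crit_def)
  have "(u * p + v * q)^2 = u * p^2 + v * q^2 - u * v * (p - q)^2"
    using uv(3) by algebra
  also have "\<dots> \<le> u * p^2 + v * q^2" using uv by simp
  also have "\<dots> = 1 - (u * Scrit x + v * Scrit y)"
    unfolding pq using uv(3) by (simp add: algebra_simps)
  also have "\<dots> \<le> 1 - Scrit (u *\<^sub>R x + v *\<^sub>R y)"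
  proof -
    have "Scrit (u *\<^sub>R x + v *\<^sub>R y) \<le> u * Scrit x + v * Scrit y"
      using Scrit_convex xy uv unfolding convex_on_def by blast
    then show ?thesis by simp
  qed
  finally have "(u * p + v * q)^2 \<le> 1 - Scrit (u *\<^sub>R x + v *\<^sub>R y)" .
  then show "u * e_crit x + v * e_crit y \<le> e_crit (u *\<^sub>R x + v *\<^sub>R y)"
    unfolding p_def[symmetric] q_def[symmetric] e_crit_def[of "u *\<^sub>R x + v *\<^sub>R y"]
    by (rule real_le_rsqrt)
qed (simp add: convex_real_interval)

lemma e_crit_0 [extraction_expand]: "e_crit 0 = (7 + sqrt 17) / 16"
  by (simp add: e_crit_def Scrit_0)

lemma e_crit_1 [extraction_expand]: "e_crit 1 = 0"
  by (simp add: e_crit_def Scrit_1)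

lemma e_crit_in_domain [extraction_expand]:
  assumes "b \<in> {0<..<1}"
  shows "(b, e_crit b) \<in> par_domain"
proof -
  have "(e_crit b)^2 = 1 - Scrit b" "0 < e_crit b" "b^2 < Scrit b"
    using assms Scrit_less_1[of b] Scrit_gt_square[of b] by (auto simp: e_crit_def)
  moreover have "0 < b^2 + (e_crit b)^2"
    using assms by (intro add_pos_nonneg) auto
  ultimately show ?thesis using assms unfolding par_domain_def by simp
qed

section \<open>Convexity of strict sublevel sets\<close>

lemma second_derivative_min [extraction_expand]:
  fixes \<phi> \<psi> :: "real \<Rightarrow> real"
  assumes d: "0 < d" "\<And>s. \<bar>s - t\<bar> < d \<Longrightarrow> (\<phi> has_real_derivative \<psi> s) (at s)"
    and \<psi>: "(\<psi> has_real_derivative l) (at t)" "\<psi> t = 0" "0 < l"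
  obtains e where "0 < e" "\<And>h. 0 < \<bar>h\<bar> \<Longrightarrow> \<bar>h\<bar> < e \<Longrightarrow> \<phi> t < \<phi> (t + h)"
proof -
  obtain e1 where e1: "0 < e1" "\<And>h. 0 < h \<Longrightarrow> h < e1 \<Longrightarrow> 0 < \<psi> (t + h)"
    using DERIV_pos_inc_right[OF \<psi>(1,3)] \<psi>(2) by auto
  obtain e2 where e2: "0 < e2" "\<And>h. 0 < h \<Longrightarrow> h < e2 \<Longrightarrow> \<psi> (t - h) < 0"
    using DERIV_pos_inc_left[OF \<psi>(1,3)] \<psi>(2) by auto
  define e where "e = min d (min e1 e2)"
  have "\<phi> t < \<phi> (t + h)" if h: "0 < \<bar>h\<bar>" "\<bar>h\<bar> < e" for h
  proof (cases "0 < h")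
    case True
    then have "\<exists>z. t < z \<and> z < t + h \<and> \<phi> (t + h) - \<phi> t = (t + h - t) * \<psi> z"
      using h d(2) by (intro MVT2) (auto simp: e_def)
    then obtain z where z: "t < z" "z < t + h" "\<phi> (t + h) - \<phi> t = h * \<psi> z" by auto
    have "0 < \<psi> (t + (z - t))" using z True h by (intro e1) (auto simp: e_def)
    then show ?thesis using z True by (metis add.commute diff_add_cancel diff_gt_0_iff_gt mult_pos_pos)
  next
    case False
    then have "\<exists>z. t + h < z \<and> z < t \<and> \<phi> t - \<phi> (t + h) = (t - (t + h)) * \<psi> z"
      using h d(2) by (intro MVT2) (auto simp: e_def)
    then obtain z where z: "t + h < z" "z < t" "\<phi> t - \<phi> (t + h) = - h * \<psi> z" by auto
    have "\<psi> (t - (t - z)) < 0" using z False h by (intro e2) (auto simp: e_def)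
    then have "- h * \<psi> z < 0" using False h by (intro mult_pos_neg) auto
    then show ?thesis using z by simp
  qed
  moreover have "0 < e" using d e1 e2 by (simp add: e_def)
  ultimately show ?thesis using that by blast
qed

text \<open>A local-to-global principle: if a segment inside the closed sublevel set had its
  interior meet the level, it would be tangent there, against the second-order condition. So the
  set of endpoints visible from a fixed point is open and closed.\<close>

lemma convex_strict_sublevel [extraction_expand]:
  fixes F :: "'a::euclidean_space \<Rightarrow> real"
  assumes U0: "open U0"
    and F1: "\<And>x. x \<in> U0 \<Longrightarrow> (F has_derivative dF x) (at x)"
    and F2: "\<And>x v. x \<in> U0 \<Longrightarrow> ((\<lambda>y. dF y v) has_derivative ddF x v) (at x)"
    and cl: "closed {x \<in> U0. F x \<le> c}"
    and conn: "connected {x \<in> U0. F x < c}"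
    and tang: "\<And>x v. x \<in> U0 \<Longrightarrow> F x = c \<Longrightarrow> v \<noteq> 0 \<Longrightarrow> dF x v = 0 \<Longrightarrow> 0 < ddF x v v"
  shows "convex {x \<in> U0. F x < c}"
proof -
  define U where "U = {x \<in> U0. F x < c}"
  have cont: "continuous_on U0 F"
    by (intro continuous_at_imp_continuous_on ballI has_derivative_continuous[OF F1])
  have oU: "open U"
  proof -
    have "U = U0 \<inter> F -` {..<c}" by (auto simp: U_def)
    then show ?thesis using continuous_open_preimage[OF cont U0, of "{..<c}"] by simp
  qed
  have seg: "closed_segment x y \<subseteq> U" if x: "x \<in> U" and y: "y \<in> U" for x y
  proof -
    define B where "B = {y \<in> U. closed_segment x y \<subseteq> U}"
    have "open B"
      unfolding open_contains_ball
    proof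
      fix y assume "y \<in> B"
      then have yU: "closed_segment x y \<subseteq> U" by (simp add: B_def)
      then obtain e where e: "0 < e" "(\<Union>p\<in>closed_segment x y. ball p e) \<subseteq> U"
        using compact_subset_open_imp_ball_epsilon_subset[OF compact_segment oU] by metis
      have "closed_segment x y' \<subseteq> U" if "dist y y' < e" for y'
      proof
        fix q assume "q \<in> closed_segment x y'"
        then obtain s where s: "0 \<le> s" "s \<le> 1" "q = (1 - s) *\<^sub>R x + s *\<^sub>R y'"
          by (auto simp: closed_segment_def)
        define p where "p = (1 - s) *\<^sub>R x + s *\<^sub>R y"
        have "dist p q = s * dist y y'"
          using s by (simp add: p_def dist_norm flip: scaleR_diff_right)
        also have "\<dots> \<le> 1 * dist y y'" using s by (intro mult_right_mono) auto
        finally have "q \<in> ball p e" using that by simp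
        moreover have "p \<in> closed_segment x y" using s by (auto simp: p_def closed_segment_def)
        ultimately show "q \<in> U" using e by blast
      qed
      then have "ball y e \<subseteq> B" by (force simp: B_def)
      then show "\<exists>e>0. ball y e \<subseteq> B" using e(1) by blast
    qed
    \<comment> \<open>Endpoints whose segment from \<open>x\<close> stays in the closed sublevel
      set. \<open>T\<close> is closed, and \<open>vis\<close> shows that inside \<open>U\<close> it
      coincides with the set \<open>B\<close> of endpoints visible within \<open>U\<close>.\<close>
    define T where "T = (\<Inter>s\<in>{0..1}. (\<lambda>y. (1 - s) *\<^sub>R x + s *\<^sub>R y) -` {x \<in> U0. F x \<le> c})"
    have "closed T"
      unfolding T_def by (intro closed_INT ballI closed_vimage cl continuous_intros)
    have vis: "l \<in> B" if l: "l \<in> U" "l \<in> T" for l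
    proof -
      have le: "(1 - s) *\<^sub>R x + s *\<^sub>R l \<in> {x \<in> U0. F x \<le> c}" if s: "0 \<le> s" "s \<le> 1" for s
        using l(2) s unfolding T_def by simp
      have "(1 - t) *\<^sub>R x + t *\<^sub>R l \<in> U" if t: "0 \<le> t" "t \<le> 1" for t
      proof (rule ccontr)
        assume not: "(1 - t) *\<^sub>R x + t *\<^sub>R l \<notin> U"
        define v where "v = l - x"
        define \<phi> where "\<phi> s = F (x + s *\<^sub>R v)" for s
        have line: "x + s *\<^sub>R v = (1 - s) *\<^sub>R x + s *\<^sub>R l" for s
          by (simp add: v_def algebra_simps)
        have inU0: "x + s *\<^sub>R v \<in> U0" and \<phi>c: "\<phi> s \<le> c" if "0 \<le> s" "s \<le> 1" for s
          using le[OF that] by (auto simp: line \<phi>_def)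
        have Ft: "F (x + t *\<^sub>R v) = c" using le[OF t] not by (auto simp: line U_def)
        have "t \<noteq> 0" "t \<noteq> 1" using x l not by auto
        then have t01: "0 < t" "t < 1" using t by auto
        have "v \<noteq> 0" using x Ft by (auto simp: U_def)
        have lin: "((\<lambda>s. x + s *\<^sub>R v) has_derivative (\<lambda>h. h *\<^sub>R v)) (at s)" for s
          by (auto intro!: derivative_eq_intros)
        have d1: "(\<phi> has_real_derivative dF (x + s *\<^sub>R v) v) (at s)" if "0 \<le> s" "s \<le> 1" for s
        proof -
          have F': "(F has_derivative dF (x + s *\<^sub>R v)) (at (x + s *\<^sub>R v))" using F1 inU0 that by simp
          have "dF (x + s *\<^sub>R v) (h *\<^sub>R v) = dF (x + s *\<^sub>R v) v * h" for h
            using linear_cmul[OF has_derivative_linear[OF F']] by simp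
          then show ?thesis
            using has_derivative_compose[OF lin F'] by (simp add: has_field_derivative_def \<phi>_def[abs_def])
        qed
        have d2: "((\<lambda>s. dF (x + s *\<^sub>R v) v) has_real_derivative ddF (x + t *\<^sub>R v) v v) (at t)"
        proof -
          have F': "((\<lambda>y. dF y v) has_derivative ddF (x + t *\<^sub>R v) v) (at (x + t *\<^sub>R v))"
            using F2 inU0 t by simp
          have "ddF (x + t *\<^sub>R v) v (h *\<^sub>R v) = ddF (x + t *\<^sub>R v) v v * h" for h
            using linear_cmul[OF has_derivative_linear[OF F']] by simp
          then show ?thesis
            using has_derivative_compose[OF lin F'] by (simp add: has_field_derivative_def)
        qed
        define \<delta> where "\<delta> = min t (1 - t)"
        have \<delta>: "0 < \<delta>" using t01 by (simp add: \<delta>_def)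
        have d1': "(\<phi> has_real_derivative dF (x + s *\<^sub>R v) v) (at s)" if "\<bar>s - t\<bar> < \<delta>" for s
          using that by (intro d1) (auto simp: \<delta>_def)
        have max: "\<phi> s \<le> \<phi> t" if "\<bar>t - s\<bar> < \<delta>" for s
          using \<phi>c[of s] Ft that by (auto simp: \<phi>_def \<delta>_def)
        have "dF (x + t *\<^sub>R v) v = 0"
          using DERIV_local_max[OF d1[OF t] \<delta>] max by auto
        then have "0 < ddF (x + t *\<^sub>R v) v v" using tang inU0 t Ft \<open>v \<noteq> 0\<close> by simp
        then obtain e where e: "0 < e" "\<And>h. 0 < \<bar>h\<bar> \<Longrightarrow> \<bar>h\<bar> < e \<Longrightarrow> \<phi> t < \<phi> (t + h)"
          using second_derivative_min[OF \<delta> d1' d2 \<open>dF (x + t *\<^sub>R v) v = 0\<close>] by metis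
        define h where "h = min e \<delta> / 2"
        have "0 < h" "h < e" "h < \<delta>" using e \<delta> by (auto simp: h_def)
        then show False using e(2)[of h] max[of "t + h"] by simp
      qed
      then have "closed_segment x l \<subseteq> U" by (auto simp: closed_segment_def)
      then show "l \<in> B" using l by (simp add: B_def)
    qed
    have "B \<subseteq> T"
    proof
      fix y assume "y \<in> B"
      then have "(1 - s) *\<^sub>R x + s *\<^sub>R y \<in> U" if "s \<in> {0..1}" for s
        using that by (auto simp: B_def closed_segment_def)
      then show "y \<in> T" unfolding T_def U_def by fastforce
    qed
    then have "B = U \<inter> T" using vis by (auto simp: B_def)
    then have "closedin (top_of_set U) B" using \<open>closed T\<close> by (auto simp: closedin_closed)
    moreover have "x \<in> B" using x by (simp add: B_def)
    moreover have "openin (top_of_set U) B"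
    proof -
      have "B = U \<inter> B" by (auto simp: B_def)
      then show ?thesis using \<open>open B\<close> openin_open by blast
    qed
    ultimately have "B = U"
      using conn[folded U_def] unfolding connected_clopen by blast
    then show ?thesis using y by (auto simp: B_def)
  qed
  then show ?thesis unfolding U_def[symmetric] by (simp add: convex_contains_segment)
qed

section \<open>The Hessian on the energy surface\<close>

definition rho :: "real \<Rightarrow> real \<Rightarrow> real \<Rightarrow> real" where
  "rho a r z = sqrt (r^2 + (1 + 2 * a) * z^2)"

text \<open>The kinetic energy left at energy \<open>-1\<close>; the Hill region is where it is
  nonnegative.\<close>

definition hill :: "real \<Rightarrow> real \<Rightarrow> real \<Rightarrow> real \<Rightarrow> real" where
  "hill w a r z = 1 / r + (4 / a) / rho a r z - 1 - w^2 / (2 * r^2)"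

definition Vr :: "real \<Rightarrow> real \<Rightarrow> real \<Rightarrow> real \<Rightarrow> real" where
  "Vr w a r z = 1 / r^2 - w^2 / r^3 + (4 / a) * r / rho a r z ^ 3"

definition Vz :: "real \<Rightarrow> real \<Rightarrow> real \<Rightarrow> real" where
  "Vz a r z = (4 / a) * (1 + 2 * a) * z / rho a r z ^ 3"

definition Vrr :: "real \<Rightarrow> real \<Rightarrow> real \<Rightarrow> real \<Rightarrow> real" where
  "Vrr w a r z = 3 * w^2 / r^4 - 2 / r^3 + (4 / a) * (1 / rho a r z ^ 3 - 3 * r^2 / rho a r z ^ 5)"

definition Vrz :: "real \<Rightarrow> real \<Rightarrow> real \<Rightarrow> real" where
  "Vrz a r z = - 3 * (4 / a) * (1 + 2 * a) * r * z / rho a r z ^ 5"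

definition Vzz :: "real \<Rightarrow> real \<Rightarrow> real \<Rightarrow> real" where
  "Vzz a r z = (4 / a) * ((1 + 2 * a) / rho a r z ^ 3 - 3 * (1 + 2 * a)^2 * z^2 / rho a r z ^ 5)"

definition dHam :: "real \<Rightarrow> real \<Rightarrow> real ^ 4 \<Rightarrow> real ^ 4 \<Rightarrow> real" where
  "dHam w a x v = x $ 1 * v $ 1 + x $ 2 * v $ 2 + Vr w a (x $ 3) (x $ 4) * v $ 3 + Vz a (x $ 3) (x $ 4) * v $ 4"

definition ddHam :: "real \<Rightarrow> real \<Rightarrow> real ^ 4 \<Rightarrow> real ^ 4 \<Rightarrow> real ^ 4 \<Rightarrow> real" where
  "ddHam w a x u v = u $ 1 * v $ 1 + u $ 2 * v $ 2 + Vrr w a (x $ 3) (x $ 4) * u $ 3 * v $ 3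
     + Vrz a (x $ 3) (x $ 4) * (u $ 3 * v $ 4 + u $ 4 * v $ 3) + Vzz a (x $ 3) (x $ 4) * u $ 4 * v $ 4"

lemma rho_pos [extraction_expand]: "0 < a \<Longrightarrow> 0 < r \<Longrightarrow> 0 < rho a r z"
  unfolding rho_def by (simp add: add_pos_nonneg)

lemma rho_sq [extraction_expand]: "0 < a \<Longrightarrow> rho a r z ^ 2 = r^2 + (1 + 2 * a) * z^2"
  unfolding rho_def by simp

lemma rho_ge [extraction_expand]: "0 < a \<Longrightarrow> 0 < r \<Longrightarrow> r \<le> rho a r z"
  unfolding rho_def by (simp add: real_le_rsqrt)

lemma Ham_eq [extraction_expand]: "Ham w a x = ((x $ 1)^2 + (x $ 2)^2) / 2 - hill w a (x $ 3) (x $ 4) - 1"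
  unfolding Ham_def hill_def rho_def by simp

lemma vec_nth_derivative [extraction_expand]: "((\<lambda>x. x $ i) has_derivative (\<lambda>h. h $ i)) (at (x :: real ^ 'n))"
  by (rule bounded_linear_imp_has_derivative[OF bounded_linear_vec_nth])

lemma rho_has_derivative [extraction_expand]:
  assumes "0 < a" "0 < x $ 3"
  shows "((\<lambda>x :: real ^ 4. rho a (x $ 3) (x $ 4)) has_derivative
    (\<lambda>h. (x $ 3 * h $ 3 + (1 + 2 * a) * x $ 4 * h $ 4) / rho a (x $ 3) (x $ 4))) (at x)"
proof -
  have p: "0 < (x $ 3)^2 + (1 + 2 * a) * (x $ 4)^2" using assms by (simp add: add_pos_nonneg)
  show ?thesis
    unfolding rho_def
    by (rule derivative_eq_intros vec_nth_derivative p refl)+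
      (use p in \<open>simp add: fun_eq_iff field_simps\<close>)
qed

lemma Ham_has_derivative [extraction_expand]:
  assumes a: "0 < a" and x: "x \<in> phase_space"
  shows "(Ham w a has_derivative dHam w a x) (at x)"
proof -
  have r: "0 < x $ 3" using x by (simp add: phase_space_def)
  note R = rho_pos[OF a r, of "x $ 4"]
  have H: "Ham w a = (\<lambda>x. ((x $ 1)^2 + (x $ 2)^2) / 2 + w^2 / (2 * (x $ 3)^2) - 1 / x $ 3
      - (4 / a) / rho a (x $ 3) (x $ 4))"
    unfolding Ham_def rho_def by (rule ext) simp
  have 1: "((\<lambda>x :: real ^ 4. ((x $ 1)^2 + (x $ 2)^2) / 2) has_derivative
      (\<lambda>h. x $ 1 * h $ 1 + x $ 2 * h $ 2)) (at x)"
    by (rule derivative_eq_intros vec_nth_derivative refl)+ (auto intro!: ext simp: field_simps)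
  have "((\<lambda>r. w^2 / (2 * r^2) - 1 / r) has_real_derivative (1 / (x $ 3)^2 - w^2 / (x $ 3)^3)) (at (x $ 3))"
    using r by (auto intro!: derivative_eq_intros simp: field_simps power2_eq_square power3_eq_cube)
  note 2 = DERIV_compose_FDERIV[OF this vec_nth_derivative]
  have "((\<lambda>q. (4 / a) / q) has_real_derivative (- (4 / a) / rho a (x $ 3) (x $ 4) ^ 2))
      (at (rho a (x $ 3) (x $ 4)))"
    using R a by (auto intro!: derivative_eq_intros simp: power2_eq_square)
  note 3 = DERIV_compose_FDERIV[OF this rho_has_derivative[OF a r]]
  have "((\<lambda>x. ((x $ 1)^2 + (x $ 2)^2) / 2 + (w^2 / (2 * (x $ 3)^2) - 1 / x $ 3)
      - (4 / a) / rho a (x $ 3) (x $ 4)) has_derivative dHam w a x) (at x)"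
    by (rule has_derivative_eq_rhs[OF has_derivative_diff[OF has_derivative_add[OF 1 2] 3]])
      (use R in \<open>simp add: fun_eq_iff dHam_def Vr_def Vz_def field_simps power2_eq_square power3_eq_cube\<close>, simp add: add_divide_distrib)
  then show ?thesis unfolding H by (simp add: add_diff_eq)
qed

lemma dHam_has_derivative [extraction_expand]:
  assumes a: "0 < a" and x: "x \<in> phase_space"
  shows "((\<lambda>y. dHam w a y v) has_derivative ddHam w a x v) (at x)"
proof -
  have r: "0 < x $ 3" using x by (simp add: phase_space_def)
  define g where "g = 1 + 2 * a"
  define R where "R = rho a (x $ 3) (x $ 4)"
  have R: "0 < R" using rho_pos[OF a r] by (simp add: R_def)
  have 1: "((\<lambda>y. y $ 1 * v $ 1 + y $ 2 * v $ 2) has_derivative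
      (\<lambda>h. h $ 1 * v $ 1 + h $ 2 * v $ 2)) (at x)"
    by (rule derivative_eq_intros vec_nth_derivative refl)+ simp
  have "((\<lambda>r. (1 / r^2 - w^2 / r^3) * v $ 3) has_real_derivative
      ((3 * w^2 / (x $ 3)^4 - 2 / (x $ 3)^3) * v $ 3)) (at (x $ 3))"
    using r by (auto intro!: derivative_eq_intros simp: field_simps eval_nat_numeral)
  note 2 = DERIV_compose_FDERIV[OF this vec_nth_derivative]
  have "((\<lambda>q. (4 / a) / q^3) has_real_derivative (- 3 * (4 / a) / R^4)) (at R)"
    using R a by (auto intro!: derivative_eq_intros simp: field_simps eval_nat_numeral)
  note 3 = DERIV_compose_FDERIV[OF this[unfolded R_def] rho_has_derivative[OF a r]]
  have 4: "((\<lambda>y. y $ 3 * v $ 3 + g * y $ 4 * v $ 4) has_derivative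
      (\<lambda>h. h $ 3 * v $ 3 + g * h $ 4 * v $ 4)) (at x)"
    by (rule derivative_eq_intros vec_nth_derivative refl)+ simp
  have "((\<lambda>y. (y $ 1 * v $ 1 + y $ 2 * v $ 2) + (1 / (y $ 3)^2 - w^2 / (y $ 3)^3) * v $ 3
      + (4 / a) / rho a (y $ 3) (y $ 4) ^ 3 * (y $ 3 * v $ 3 + g * y $ 4 * v $ 4))
      has_derivative ddHam w a x v) (at x)"
    by (rule has_derivative_eq_rhs[OF has_derivative_add[OF has_derivative_add[OF 1 2] has_derivative_mult[OF 3 4]]])
      (use R a in \<open>simp add: fun_eq_iff ddHam_def Vrr_def Vrz_def Vzz_def g_def[symmetric] R_def[symmetric]
          divide_simps\<close>, simp add: algebra_simps eval_nat_numeral)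
  moreover have "(\<lambda>y. (y $ 1 * v $ 1 + y $ 2 * v $ 2) + (1 / (y $ 3)^2 - w^2 / (y $ 3)^3) * v $ 3
      + (4 / a) / rho a (y $ 3) (y $ 4) ^ 3 * (y $ 3 * v $ 3 + g * y $ 4 * v $ 4)) = (\<lambda>y. dHam w a y v)"
    by (rule ext) (simp add: dHam_def Vr_def Vz_def g_def algebra_simps add_divide_distrib)
  ultimately show ?thesis by simp
qed

lemma open_phase_space [extraction_expand]: "open phase_space"
  unfolding phase_space_def by (intro open_Collect_less continuous_intros)

lemma level_tangent_Ham [extraction_expand]:
  assumes "0 < a" "x \<in> phase_space"
  shows "level_tangent (Ham w a) x = {v. dHam w a x v = 0}"
  using frechet_derivative_at[OF Ham_has_derivative[OF assms]] by (simp add: level_tangent_def)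

lemma hessian_Ham [extraction_expand]:
  assumes "0 < a" "x \<in> phase_space"
  shows "hessian (Ham w a) x u v = ddHam w a x u v"
proof -
  have "((\<lambda>y. frechet_derivative (Ham w a) (at y) u) has_derivative ddHam w a x u) (at x)"
    by (rule has_derivative_transform_within_open[OF dHam_has_derivative[OF assms] open_phase_space assms(2)])
      (use frechet_derivative_at[OF Ham_has_derivative[OF assms(1)]] in metis)
  then show ?thesis unfolding hessian_def using frechet_derivative_at by metis
qed

text \<open>The determinant of \<open>2 * hill * V'' + V' V'^T\<close> divided by
  \<open>2 * hill\<close>, in a form that makes sense on the Hill boundary. There it is
  \<open>V''\<close> evaluated on the vector \<open>(Vz, - Vr)\<close> tangent to the
  boundary.\<close>

definition curv :: "real \<Rightarrow> real \<Rightarrow> real \<Rightarrow> real \<Rightarrow> real" where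
  "curv w a r z = 2 * hill w a r z * (Vrr w a r z * Vzz a r z - (Vrz a r z)^2)
     + Vzz a r z * (Vr w a r z)^2 - 2 * Vrz a r z * Vr w a r z * Vz a r z + Vrr w a r z * (Vz a r z)^2"

lemma beta_par_bounds [extraction_expand]:
  assumes "0 < a"
  shows "0 < beta_par a" "beta_par a < 1" "beta_par a * (4 / a) = 1 - beta_par a"
  using assms by (auto simp: beta_par_def field_simps)

lemma hill_eq_room [extraction_expand]:
  assumes a: "0 < a" and r: "0 < r" and w: "0 < w"
  defines "b \<equiv> beta_par a"
  shows "2 * hill w a r z * (w^2 * b^2)
    = room b (r / rho a r z) (b * w^2 / r) - 2 * w^2 * b^2"
proof -
  define c where "c = 4 / a"
  have b: "b * c = 1 - b" using beta_par_bounds[OF a] by (simp add: b_def c_def)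
  have "room b (r / rho a r z) (b * w^2 / r)
      = b * w^2 / r * (2 * (b + b * c * (r / rho a r z)) - b * w^2 / r)"
    unfolding room_def hval_def b by simp
  also have "\<dots> = w^2 * b^2 * (2 / r + 2 * c / rho a r z - w^2 / r^2)"
    using r rho_pos[OF a r, of z] by (simp add: field_simps power2_eq_square)
  finally show ?thesis unfolding hill_def c_def[symmetric] by (simp add: field_simps)
qed

text \<open>Here \<open>z\<close> enters only through \<open>Vz^2\<close>, \<open>Vrz^2\<close> and
  \<open>Vrz * Vz\<close>, hence through \<open>g * z^2 = R^2 * (1 - C^2)\<close>. With
  \<open>r = R * C\<close> and \<open>w^2 = X * R * C / b\<close> all factors become explicit;
  \<open>A1\<close>, \<open>A2\<close>, \<open>n\<close> and \<open>B\<close> are rescaled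
  \<open>Vr\<close>, \<open>Vrr\<close>, \<open>Vzz\<close> and \<open>room / X\<close>.\<close>

lemma curv_eq_dform [extraction_expand]:
  assumes a: "0 < a" and r: "0 < r" and w: "0 < w"
  defines "b \<equiv> beta_par a"
  shows "curv w a r z * (4 * r^3 * rho a r z ^ 3 * w^2 * b^3)
    = (1 + 2 * a) * (4 / a) * dform b (r / rho a r z) (b * w^2 / r) (2 * w^2 * b^2)"
proof -
  define c where "c = 4 / a"
  define g where "g = 1 + 2 * a"
  define R where "R = rho a r z"
  have R: "0 < R" using rho_pos[OF a r] by (simp add: R_def)
  define C where "C = r / R"
  define X where "X = b * w^2 / r"
  define f where "f = 1 - b"
  have b: "0 < b" "b < 1" "c = f / b" using beta_par_bounds[OF a] by (auto simp: b_def c_def f_def field_simps)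
  have C: "0 < C" "r = R * C" using r R by (auto simp: C_def)
  have X: "0 < X" "w^2 = X * R * C / b" using b w r C R by (auto simp: X_def field_simps)
  have z: "g * z^2 = R^2 * (1 - C^2)"
  proof -
    have "R^2 * C^2 = r^2" using C(2) by (simp add: power_mult_distrib)
    then show ?thesis
      using rho_sq[OF a, of r z] unfolding R_def[symmetric] g_def by (simp add: algebra_simps)
  qed
  define n where "n = 3 * C^2 - 2"
  define A1 where "A1 = b - X + f * C^3"
  define A2 where "A2 = 3 * X - 2 * b + f * C^3 * (1 - 3 * C^2)"
  define B where "B = 2 * (b + f * C) - X"
  have "1 / r^2 - w^2 / r^3 + c * r / R^3 = A1 / (b * R^2 * C^2)"
    unfolding A1_def X(2) C(2) b(3) using R C(1) b(1) by (simp add: field_simps eval_nat_numeral)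
  then have vr: "Vr w a r z = A1 / (b * R^2 * C^2)"
    by (simp add: Vr_def c_def R_def)
  have "3 * w^2 / r^4 - 2 / r^3 + c * (1 / R^3 - 3 * r^2 / R^5) = A2 / (b * R^3 * C^3)"
    unfolding A2_def X(2) C(2) b(3) using R C(1) b(1) by (simp add: field_simps eval_nat_numeral)
  then have vrr: "Vrr w a r z = A2 / (b * R^3 * C^3)"
    by (simp add: Vrr_def c_def R_def)
  have "Vzz a r z = c * (g / R^3 - 3 * g * (g * z^2) / R^5)"
    unfolding Vzz_def c_def g_def R_def by (simp add: power2_eq_square mult.assoc)
  also have "\<dots> = f * g * n / (b * R^3)"
    unfolding z unfolding b(3) n_def using R b(1) by (simp add: field_simps eval_nat_numeral)
  finally have vzz: "Vzz a r z = f * g * n / (b * R^3)" .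
  have vz: "Vz a r z = c * g * z / R^3" and vrz: "Vrz a r z = - 3 * c * g * r * z / R^5"
    by (simp_all add: Vz_def Vrz_def c_def g_def R_def)
  have "(Vz a r z)^2 = c^2 * g * (g * z^2) / R^6"
    unfolding vz by (simp add: power_mult_distrib power_divide eval_nat_numeral ac_simps)
  also have "\<dots> = f^2 * g * (1 - C^2) / (b^2 * R^4)"
    unfolding z unfolding b(3) using R b(1) by (simp add: field_simps eval_nat_numeral)
  finally have vz2: "(Vz a r z)^2 = f^2 * g * (1 - C^2) / (b^2 * R^4)" .
  have "(Vrz a r z)^2 = 9 * c^2 * g * r^2 * (g * z^2) / R^10"
    unfolding vrz by (simp add: power_mult_distrib power_divide eval_nat_numeral ac_simps)
  also have "\<dots> = 9 * f^2 * g * C^2 * (1 - C^2) / (b^2 * R^6)"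
    unfolding z unfolding C(2) b(3) using R b(1) by (simp add: field_simps eval_nat_numeral)
  finally have vrz2: "(Vrz a r z)^2 = 9 * f^2 * g * C^2 * (1 - C^2) / (b^2 * R^6)" .
  have "Vrz a r z * Vz a r z = - 3 * c^2 * g * r * (g * z^2) / R^8"
    unfolding vz vrz by (simp add: eval_nat_numeral ac_simps)
  also have "\<dots> = - 3 * f^2 * g * C * (1 - C^2) / (b^2 * R^5)"
    unfolding z unfolding C(2) b(3) using R b(1) by (simp add: field_simps eval_nat_numeral)
  finally have vrzz: "Vrz a r z * Vz a r z = - 3 * f^2 * g * C * (1 - C^2) / (b^2 * R^5)" .
  have "2 * (1 / r + c / R - 1 - w^2 / (2 * r^2)) = (B - 2 * b * R * C) / (b * R * C)"
    unfolding B_def X(2) C(2) b(3) using R C(1) b(1) by (simp add: field_simps power2_eq_square)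
  then have W: "2 * hill w a r z = (B - 2 * b * R * C) / (b * R * C)"
    by (simp add: hill_def c_def R_def)
  have "curv w a r z = 2 * hill w a r z * (Vrr w a r z * Vzz a r z - (Vrz a r z)^2)
     + Vzz a r z * (Vr w a r z)^2 - 2 * (Vrz a r z * Vz a r z) * Vr w a r z + Vrr w a r z * (Vz a r z)^2"
    by (simp add: curv_def)
  also have "\<dots> = (B - 2 * b * R * C) / (b * R * C) * (A2 * (f * g * n) / (b^2 * R^6 * C^3)
        - 9 * f^2 * g * C^2 * (1 - C^2) / (b^2 * R^6))
      + f * g * n * A1^2 / (b^3 * R^7 * C^4) + 6 * f^2 * g * C * (1 - C^2) * A1 / (b^3 * R^7 * C^2)
      + A2 * (f^2 * g * (1 - C^2)) / (b^3 * R^7 * C^3)"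
    unfolding W vr vrr vzz vz2 vrz2 vrzz using R C(1) b(1)
    by (simp add: power_divide power_mult_distrib eval_nat_numeral mult.commute mult.left_commute)
  also have "\<dots> = g * f / (b^3 * R^7 * C^4) * ((B - 2 * b * R * C) * (A2 * n - 9 * f * C^5 * (1 - C^2))
      + n * A1^2 + 6 * f * C^3 * (1 - C^2) * A1 + A2 * f * C * (1 - C^2))"
    using R C(1) b(1) by (simp add: divide_simps) (simp add: algebra_simps eval_nat_numeral)
  \<comment> \<open>The left side is a positive multiple of \<open>Vrr * Vzz - Vrz^2\<close>, which
    identifies \<open>kap\<close> with minus the determinant of \<open>V''\<close>.\<close>
  also have "A2 * n - 9 * f * C^5 * (1 - C^2) = - kap b C X"
    unfolding A2_def n_def kap_def f_def by algebra
  also have "(B - 2 * b * R * C) * - kap b C X + n * A1^2 + 6 * f * C^3 * (1 - C^2) * A1 + A2 * f * C * (1 - C^2)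
      = (kap b C X * (8 * R * C * b - 3 * B) + n * X^2) / 4"
    unfolding B_def A1_def A2_def n_def kap_def f_def by algebra
  finally have D: "curv w a r z = g * f / (b^3 * R^7 * C^4) * ((kap b C X * (8 * R * C * b - 3 * B) + n * X^2) / 4)" .
  have "dform b C X (2 * w^2 * b^2) = X * (kap b C X * (8 * R * C * b - 3 * B) + n * X^2)"
    unfolding dform_def room_def hval_def n_def B_def X(2) f_def
    using b(1) by (simp add: field_simps power2_eq_square power3_eq_cube)
  moreover have "g * f / (b^3 * R^7 * C^4) * (Y / 4) * (4 * r^3 * R^3 * w^2 * b^3) = g * c * (X * Y)" for Y
    unfolding X(2) C(2) b(3) using R C(1) b(1) X(1) by (simp add: field_simps eval_nat_numeral)
  ultimately have "curv w a r z * (4 * r^3 * R^3 * w^2 * b^3) = g * c * dform b C X (2 * w^2 * b^2)"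
    unfolding D by simp
  then show ?thesis by (simp add: C_def X_def R_def c_def g_def)
qed

text \<open>The sign of \<open>kap\<close> is not known at a given configuration, so a failure is
  bounded by \<open>bad_point_le_Scrit\<close> instead of the definition of
  \<open>Scrit\<close>.\<close>

lemma curv_pos [extraction_expand]:
  assumes a: "0 < a" and w: "0 < w" and r: "0 < r" and h: "0 \<le> hill w a r z"
    and S: "Scrit (beta_par a) < 2 * w^2 * (beta_par a)^2" "2 * w^2 * (beta_par a)^2 < 1"
  shows "0 < curv w a r z"
proof -
  define b where "b = beta_par a"
  have b: "0 < b" "b < 1" using beta_par_bounds[OF a] by (auto simp: b_def)
  have R: "0 < rho a r z" "r \<le> rho a r z" using rho_pos rho_ge a r by auto
  define C where "C = r / rho a r z"
  define X where "X = b * w^2 / r"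
  have C: "0 < C" "C \<le> 1" using R r by (auto simp: C_def)
  have X: "0 < X" using b w r by (simp add: X_def)
  have "0 \<le> 2 * hill w a r z * (w^2 * b^2)" using h by simp
  then have room: "2 * w^2 * b^2 \<le> room b C X"
    using hill_eq_room[OF a r w, of z] by (simp add: b_def C_def X_def)
  have "0 < dform b C X (2 * w^2 * b^2)"
  proof (rule ccontr)
    assume "\<not> 0 < dform b C X (2 * w^2 * b^2)"
    then have "2 * w^2 * b^2 \<le> Scrit b"
      using bad_point_le_Scrit[OF b C X] room S by (simp add: b_def)
    then show False using S by (simp add: b_def)
  qed
  then have "0 < (1 + 2 * a) * (4 / a) * dform b C X (2 * w^2 * b^2)" using a by simp
  also have "\<dots> = curv w a r z * (4 * r^3 * rho a r z ^ 3 * w^2 * b^3)"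
    using curv_eq_dform[OF a r w, of z] by (simp add: b_def C_def X_def)
  finally show ?thesis by (rule zero_less_mult_pos2) (use r R w b in simp)
qed

lemma rho_mono [extraction_expand]:
  assumes "0 < a" "z^2 \<le> z'^2"
  shows "rho a r z \<le> rho a r z'"
  unfolding rho_def using assms by (simp add: mult_left_mono)

lemma hill_antimono [extraction_expand]:
  assumes "0 < a" "0 < r" "z^2 \<le> z'^2"
  shows "hill w a r z' \<le> hill w a r z"
proof -
  have "(4 / a) / rho a r z' \<le> (4 / a) / rho a r z"
    using rho_mono[OF assms(1,3), of r] rho_pos[OF assms(1,2), of z] assms(1) by (intro divide_left_mono) auto
  then show ?thesis by (simp add: hill_def)
qed

text \<open>The lower diagonal entry of \<open>2 * hill * V'' + V' V'^T\<close> cannot vanish where the determinant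
  is positive, and it is positive on the axis \<open>z = 0\<close>.\<close>

lemma axial_entry_pos [extraction_expand]:
  assumes a: "0 < a" and r: "0 < r" and h: "0 < hill w a r z"
    and cp: "\<And>z. 0 \<le> hill w a r z \<Longrightarrow> 0 < curv w a r z"
  shows "0 < 2 * hill w a r z * Vzz a r z + (Vz a r z)^2"
proof (rule ccontr)
  assume not: "\<not> ?thesis"
  define M where "M t = 2 * hill w a r (t * z) * Vzz a r (t * z) + (Vz a r (t * z))^2" for t
  have hpos: "0 < hill w a r (t * z)" if "0 \<le> t" "t \<le> 1" for t
  proof -
    have "t^2 \<le> 1" using that by (simp add: power_le_one)
    then have "(t * z)^2 \<le> 1 * z^2" unfolding power_mult_distrib by (intro mult_right_mono) auto
    then show ?thesis using hill_antimono[OF a r, of "t * z" z w] h by simp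
  qed
  have R: "rho a r (t * z) \<noteq> 0" for t using rho_pos[OF a r, of "t * z"] by simp
  have "continuous_on {0..1} (\<lambda>t. rho a r (t * z))"
    unfolding rho_def by (intro continuous_intros)
  then have "continuous_on {0..1} M"
    unfolding M_def hill_def Vzz_def Vz_def using r R by (intro continuous_intros) auto
  moreover have "M 1 \<le> 0" using not by (simp add: M_def)
  moreover have "0 \<le> M 0"
  proof -
    have "Vz a r 0 = 0" by (simp add: Vz_def)
    moreover have "0 < Vzz a r 0" using a rho_pos[OF a r, of 0] by (simp add: Vzz_def)
    ultimately show ?thesis using hpos[of 0] by (simp add: M_def)
  qed
  ultimately obtain t where t: "0 \<le> t" "t \<le> 1" "M t = 0"
    using IVT2'[of M 1 0 0] by auto
  define y where "y = t * z"
  have "2 * hill w a r y * curv w a r y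
      = (2 * hill w a r y * Vrr w a r y + (Vr w a r y)^2) * M t
        - (2 * hill w a r y * Vrz a r y + Vr w a r y * Vz a r y)^2"
    unfolding curv_def M_def y_def[symmetric] by algebra
  also have "\<dots> \<le> 0" using t by simp
  finally have "2 * hill w a r y * curv w a r y \<le> 0" .
  moreover have "0 < hill w a r y" using hpos t by (simp add: y_def)
  moreover then have "0 < curv w a r y" using cp by simp
  ultimately show False by (simp add: mult_le_0_iff)
qed

lemma quadratic_form_pos [extraction_expand]:
  fixes \<alpha> \<beta> \<gamma> p q :: real
  assumes "0 < \<gamma>" "0 < \<alpha> * \<gamma> - \<beta>^2" "p \<noteq> 0 \<or> q \<noteq> 0"
  shows "0 < \<alpha> * p^2 + 2 * \<beta> * p * q + \<gamma> * q^2"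
proof -
  have "\<gamma> * (\<alpha> * p^2 + 2 * \<beta> * p * q + \<gamma> * q^2) = (\<alpha> * \<gamma> - \<beta>^2) * p^2 + (\<gamma> * q + \<beta> * p)^2"
    by (simp add: algebra_simps power2_eq_square)
  moreover have "0 < (\<alpha> * \<gamma> - \<beta>^2) * p^2 + (\<gamma> * q + \<beta> * p)^2"
  proof (cases "p = 0")
    case True
    then show ?thesis using assms by simp
  next
    case False
    then show ?thesis using assms by (intro add_pos_nonneg) auto
  qed
  ultimately have "0 < \<gamma> * (\<alpha> * p^2 + 2 * \<beta> * p * q + \<gamma> * q^2)" by (simp only:)
  then show ?thesis by (rule zero_less_mult_pos) (rule assms(1))
qed

lemma quadratic_form_nonpos [extraction_expand]:
  fixes \<alpha> \<beta> \<gamma> :: real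
  assumes "\<alpha> * \<gamma> - \<beta>^2 \<le> 0"
  obtains p q where "p \<noteq> 0 \<or> q \<noteq> 0" "\<alpha> * p^2 + 2 * \<beta> * p * q + \<gamma> * q^2 \<le> 0"
    "\<alpha> * \<gamma> - \<beta>^2 < 0 \<Longrightarrow> \<alpha> * p^2 + 2 * \<beta> * p * q + \<gamma> * q^2 < 0"
proof -
  consider "0 < \<gamma>" | "\<gamma> < 0" | "\<gamma> = 0" "\<beta> = 0" | "\<gamma> = 0" "\<beta> \<noteq> 0" by linarith
  then show ?thesis
  proof cases
    case 1
    have "\<alpha> * \<gamma>^2 + 2 * \<beta> * \<gamma> * (- \<beta>) + \<gamma> * (- \<beta>)^2 = \<gamma> * (\<alpha> * \<gamma> - \<beta>^2)"
      by (simp add: algebra_simps power2_eq_square)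
    then show ?thesis using 1 assms by (intro that[of \<gamma> "- \<beta>"]) (auto simp: mult_le_0_iff mult_less_0_iff)
  next
    case 2
    then show ?thesis by (intro that[of 0 1]) auto
  next
    case 3
    then show ?thesis by (intro that[of 0 1]) auto
  next
    case 4
    \<comment> \<open>Small enough that the linear term \<open>2 * \<beta> * p\<close>, equal to
      \<open>- 2 * \<beta>^2 / (1 + \<bar>\<alpha>\<bar>)\<close>, outweighs
      \<open>\<alpha> * p^2\<close>.\<close>
    define p where "p = - \<beta> / (1 + \<bar>\<alpha>\<bar>)"
    have "\<alpha> * p^2 + 2 * \<beta> * p * 1 + \<gamma> * 1^2 = - (\<beta>^2 / (1 + \<bar>\<alpha>\<bar>)) * (2 - \<alpha> / (1 + \<bar>\<alpha>\<bar>))"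
      using 4 by (simp add: p_def divide_simps) (simp add: algebra_simps power2_eq_square)
    moreover have "\<alpha> / (1 + \<bar>\<alpha>\<bar>) < 2"
    proof -
      have "x / (1 + t) < 2" if "x \<le> t" "0 \<le> t" for x t :: real
        using that by (simp add: divide_less_eq)
      then show ?thesis using abs_ge_self abs_ge_zero by blast
    qed
    moreover have "0 < \<beta>^2 / (1 + \<bar>\<alpha>\<bar>)" using 4 by simp
    then have "- (\<beta>^2 / (1 + \<bar>\<alpha>\<bar>)) * (2 - \<alpha> / (1 + \<bar>\<alpha>\<bar>)) < 0"
      using \<open>\<alpha> / (1 + \<bar>\<alpha>\<bar>) < 2\<close> by (intro mult_neg_pos) simp_all
    ultimately have "\<alpha> * p^2 + 2 * \<beta> * p * 1 + \<gamma> * 1^2 < 0" by (simp only:)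
    then show ?thesis by (intro that[of p 1]) auto
  qed
qed

lemma vec4_eq_0 [extraction_expand]: "v = 0 \<longleftrightarrow> v $ 1 = 0 \<and> v $ 2 = 0 \<and> v $ 3 = 0 \<and> v $ 4 = 0" for v :: "real ^ 4"
  by (simp add: vec_eq_iff forall_4)

text \<open>Eliminating the momentum part of a tangent vector leaves the quadratic form
  \<open>2 * hill * V'' + V' V'^T\<close>, whose determinant is \<open>2 * hill * curv\<close>.\<close>

lemma ddHam_pos [extraction_expand]:
  assumes a: "0 < a" and w: "0 < w" and x: "x \<in> phase_space" "Ham w a x = -1"
    and v: "v \<noteq> 0" "dHam w a x v = 0"
    and S: "Scrit (beta_par a) < 2 * w^2 * (beta_par a)^2" "2 * w^2 * (beta_par a)^2 < 1"
  shows "0 < ddHam w a x v v"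
proof -
  define r z where "r = x $ 3" and "z = x $ 4"
  have r: "0 < r" using x by (simp add: phase_space_def r_def)
  define W where "W = hill w a r z"
  have W: "(x $ 1)^2 + (x $ 2)^2 = 2 * W"
    using x(2) unfolding Ham_eq W_def r_def z_def by simp
  then have W0: "0 \<le> W" by (metis sum_power2_ge_zero zero_le_mult_iff zero_less_numeral not_numeral_le_zero)
  have cp: "0 < curv w a r z'" if "0 \<le> hill w a r z'" for z'
    using curv_pos[OF a w r that S] .
  define p q where "p = v $ 3" and "q = v $ 4"
  define s where "s = Vr w a r z * p + Vz a r z * q"
  define Q where "Q = Vrr w a r z * p^2 + 2 * Vrz a r z * p * q + Vzz a r z * q^2"
  have s: "x $ 1 * v $ 1 + x $ 2 * v $ 2 = - s"
    using v(2) by (simp add: dHam_def s_def r_def z_def p_def q_def)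
  have dd: "ddHam w a x v v = (v $ 1)^2 + (v $ 2)^2 + Q"
    by (simp add: ddHam_def Q_def r_def z_def p_def q_def power2_eq_square algebra_simps)
  show ?thesis
  proof (cases "p = 0 \<and> q = 0")
    case True
    then have "v $ 1 \<noteq> 0 \<or> v $ 2 \<noteq> 0" using v(1) vec4_eq_0[of v] by (auto simp: p_def q_def)
    then have "0 < (v $ 1)^2 + (v $ 2)^2" by (simp add: sum_power2_gt_zero_iff)
    then show ?thesis using True by (simp add: dd Q_def)
  next
    case pq: False
    show ?thesis
    proof (cases "W = 0")
      case True
      \<comment> \<open>At zero velocity the tangency condition makes \<open>(p, q)\<close>
        orthogonal to the gradient of the potential, so the Hessian is tested only along the Hill
        boundary.\<close>
      then have "x $ 1 = 0" "x $ 2 = 0" using W by (simp_all add: sum_power2_eq_zero_iff)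
      then have s0: "Vr w a r z * p + Vz a r z * q = 0" using s by (simp add: s_def)
      define \<kappa> where "\<kappa> = Vzz a r z * (Vr w a r z)^2 - 2 * Vrz a r z * Vr w a r z * Vz a r z
        + Vrr w a r z * (Vz a r z)^2"
      have \<kappa>: "0 < \<kappa>" using cp[of z] True by (simp add: curv_def \<kappa>_def W_def)
      have "Q * ((Vr w a r z)^2 + (Vz a r z)^2) = (p^2 + q^2) * \<kappa>"
        using s0 unfolding Q_def \<kappa>_def by algebra
      moreover have "0 < (p^2 + q^2) * \<kappa>" using \<kappa> pq by (auto intro!: mult_pos_pos simp: sum_power2_gt_zero_iff)
      ultimately have "0 < Q" by (metis sum_power2_ge_zero not_sum_power2_lt_zero zero_less_mult_iff)
      then show ?thesis unfolding dd by (simp add: add_nonneg_pos)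
    next
      case False
      then have Wp: "0 < W" using W0 by simp
      define \<alpha> where "\<alpha> = 2 * W * Vrr w a r z + (Vr w a r z)^2"
      define \<beta> where "\<beta> = 2 * W * Vrz a r z + Vr w a r z * Vz a r z"
      define \<gamma> where "\<gamma> = 2 * W * Vzz a r z + (Vz a r z)^2"
      have "\<alpha> * \<gamma> - \<beta>^2 = 2 * W * curv w a r z"
        unfolding \<alpha>_def \<beta>_def \<gamma>_def curv_def W_def by algebra
      moreover have "0 < curv w a r z" using cp Wp by (simp add: W_def)
      ultimately have det: "0 < \<alpha> * \<gamma> - \<beta>^2" using Wp by simp
      have "0 < \<gamma>" using axial_entry_pos[OF a r _ cp] Wp unfolding \<gamma>_def W_def by blast
      then have "0 < \<alpha> * p^2 + 2 * \<beta> * p * q + \<gamma> * q^2"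
        using det pq by (intro quadratic_form_pos) auto
      also have "\<dots> = s^2 + 2 * W * Q"
        unfolding \<alpha>_def \<beta>_def \<gamma>_def s_def Q_def by algebra
      also have "s^2 \<le> 2 * W * ((v $ 1)^2 + (v $ 2)^2)"
      proof -
        \<comment> \<open>Cauchy-Schwarz for the momentum parts of \<open>x\<close> and
          \<open>v\<close>, by Lagrange's identity.\<close>
        have "s^2 = (x $ 1 * v $ 1 + x $ 2 * v $ 2)^2" using s by simp
        also have "\<dots> = ((x $ 1)^2 + (x $ 2)^2) * ((v $ 1)^2 + (v $ 2)^2) - (x $ 1 * v $ 2 - x $ 2 * v $ 1)^2"
          by algebra
        also have "\<dots> \<le> ((x $ 1)^2 + (x $ 2)^2) * ((v $ 1)^2 + (v $ 2)^2)" by simp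
        finally show ?thesis unfolding W .
      qed
      finally have "0 < 2 * W * ddHam w a x v v" unfolding dd by (simp add: algebra_simps)
      then show ?thesis using Wp by (simp add: zero_less_mult_iff)
    qed
  qed
qed

definition mk4 :: "real \<Rightarrow> real \<Rightarrow> real \<Rightarrow> real \<Rightarrow> real ^ 4" where
  "mk4 p q r z = (\<chi> i. if i = 1 then p else if i = 2 then q else if i = 3 then r else z)"

lemma mk4_nth [simp, extraction_expand]: "mk4 p q r z $ 1 = p" "mk4 p q r z $ 2 = q" "mk4 p q r z $ 3 = r" "mk4 p q r z $ 4 = z"
  by (simp_all add: mk4_def)

lemma vec4_eq_iff [extraction_expand]: "x = y \<longleftrightarrow> x $ 1 = y $ 1 \<and> x $ 2 = y $ 2 \<and> x $ 3 = y $ 3 \<and> x $ 4 = y $ 4"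
  for x y :: "real ^ 4"
  by (simp add: vec_eq_iff forall_4)

text \<open>The converse of \<open>ddHam_pos\<close>: a maximizer of the reduced problem is realized
  by a point of the surface, and the momentum part of \<open>v\<close> is chosen so that the
  reduction to the quadratic form in \<open>(p, q)\<close> is an equality.\<close>

lemma degenerate_direction [extraction_expand]:
  assumes a: "0 < a" and w: "0 < w" and S: "2 * w^2 * (beta_par a)^2 \<le> Scrit (beta_par a)"
  obtains x v where "x \<in> phase_space" "Ham w a x = -1" "v \<noteq> 0" "dHam w a x v = 0" "ddHam w a x v v \<le> 0"
    "2 * w^2 * (beta_par a)^2 < Scrit (beta_par a) \<Longrightarrow> ddHam w a x v v < 0"
proof -
  define b where "b = beta_par a"
  define S where "S = 2 * w^2 * b^2"
  have b: "0 < b" "b < 1" using beta_par_bounds[OF a] by (auto simp: b_def)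
  have SS: "S \<le> Scrit b" using S by (simp add: S_def b_def)
  obtain C X where dg: "degen b C X (Scrit b)" using Scrit_attained[of b] b by auto
  note pt = Scrit_point_interior[OF less_imp_le[OF b(1)] b(2) dg]
  \<comment> \<open>\<open>r\<close> is recovered from \<open>X\<close>, and below \<open>z\<close>
    from \<open>C\<close>. The Hill function is positive there because
    \<open>S \<le> Scrit b < room b C X\<close>.\<close>
  define r where "r = b * w^2 / X"
  have r: "0 < r" using b w pt by (simp add: r_def)
  define z where "z = sqrt (((r / C)^2 - r^2) / (1 + 2 * a))"
  have "r^2 \<le> (r / C)^2" using r pt by (intro power_mono) (auto simp: pos_le_divide_eq)
  then have "(1 + 2 * a) * z^2 = (r / C)^2 - r^2" using a by (simp add: z_def)
  then have R: "rho a r z = r / C" using r pt by (simp add: rho_def)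
  have CX: "r / rho a r z = C" "b * w^2 / r = X" using r pt R b w by (simp_all add: r_def)
  define W where "W = hill w a r z"
  have "2 * W * (w^2 * b^2) = room b C X - S"
    using hill_eq_room[OF a r w, of z] unfolding b_def[symmetric] CX S_def W_def .
  then have "0 < 2 * W * (w^2 * b^2)" using pt SS by simp
  then have "0 < 2 * W" by (rule zero_less_mult_pos2) (use w b in simp)
  then have W: "0 < W" by simp
  have df: "dform b C X S = 4 * kap b C X * (S - Scrit b)"
    using dform_shift[of b C X S "Scrit b"] pt by simp
  have ce: "curv w a r z * (4 * r^3 * rho a r z ^ 3 * w^2 * b^3)
      = (1 + 2 * a) * (4 / a) * (4 * kap b C X * (S - Scrit b))"
    using curv_eq_dform[OF a r w, of z] unfolding b_def[symmetric] CX S_def[symmetric] df .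
  have pos: "0 < 4 * r^3 * rho a r z ^ 3 * w^2 * b^3" using r rho_pos[OF a r] w b by simp
  have c0: "curv w a r z \<le> 0"
  proof -
    have "curv w a r z * (4 * r^3 * rho a r z ^ 3 * w^2 * b^3) \<le> 0"
      unfolding ce using a pt SS by (intro mult_nonneg_nonpos) auto
    then show ?thesis using pos by (meson mult_pos_pos not_le)
  qed
  have c1: "curv w a r z < 0" if "S < Scrit b"
  proof -
    have "curv w a r z * (4 * r^3 * rho a r z ^ 3 * w^2 * b^3) < 0"
      unfolding ce using a pt that by (intro mult_pos_neg) auto
    then show ?thesis using pos by (meson less_imp_le mult_nonneg_nonneg not_le)
  qed
  define \<alpha> where "\<alpha> = 2 * W * Vrr w a r z + (Vr w a r z)^2"
  define \<beta> where "\<beta> = 2 * W * Vrz a r z + Vr w a r z * Vz a r z"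
  define \<gamma> where "\<gamma> = 2 * W * Vzz a r z + (Vz a r z)^2"
  have det: "\<alpha> * \<gamma> - \<beta>^2 = 2 * W * curv w a r z"
    unfolding \<alpha>_def \<beta>_def \<gamma>_def curv_def W_def by algebra
  then have "\<alpha> * \<gamma> - \<beta>^2 \<le> 0" using W c0 by (simp add: mult_nonneg_nonpos)
  then obtain p q where pq: "p \<noteq> 0 \<or> q \<noteq> 0" "\<alpha> * p^2 + 2 * \<beta> * p * q + \<gamma> * q^2 \<le> 0"
    "\<alpha> * \<gamma> - \<beta>^2 < 0 \<Longrightarrow> \<alpha> * p^2 + 2 * \<beta> * p * q + \<gamma> * q^2 < 0"
    by (rule quadratic_form_nonpos) blast
  define s where "s = Vr w a r z * p + Vz a r z * q"
  define u where "u = sqrt (2 * W)"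
  have u: "0 < u" "u^2 = 2 * W" using W by (auto simp: u_def)
  define x where "x = mk4 u 0 r z"
  \<comment> \<open>Tangency fixes the component along the momentum; taking no component across it
    gives equality in Cauchy-Schwarz.\<close>
  define v where "v = mk4 (- s / u) 0 p q"
  have "x \<in> phase_space" using r by (simp add: phase_space_def x_def)
  moreover have "Ham w a x = -1" by (simp add: Ham_eq x_def u(2) W_def)
  moreover have "v \<noteq> 0" using pq(1) vec4_eq_0[of v] by (auto simp: v_def)
  moreover have "dHam w a x v = 0" using u by (simp add: dHam_def x_def v_def s_def)
  moreover have dd: "2 * W * ddHam w a x v v = \<alpha> * p^2 + 2 * \<beta> * p * q + \<gamma> * q^2"
  proof -
    have "ddHam w a x v v = s^2 / (2 * W) + (Vrr w a r z * p^2 + 2 * Vrz a r z * p * q + Vzz a r z * q^2)"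
      unfolding u(2)[symmetric]
      by (simp add: ddHam_def x_def v_def power2_eq_square algebra_simps)
    then have "2 * W * ddHam w a x v v
        = s^2 + 2 * W * (Vrr w a r z * p^2 + 2 * Vrz a r z * p * q + Vzz a r z * q^2)"
      using W by (simp add: field_simps)
    then show ?thesis unfolding \<alpha>_def \<beta>_def \<gamma>_def s_def by algebra
  qed
  have "ddHam w a x v v \<le> 0"
  proof -
    have "2 * W * ddHam w a x v v \<le> 0" using dd pq(2) by simp
    then show ?thesis using W by (simp add: mult_le_0_iff)
  qed
  moreover have "ddHam w a x v v < 0" if "S < Scrit b"
  proof -
    have "\<alpha> * \<gamma> - \<beta>^2 < 0" unfolding det using W c1[OF that] by (simp add: mult_pos_neg)
    then have "2 * W * ddHam w a x v v < 0" using dd pq(3) by simp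
    then show ?thesis using W by (simp add: mult_less_0_iff)
  qed
  ultimately show ?thesis using that by (simp add: S_def b_def)
qed

section \<open>The sublevel set\<close>

definition interior_sublevel :: "real \<Rightarrow> real \<Rightarrow> (real ^ 4) set" where
  "interior_sublevel w a = {x \<in> phase_space. Ham w a x < -1}"

lemma continuous_on_Ham [extraction_expand]: "0 < a \<Longrightarrow> continuous_on phase_space (Ham w a)"
  by (intro continuous_at_imp_continuous_on ballI has_derivative_continuous[OF Ham_has_derivative])

lemma open_interior_sublevel [extraction_expand]:
  assumes "0 < a"
  shows "open (interior_sublevel w a)"
proof -
  have "interior_sublevel w a = phase_space \<inter> Ham w a -` {..< -1}"
    by (auto simp: interior_sublevel_def)
  then show ?thesis
    using continuous_open_preimage[OF continuous_on_Ham[OF assms] open_phase_space, of "{..< -1}"] by simp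
qed

text \<open>The centrifugal term \<open>w^2 / (2 * r^2)\<close> must not exceed the attraction,
  which is at most \<open>(1 + 4 / a) / r\<close>. This barrier is what makes the sublevel set
  closed in the whole space.\<close>

lemma energy_sublevel_away [extraction_expand]:
  assumes a: "0 < a" and w: "0 < w" and x: "x \<in> energy_sublevel w a"
  shows "w^2 / (2 * (1 + 4 / a)) \<le> x $ 3"
proof -
  define r where "r = x $ 3"
  have r: "0 < r" using x by (simp add: energy_sublevel_def phase_space_def r_def)
  have "0 \<le> hill w a r (x $ 4)"
  proof -
    have "((x $ 1)^2 + (x $ 2)^2) / 2 - hill w a r (x $ 4) - 1 \<le> -1"
      using x by (simp add: energy_sublevel_def Ham_eq r_def)
    moreover have "0 \<le> W" if "P / 2 - W - 1 \<le> -1" "0 \<le> P" for P W :: real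
      using that by simp
    ultimately show ?thesis using sum_power2_ge_zero by blast
  qed
  then have "w^2 / (2 * r^2) \<le> 1 / r + (4 / a) / rho a r (x $ 4)" by (simp add: hill_def)
  also have "(4 / a) / rho a r (x $ 4) \<le> (4 / a) / r"
    using rho_ge[OF a r] rho_pos[OF a r] r a by (intro divide_left_mono mult_pos_pos) auto
  finally have "w^2 / (2 * r^2) \<le> (1 + 4 / a) / r" by (simp add: add_divide_distrib)
  then have "w^2 / (2 * r^2) * (2 * r^2) \<le> (1 + 4 / a) / r * (2 * r^2)"
    using r by (intro mult_right_mono) auto
  moreover have "w^2 / (2 * r^2) * (2 * r^2) = w^2" "k / r * (2 * r^2) = r * (2 * k)" for k
    using r by (simp_all add: power2_eq_square)
  ultimately have "w^2 \<le> r * (2 * (1 + 4 / a))" by (simp only:)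
  then show ?thesis using a by (subst pos_divide_le_eq) (auto simp: r_def add_pos_pos)
qed

lemma closed_energy_sublevel [extraction_expand]:
  assumes a: "0 < a" and w: "0 < w"
  shows "closed (energy_sublevel w a)"
proof -
  define r0 where "r0 = w^2 / (2 * (1 + 4 / a))"
  have r0: "0 < r0" using a w by (simp add: r0_def add_pos_pos)
  let ?T = "{x :: real ^ 4. r0 \<le> x $ 3}"
  have T: "closed ?T" by (intro closed_Collect_le continuous_intros)
  have sub: "?T \<subseteq> phase_space" using r0 by (auto simp: phase_space_def)
  have "energy_sublevel w a = ?T \<inter> Ham w a -` {..-1}"
    using energy_sublevel_away[OF a w] sub by (auto simp: energy_sublevel_def r0_def)
  then show ?thesis
    using continuous_closed_preimage[OF continuous_on_subset[OF continuous_on_Ham[OF a] sub] T, of "{..-1}"]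
    by simp
qed

text \<open>Pushing the first momentum component away from zero raises the kinetic energy, so points
  outside the sublevel set lie arbitrarily near.\<close>

lemma energy_surface_not_interior [extraction_expand]:
  assumes x: "x \<in> energy_surface w a"
  shows "x \<notin> interior (energy_sublevel w a)"
proof
  assume "x \<in> interior (energy_sublevel w a)"
  then obtain e where e: "0 < e" "ball x e \<subseteq> energy_sublevel w a" by (meson mem_interior)
  define h where "h = (if 0 \<le> x $ 1 then e / 2 else - e / 2)"
  define y where "y = x + axis 1 h"
  have y: "y $ 1 = x $ 1 + h" "y $ 2 = x $ 2" "y $ 3 = x $ 3" "y $ 4 = x $ 4"
    by (simp_all add: y_def axis_def)
  have "dist x y = \<bar>h\<bar>" by (simp add: y_def dist_norm norm_eq_sqrt_inner inner_axis_axis)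
  then have "y \<in> ball x e" using e(1) by (simp add: h_def)
  then have "Ham w a y \<le> -1" using e(2) by (auto simp: energy_sublevel_def)
  moreover have "(y $ 1)^2 = (x $ 1)^2 + (2 * (x $ 1 * h) + h^2)"
    by (simp add: y power2_eq_square algebra_simps)
  then have "Ham w a y = Ham w a x + (2 * (x $ 1 * h) + h^2) / 2"
    unfolding Ham_eq y(2-4) by (simp add: add_divide_distrib)
  moreover have "0 \<le> x $ 1 * h" using e(1) by (auto simp: h_def mult_nonpos_nonneg zero_le_mult_iff)
  moreover have "0 < h^2" using e(1) by (simp add: h_def)
  moreover have "Ham w a x = -1" using x by (simp add: energy_surface_def)
  ultimately show False by (simp add: add_divide_distrib)
qed

lemma frontier_energy_sublevel [extraction_expand]:
  assumes a: "0 < a" and w: "0 < w"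
  shows "frontier (energy_sublevel w a) = energy_surface w a"
proof -
  have "interior_sublevel w a \<subseteq> interior (energy_sublevel w a)"
    using open_interior_sublevel[OF a]
    by (intro interior_maximal) (auto simp: interior_sublevel_def energy_sublevel_def)
  moreover have "energy_sublevel w a = interior_sublevel w a \<union> energy_surface w a"
    by (auto simp: interior_sublevel_def energy_sublevel_def energy_surface_def)
  moreover have "energy_surface w a \<inter> interior (energy_sublevel w a) = {}"
    using energy_surface_not_interior by blast
  moreover have "frontier (energy_sublevel w a) = energy_sublevel w a - interior (energy_sublevel w a)"
    using closed_energy_sublevel[OF a w] by (simp add: frontier_def)
  ultimately show ?thesis by blast
qed

text \<open>Moving towards the \<open>r\<close>-axis lowers the Hamiltonian, and the sublevel set meets the
  axis in an interval around \<open>r = w^2 * beta_par a\<close>.\<close>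

lemma Ham_retract [extraction_expand]:
  assumes a: "0 < a" and x: "x \<in> phase_space" and t: "0 \<le> t" "t \<le> 1"
  defines "y \<equiv> (1 - t) *\<^sub>R x + t *\<^sub>R mk4 0 0 (x $ 3) 0"
  shows "y \<in> phase_space" "Ham w a y \<le> Ham w a x"
    and "0 < t \<Longrightarrow> x \<noteq> mk4 0 0 (x $ 3) 0 \<Longrightarrow> Ham w a y < Ham w a x"
proof -
  have r: "0 < x $ 3" using x by (simp add: phase_space_def)
  have y: "y $ 1 = (1 - t) * x $ 1" "y $ 2 = (1 - t) * x $ 2" "y $ 3 = x $ 3" "y $ 4 = (1 - t) * x $ 4"
    by (simp_all add: y_def algebra_simps)
  show "y \<in> phase_space" using r y by (simp add: phase_space_def)
  have sq: "((1 - t) * u)^2 \<le> u^2" for u :: real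
  proof -
    have "(1 - t)^2 * u^2 \<le> 1 * u^2" using t by (intro mult_right_mono power_le_one) auto
    then show ?thesis by (simp add: power_mult_distrib)
  qed
  have hl: "hill w a (x $ 3) (x $ 4) \<le> hill w a (x $ 3) (y $ 4)"
    using hill_antimono[OF a r sq] y by simp
  have "(p' + q') / 2 - W' - 1 \<le> (p + q) / 2 - W - 1" if "p' \<le> p" "q' \<le> q" "W \<le> W'"
    for p p' q q' W W' :: real
    using that by (simp add: add_divide_distrib)
  then show "Ham w a y \<le> Ham w a x"
    using sq[of "x $ 1"] sq[of "x $ 2"] hl unfolding Ham_eq y(1-3) by blast
  assume t0: "0 < t" and ne: "x \<noteq> mk4 0 0 (x $ 3) 0"
  have sq': "((1 - t) * u)^2 < u^2" if "u \<noteq> 0" for u :: real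
  proof -
    have "(1 - t)^2 < 1" using t t0 by (simp add: power_less_one_iff)
    then have "(1 - t)^2 * u^2 < 1 * u^2" using that by (intro mult_strict_right_mono) auto
    then show ?thesis by (simp add: power_mult_distrib)
  qed
  have hl': "hill w a (x $ 3) (x $ 4) < hill w a (x $ 3) (y $ 4)" if "x $ 4 \<noteq> 0"
  proof -
    have "rho a (x $ 3) (y $ 4) < rho a (x $ 3) (x $ 4)"
      unfolding rho_def y(4) using sq'[OF that] a by (simp add: mult_strict_left_mono)
    then have "(4 / a) / rho a (x $ 3) (x $ 4) < (4 / a) / rho a (x $ 3) (y $ 4)"
      using a rho_pos[OF a r] by (intro divide_strict_left_mono mult_pos_pos) auto
    then show ?thesis by (simp add: hill_def)
  qed
  have "(p' + q') / 2 - W' - 1 < (p + q) / 2 - W - 1"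
    if "p' \<le> p" "q' \<le> q" "W \<le> W'" "p' < p \<or> q' < q \<or> W < W'" for p p' q q' W W' :: real
    using that by (auto simp: add_divide_distrib)
  moreover from ne have "x $ 1 \<noteq> 0 \<or> x $ 2 \<noteq> 0 \<or> x $ 4 \<noteq> 0" by (auto simp: vec4_eq_iff)
  then have "((1 - t) * x $ 1)^2 < (x $ 1)^2 \<or> ((1 - t) * x $ 2)^2 < (x $ 2)^2
      \<or> hill w a (x $ 3) (x $ 4) < hill w a (x $ 3) (y $ 4)"
    using sq' hl' by blast
  ultimately show "Ham w a y < Ham w a x"
    using sq[of "x $ 1"] sq[of "x $ 2"] hl unfolding Ham_eq y(1-3) by blast
qed

lemma Ham_axis [extraction_expand]:
  assumes a: "0 < a" and r: "0 < r"
  shows "(Ham w a (mk4 0 0 r 0) + 1) * r^2 = r^2 - r / beta_par a + w^2 / 2"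
proof -
  have "rho a r 0 = r" using r by (simp add: rho_def)
  then show ?thesis
    using r by (simp add: Ham_eq hill_def beta_par_def power2_eq_square field_simps)
qed

lemma Ham_axis_le [extraction_expand]:
  assumes "0 < a" "0 < r"
  shows "Ham w a (mk4 0 0 r 0) < -1 \<longleftrightarrow> r^2 - r / beta_par a + w^2 / 2 < 0"
    and "Ham w a (mk4 0 0 r 0) \<le> -1 \<longleftrightarrow> r^2 - r / beta_par a + w^2 / 2 \<le> 0"
  unfolding Ham_axis[OF assms, symmetric] using assms(2) by (auto simp: mult_less_0_iff mult_le_0_iff)

text \<open>On the axis the sublevel set is cut out by a convex parabola in \<open>r\<close>. The
  target \<open>w^2 * beta_par a\<close> is the radius of the planar circular orbit, whose energy is
  below \<open>-1\<close> exactly if \<open>2 * w^2 * (beta_par a)^2 < 1\<close>.\<close>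

lemma axis_segment [extraction_expand]:
  assumes a: "0 < a" and w: "0 < w" and S: "2 * w^2 * (beta_par a)^2 < 1"
    and r: "0 < r" "Ham w a (mk4 0 0 r 0) \<le> -1" and t: "0 \<le> t" "t \<le> 1"
    and st: "0 < t \<or> Ham w a (mk4 0 0 r 0) < -1"
  shows "(1 - t) *\<^sub>R mk4 0 0 r 0 + t *\<^sub>R mk4 0 0 (w^2 * beta_par a) 0 \<in> interior_sublevel w a"
proof -
  define b where "b = beta_par a"
  have b: "0 < b" using beta_par_bounds[OF a] by (simp add: b_def)
  define r1 where "r1 = w^2 * b"
  have r1: "0 < r1" using w b by (simp add: r1_def)
  define \<phi> where "\<phi> r = r^2 - r / b + w^2 / 2" for r
  have \<phi>1: "\<phi> r1 < 0"
  proof -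
    have "\<phi> r1 = w^2 * (2 * w^2 * b^2 - 1) / 2"
      using b by (simp add: \<phi>_def r1_def field_simps power2_eq_square)
    also have "\<dots> < 0" using S w by (simp add: b_def mult_pos_neg)
    finally show ?thesis .
  qed
  have \<phi>r: "\<phi> r \<le> 0" using r Ham_axis_le(2)[OF a r(1)] by (simp add: \<phi>_def b_def)
  define s where "s = (1 - t) * r + t * r1"
  have s: "0 < s"
  proof (cases "t = 0")
    case False
    then show ?thesis using t r r1 unfolding s_def by (intro add_nonneg_pos mult_pos_pos mult_nonneg_nonneg) auto
  qed (use r in \<open>simp add: s_def\<close>)
  have "\<phi> s = (1 - t) * \<phi> r + t * \<phi> r1 - t * (1 - t) * (r - r1)^2"
    unfolding \<phi>_def s_def using b by (simp add: field_simps power2_eq_square)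
  also have "\<dots> < 0"
  proof -
    have "(1 - t) * \<phi> r \<le> 0" "t * \<phi> r1 \<le> 0" "0 \<le> t * (1 - t) * (r - r1)^2"
      using t \<phi>r \<phi>1 by (auto intro: mult_nonneg_nonpos)
    moreover have "(1 - t) * \<phi> r < 0 \<or> t * \<phi> r1 < 0"
    proof (cases "t = 0")
      case True
      then have "\<phi> r < 0" using st Ham_axis_le(1)[OF a r(1)] by (simp add: \<phi>_def b_def)
      then show ?thesis using True by simp
    next
      case False
      then show ?thesis using t \<phi>1 by (simp add: mult_pos_neg)
    qed
    ultimately show ?thesis by linarith
  qed
  finally have "Ham w a (mk4 0 0 s 0) < -1" using Ham_axis_le(1)[OF a s] by (simp add: \<phi>_def b_def)
  moreover have "(1 - t) *\<^sub>R mk4 0 0 r 0 + t *\<^sub>R mk4 0 0 (w^2 * beta_par a) 0 = mk4 0 0 s 0"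
    by (simp add: vec4_eq_iff s_def r1_def b_def)
  ultimately show ?thesis using s by (simp add: interior_sublevel_def phase_space_def)
qed

lemma connected_interior_sublevel [extraction_expand]:
  assumes a: "0 < a" and w: "0 < w" and S: "2 * w^2 * (beta_par a)^2 < 1"
  shows "connected (interior_sublevel w a)"
proof -
  let ?U = "interior_sublevel w a" and ?o = "mk4 0 0 (w^2 * beta_par a) 0"
  have "connected_component ?U x ?o" if x: "x \<in> ?U" for x
  proof -
    have xp: "x \<in> phase_space" "Ham w a x < -1" using x by (auto simp: interior_sublevel_def)
    then have r: "0 < x $ 3" by (simp add: phase_space_def)
    let ?p = "mk4 0 0 (x $ 3) 0"
    have "closed_segment x ?p \<subseteq> ?U"
      using Ham_retract(1)[OF a xp(1)] Ham_retract(2)[OF a xp(1), of _ w] xp(2)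
      unfolding closed_segment_def interior_sublevel_def by fastforce
    moreover then have hp: "Ham w a ?p < -1" using ends_in_segment(2)[of ?p x] by (auto simp: interior_sublevel_def)
    have "closed_segment ?p ?o \<subseteq> ?U"
      using axis_segment[OF a w S r less_imp_le[OF hp]] hp unfolding closed_segment_def by blast
    ultimately have "connected_component ?U x ?p" "connected_component ?U ?p ?o"
      unfolding connected_component_def
      by (metis connected_segment ends_in_segment)+
    then show ?thesis by (rule connected_component_trans)
  qed
  then show ?thesis
    unfolding connected_iff_connected_component by (meson connected_component_sym connected_component_trans)
qed

lemma limit_along_segment [extraction_expand]:
  fixes x y :: "'a::real_normed_vector"
  assumes "\<And>t. 0 < t \<Longrightarrow> t \<le> 1 \<Longrightarrow> (1 - t) *\<^sub>R x + t *\<^sub>R y \<in> U"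
  shows "x \<in> closure U"
proof (rule Lim_in_closed_set[OF closed_closure])
  show "((\<lambda>t. (1 - t) *\<^sub>R x + t *\<^sub>R y) \<longlongrightarrow> x) (at_right 0)"
    by (auto intro!: tendsto_eq_intros)
  have "\<forall>\<^sub>F t in at_right (0::real). t \<in> {0<..<1}"
    by (rule eventually_at_right_real) simp
  then show "\<forall>\<^sub>F t in at_right 0. (1 - t) *\<^sub>R x + t *\<^sub>R y \<in> closure U"
    by eventually_elim (use assms closure_subset in fastforce)
qed simp

text \<open>This carries convexity from the open set to the closed one. Points off the axis are
  limits along the retraction, points on it along the axis towards the circular orbit.\<close>

lemma closure_interior_sublevel [extraction_expand]:
  assumes a: "0 < a" and w: "0 < w" and S: "2 * w^2 * (beta_par a)^2 < 1"
  shows "closure (interior_sublevel w a) = energy_sublevel w a"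
proof
  show "closure (interior_sublevel w a) \<subseteq> energy_sublevel w a"
    by (rule closure_minimal[OF _ closed_energy_sublevel[OF a w]])
      (auto simp: interior_sublevel_def energy_sublevel_def)
  show "energy_sublevel w a \<subseteq> closure (interior_sublevel w a)"
  proof
    fix x assume "x \<in> energy_sublevel w a"
    then have x: "x \<in> phase_space" "Ham w a x \<le> -1" by (auto simp: energy_sublevel_def)
    then have r: "0 < x $ 3" by (simp add: phase_space_def)
    let ?p = "mk4 0 0 (x $ 3) 0"
    show "x \<in> closure (interior_sublevel w a)"
    proof (cases "x = ?p")
      case True
      then have "Ham w a ?p \<le> -1" using x by metis
      then have "?p \<in> closure (interior_sublevel w a)"
        by (intro limit_along_segment[OF axis_segment[OF a w S r]]) auto
      then show ?thesis using True by metis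
    next
      case False
      show ?thesis
      proof (rule limit_along_segment)
        fix t :: real assume "0 < t" "t \<le> 1"
        then show "(1 - t) *\<^sub>R x + t *\<^sub>R ?p \<in> interior_sublevel w a"
          using Ham_retract(1)[OF a x(1), of t] Ham_retract(3)[OF a x(1), of t w] x(2) False by (force simp: interior_sublevel_def)
      qed
    qed
  qed
qed

section \<open>Convexity of the surface and its failure\<close>

lemma convex_interior_sublevel_above [extraction_expand]:
  assumes a: "0 < a" and w: "0 < w"
    and S: "Scrit (beta_par a) < 2 * w^2 * (beta_par a)^2" "2 * w^2 * (beta_par a)^2 < 1"
  shows "convex (interior_sublevel w a)"
  unfolding interior_sublevel_def
proof (rule convex_strict_sublevel[OF open_phase_space Ham_has_derivative[OF a] dHam_has_derivative[OF a]])
  show "closed {x \<in> phase_space. Ham w a x \<le> -1}"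
    using closed_energy_sublevel[OF a w] by (simp add: energy_sublevel_def)
  show "connected {x \<in> phase_space. Ham w a x < -1}"
    using connected_interior_sublevel[OF a w S(2)] by (simp add: interior_sublevel_def)
  show "0 < ddHam w a x v v"
    if "x \<in> phase_space" "Ham w a x = -1" "v \<noteq> 0" "dHam w a x v = 0" for x v
    by (rule ddHam_pos[OF a w that S])
qed

text \<open>At the critical level, the open sublevel set is an increasing union of those for larger
  angular momentum.\<close>

lemma convex_interior_sublevel [extraction_expand]:
  assumes a: "0 < a" and w: "0 < w"
    and S: "Scrit (beta_par a) \<le> 2 * w^2 * (beta_par a)^2" "2 * w^2 * (beta_par a)^2 < 1"
  shows "convex (interior_sublevel w a)"
  unfolding convex_contains_segment
proof (intro ballI)
  fix x y assume xy: "x \<in> interior_sublevel w a" "y \<in> interior_sublevel w a"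
  have b: "0 < beta_par a" using beta_par_bounds[OF a] by simp
  let ?T = "{v. Ham v a x < -1 \<and> Ham v a y < -1 \<and> 2 * v^2 * (beta_par a)^2 < 1}"
  have "open ?T"
    unfolding Ham_eq hill_def divide_inverse[of "_^2" "2 * _"]
    by (intro open_Collect_conj open_Collect_less continuous_intros)
  moreover have "w \<in> ?T" using xy S by (simp add: interior_sublevel_def)
  ultimately obtain e where e: "0 < e" "ball w e \<subseteq> ?T" by (meson openE)
  define v where "v = w + e / 2"
  have v: "0 < v" "w < v" using w e by (auto simp: v_def)
  have "v \<in> ball w e" using e by (simp add: v_def dist_real_def)
  then have vT: "v \<in> ?T" using e(2) by (meson subsetD)
  have sq: "w^2 < v^2" using v w by (intro power_strict_mono) auto
  then have "2 * w^2 * (beta_par a)^2 < 2 * v^2 * (beta_par a)^2" using b by simp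
  then have "convex (interior_sublevel v a)"
    using convex_interior_sublevel_above[OF a v(1)] S vT by simp
  moreover have "x \<in> interior_sublevel v a" "y \<in> interior_sublevel v a"
    using xy vT by (auto simp: interior_sublevel_def)
  ultimately have "closed_segment x y \<subseteq> interior_sublevel v a"
    by (simp add: convex_contains_segment)
  moreover have "interior_sublevel v a \<subseteq> interior_sublevel w a"
  proof
    fix p assume p: "p \<in> interior_sublevel v a"
    have "w^2 / (2 * (p $ 3)^2) \<le> v^2 / (2 * (p $ 3)^2)" using sq by (intro divide_right_mono) auto
    then show "p \<in> interior_sublevel w a" using p by (simp add: interior_sublevel_def Ham_eq hill_def)
  qed
  ultimately show "closed_segment x y \<subseteq> interior_sublevel w a" by blast
qed

lemma surface_convex_if [extraction_expand]:
  assumes a: "0 < a" and w: "0 < w"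
    and S: "Scrit (beta_par a) \<le> 2 * w^2 * (beta_par a)^2" "2 * w^2 * (beta_par a)^2 < 1"
  shows "surface_convex w a"
  unfolding surface_convex_def
  using frontier_energy_sublevel[OF a w] convex_closure[OF convex_interior_sublevel[OF a w S]]
    closure_interior_sublevel[OF a w S(2)] by simp

lemma surface_strictly_convex_if [extraction_expand]:
  assumes a: "0 < a" and w: "0 < w"
    and S: "Scrit (beta_par a) < 2 * w^2 * (beta_par a)^2" "2 * w^2 * (beta_par a)^2 < 1"
  shows "surface_strictly_convex w a"
  unfolding surface_strictly_convex_def
proof (intro conjI ballI impI)
  show "surface_convex w a" using surface_convex_if[OF a w] S by simp
  fix x v assume x: "x \<in> energy_surface w a" and v: "v \<in> level_tangent (Ham w a) x" "v \<noteq> 0"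
  have xp: "x \<in> phase_space" "Ham w a x = -1" using x by (auto simp: energy_surface_def)
  show "0 < hessian (Ham w a) x v v"
    using ddHam_pos[OF a w xp v(2) _ S] v(1) level_tangent_Ham[OF a xp(1)] hessian_Ham[OF a xp(1)] by simp
qed

lemma not_strictly_convex_if [extraction_expand]:
  assumes a: "0 < a" and w: "0 < w"
    and S: "2 * w^2 * (beta_par a)^2 \<le> Scrit (beta_par a)"
  shows "\<not> surface_strictly_convex w a"
proof
  assume sc: "surface_strictly_convex w a"
  obtain x v where x: "x \<in> phase_space" "Ham w a x = -1" "v \<noteq> 0" "dHam w a x v = 0" "ddHam w a x v v \<le> 0"
    using degenerate_direction[OF a w S] by metis
  then have "0 < hessian (Ham w a) x v v"
    using sc level_tangent_Ham[OF a x(1)] unfolding surface_strictly_convex_def by (auto simp: energy_surface_def)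
  then show False using x hessian_Ham[OF a x(1)] by simp
qed

text \<open>Along a tangent line of negative curvature both neighbours
  \<open>x + h *\<^sub>R v\<close> and \<open>x - h *\<^sub>R v\<close> lie strictly inside, so
  convexity of the interior would put their midpoint \<open>x\<close>, a boundary point, into the
  interior.\<close>

lemma not_convex_if [extraction_expand]:
  assumes a: "0 < a" and w: "0 < w"
    and S: "2 * w^2 * (beta_par a)^2 < Scrit (beta_par a)"
  shows "\<not> surface_convex w a"
proof
  assume sc: "surface_convex w a"
  obtain x v where x: "x \<in> phase_space" "Ham w a x = -1" "v \<noteq> 0" "dHam w a x v = 0" "ddHam w a x v v < 0"
    using degenerate_direction[OF a w less_imp_le[OF S]] S by metis
  have "open {t. 0 < (x + t *\<^sub>R v) $ 3}"
    by (simp, intro open_Collect_less continuous_intros)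
  moreover have "0 \<in> {t. 0 < (x + t *\<^sub>R v) $ 3}" using x by (simp add: phase_space_def)
  ultimately obtain d where d: "0 < d" "ball 0 d \<subseteq> {t. 0 < (x + t *\<^sub>R v) $ 3}" by (meson openE)
  have ps: "x + t *\<^sub>R v \<in> phase_space" if "\<bar>t\<bar> < d" for t
  proof -
    have "t \<in> ball 0 d" using that by (simp add: dist_real_def)
    then show ?thesis using d(2) by (auto simp: phase_space_def)
  qed
  have lin: "((\<lambda>s. x + s *\<^sub>R v) has_derivative (\<lambda>h. h *\<^sub>R v)) (at s)" for s
    by (auto intro!: derivative_eq_intros)
  \<comment> \<open>The sign turns negative curvature into a strict local minimum at
    \<open>0\<close>, as \<open>second_derivative_min\<close> requires.\<close>
  define \<phi> where "\<phi> s = - Ham w a (x + s *\<^sub>R v)" for s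
  have d1: "(\<phi> has_real_derivative - dHam w a (x + s *\<^sub>R v) v) (at s)" if "\<bar>s - 0\<bar> < d" for s
  proof -
    have H: "(Ham w a has_derivative dHam w a (x + s *\<^sub>R v)) (at (x + s *\<^sub>R v))"
      using Ham_has_derivative[OF a ps] that by simp
    have "dHam w a (x + s *\<^sub>R v) (h *\<^sub>R v) = dHam w a (x + s *\<^sub>R v) v * h" for h
      using linear_cmul[OF has_derivative_linear[OF H]] by simp
    then have "((\<lambda>s. Ham w a (x + s *\<^sub>R v)) has_real_derivative dHam w a (x + s *\<^sub>R v) v) (at s)"
      using has_derivative_compose[OF lin H] by (simp add: has_field_derivative_def)
    then show ?thesis unfolding \<phi>_def[abs_def] by (rule DERIV_minus)
  qed
  have d2: "((\<lambda>s. - dHam w a (x + s *\<^sub>R v) v) has_real_derivative - ddHam w a x v v) (at 0)"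
  proof -
    have H: "((\<lambda>y. dHam w a y v) has_derivative ddHam w a (x + 0 *\<^sub>R v) v) (at (x + 0 *\<^sub>R v))"
      using dHam_has_derivative[OF a x(1)] by simp
    have "ddHam w a x v (h *\<^sub>R v) = ddHam w a x v v * h" for h
      using linear_cmul[OF has_derivative_linear[OF H]] by simp
    then have "((\<lambda>s. dHam w a (x + s *\<^sub>R v) v) has_real_derivative ddHam w a x v v) (at 0)"
      using has_derivative_compose[OF lin H] by (simp add: has_field_derivative_def)
    then show ?thesis by (rule DERIV_minus)
  qed
  obtain e where e: "0 < e" "\<And>h. 0 < \<bar>h\<bar> \<Longrightarrow> \<bar>h\<bar> < e \<Longrightarrow> \<phi> 0 < \<phi> (0 + h)"
    using second_derivative_min[OF d(1) d1 d2] x(4,5) by auto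
  define h where "h = min d e / 2"
  have h: "0 < h" "h < d" "h < e" using d e by (auto simp: h_def)
  have near: "x + t *\<^sub>R v \<in> interior_sublevel w a" if "\<bar>t\<bar> = h" for t
    using e(2)[of t] ps[of t] h that x(2) by (simp add: interior_sublevel_def \<phi>_def)
  let ?A = "energy_sublevel w a"
  have sub: "interior_sublevel w a \<subseteq> interior ?A"
    using open_interior_sublevel[OF a]
    by (intro interior_maximal) (auto simp: interior_sublevel_def energy_sublevel_def)
  have "convex (interior ?A)" using sc by (simp add: surface_convex_def convex_interior)
  moreover have "x + h *\<^sub>R v \<in> interior ?A" "x + (- h) *\<^sub>R v \<in> interior ?A"
    using near[of h] near[of "- h"] h sub by auto
  ultimately have "(1/2) *\<^sub>R (x + h *\<^sub>R v) + (1/2) *\<^sub>R (x + (- h) *\<^sub>R v) \<in> interior ?A"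
    by (intro convexD) auto
  moreover have "(1/2) *\<^sub>R (x + h *\<^sub>R v) + (1/2) *\<^sub>R (x + (- h) *\<^sub>R v) = x"
    by (simp add: vec_eq_iff field_simps)
  ultimately show False
    using energy_surface_not_interior[of x w a] x by (simp add: energy_surface_def)
qed

theorem theorem2p11:
  shows "\<exists>e_conv :: real \<Rightarrow> real.
    e_conv \<in> {0..1} \<rightarrow> {0..1} \<and>
    strict_antimono_on {0..1} e_conv \<and>
    concave_on {0..1} e_conv \<and>
    e_conv 0 = (7 + sqrt 17) / 16 \<and>
    e_conv 1 = 0 \<and>
    (\<forall>b \<in> {0<..<1}. (b, e_conv b) \<in> par_domain) \<and>
    (\<forall>b e w a :: real.
       (b, e) \<in> par_domain \<and> 0 < w \<and> 0 < a \<and> b = beta_par a \<and> e = ecc_par w a \<longrightarrow>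
         (e < e_conv b \<longleftrightarrow> surface_strictly_convex w a) \<and>
         (e = e_conv b \<longleftrightarrow> surface_convex w a \<and> \<not> surface_strictly_convex w a) \<and>
         (e > e_conv b \<longleftrightarrow> \<not> surface_convex w a))"
proof (rule exI[of _ e_crit], intro conjI allI impI)
  show "e_crit \<in> {0..1} \<rightarrow> {0..1}" by (rule e_crit_range)
  show "strict_antimono_on {0..1} e_crit" by (rule e_crit_strict_antimono)
  show "concave_on {0..1} e_crit" by (rule e_crit_concave)
  show "e_crit 0 = (7 + sqrt 17) / 16" by (rule e_crit_0)
  show "e_crit 1 = 0" by (rule e_crit_1)
  show "\<forall>b \<in> {0<..<1}. (b, e_crit b) \<in> par_domain" using e_crit_in_domain by blast
  fix b e w a :: real
  assume h: "(b, e) \<in> par_domain \<and> 0 < w \<and> 0 < a \<and> b = beta_par a \<and> e = ecc_par w a"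
  then have a: "0 < a" and w: "0 < w" and b: "b = beta_par a" and e0: "0 < e"
    by (auto simp: par_domain_def)
  define S where "S = 2 * w^2 * (beta_par a)^2"
  have e: "e = sqrt (1 - S)" using h by (simp add: ecc_par_def S_def)
  have S1: "S < 1" using e0 e by simp
  have cmp: "e < e_crit b \<longleftrightarrow> Scrit (beta_par a) < S" "e = e_crit b \<longleftrightarrow> S = Scrit (beta_par a)"
    "e_crit b < e \<longleftrightarrow> S < Scrit (beta_par a)"
    unfolding e e_crit_def b by auto
  have sv: "surface_strictly_convex w a \<longleftrightarrow> Scrit (beta_par a) < S"
    using surface_strictly_convex_if[OF a w] not_strictly_convex_if[OF a w] S1
    unfolding S_def by (meson not_le)
  have cv: "surface_convex w a \<longleftrightarrow> Scrit (beta_par a) \<le> S"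
    using surface_convex_if[OF a w] not_convex_if[OF a w] S1
    unfolding S_def by (meson not_le)
  show "e < e_crit b \<longleftrightarrow> surface_strictly_convex w a" using cmp sv by simp
  show "e = e_crit b \<longleftrightarrow> surface_convex w a \<and> \<not> surface_strictly_convex w a" using cmp sv cv by auto
  show "e > e_crit b \<longleftrightarrow> \<not> surface_convex w a" using cmp cv by auto
qed

end
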